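(* Let $M^m$ be a minimal submanifold of $\mathbb{S}^n$. Let $N(M)$ denote the normal bundle of $M$ inside $\mathbb{S}^n$. For the associated Jacobi operator $\mathcal{J}_M$ and $\lambda\in\mathbb{R}$, let $E^M_\lambda=\{V\in\Gamma(N(M))\mid \mathcal{J}_M(V)=\lambda V\}$ be the eigenspace. Then $\dim(E^M_{-m})\ge n-m$. The equality holds if and only if $M$ is isometric to $\mathbb{S}^m$. In particular, $\lambda_1(\mathcal{J}_M)\le -m$.
   Context: $\mathbb{S}^n\subset\mathbb{R}^{n+1}$ is the unit sphere with its standard metric and Levi-Civita connection $\bar\nabla$. $M$ is an $m$-dimensional submanifold, with the metric and connection $\nabla$ induced via the isometric immersion into $\mathbb{S}^n$. $(\cdot)^T$ and $(\cdot)^\perp$ denote the orthogonal projections onto the tangent space $T_pM$ and onto the normal space $N_p(M)$, $p\in M$. The second fundamental form is $B(X,Y)=\bar\nabla_XY-\nabla_XY$ for $X,Y$ tangent to $M$, and $M$ is minimal if the mean curvature $H=\sum_{j=1}^mB(e_j,e_j)$ vanishes, where $\{e_j\}$ is an orthonormal basis of $T_pM$. The normal connection is $\nabla^\perp_XV=(\bar\nabla_XV)^\perp$ for sections $V$ of $N(M)$; $\Gamma(N(M))$ is the space of sections of $N(M)$. The Jacobi operator, which comes from the second variation of area, is, for $V\in\Gamma(N(M))$, $$\mathcal{J}_M(V)=\nabla^*\nabla V-\bar R(V)-\tilde A(V),$$ where $\nabla^*\nabla=-\Delta$ is $-1$ times the trace of the Hessian of $N(M)$ with respect to $\nabla^\perp$,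 $\bar R(V)=\sum_{j=1}^m(R^{\mathbb{S}^n}_{V,e_j}e_j)^\perp$ (which equals $mV$, with the curvature convention $\langle R_{X,Y}Y,X\rangle>0$ on the standard sphere), and $\tilde A$ is the symmetric transformation of $N_p(M)$ given by $\langle\tilde A(V),W\rangle=\sum_{j=1}^m\langle(\bar\nabla_{e_j}V)^T,(\bar\nabla_{e_j}W)^T\rangle$. $\lambda_1(\mathcal{J}_M)$ denotes the smallest eigenvalue of $\mathcal{J}_M$.
   Formalization: M is nonempty with m ≥ 1; the equality case is stated for compact M that is embedded, or connected with m ≥ 2 (a multiply covered great circle and an open part of S^n are counterexamples otherwise); the bound on λ_1 is stated for m < n, since for m = n there are no eigenvalues. *)

theory Defs
  imports "HOL-Analysis.Analysis" "HOL-Library.Function_Algebras" "HOL-Library.Extended_Nat"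
begin

section \<open>Smooth maps, submanifolds of Euclidean space, tangent spaces\<close>

text \<open>Meant for open \<open>U\<close>: all iterated directional derivatives up to order \<open>k\<close> exist and are
  continuous.\<close>

primrec Ck_on :: "nat \<Rightarrow> 'a::euclidean_space set \<Rightarrow> ('a \<Rightarrow> 'b::euclidean_space) \<Rightarrow> bool" where
  "Ck_on 0 U f \<longleftrightarrow> continuous_on U f"
| "Ck_on (Suc k) U f \<longleftrightarrow> (\<forall>x\<in>U. f differentiable (at x)) \<and>
     (\<forall>v. Ck_on k U (\<lambda>x. frechet_derivative f (at x) v))"

text \<open>Smoothness on an arbitrary set: locally the restriction of a smooth map on an open set.\<close>

definition smooth_on :: "'a::euclidean_space set \<Rightarrow> ('a \<Rightarrow> 'b::euclidean_space) \<Rightarrow> bool" where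
  "smooth_on S f \<longleftrightarrow> (\<forall>p\<in>S. \<exists>U g. open U \<and> p \<in> U \<and> (\<forall>k. Ck_on k U g) \<and> (\<forall>q\<in>S \<inter> U. f q = g q))"

text \<open>Embedded submanifolds of a Euclidean space, by slice charts.  By Whitney's theorem every
  (abstract) smooth manifold of dimension \<open>m\<close> is diffeomorphic to one of these, so they serve below
  as domains of immersions.\<close>

definition embedded_manifold :: "nat \<Rightarrow> 'a::euclidean_space set \<Rightarrow> bool" where
  "embedded_manifold m M \<longleftrightarrow> (\<forall>p\<in>M. \<exists>U W \<Phi> \<Psi> L.
     open U \<and> p \<in> U \<and> open W \<and> homeomorphism U W \<Phi> \<Psi> \<and> smooth_on U \<Phi> \<and> smooth_on W \<Psi> \<and>
     subspace (L :: 'a set) \<and> dim L = m \<and> \<Phi> ` (M \<inter> U) = W \<inter> L)"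

definition tangent_space :: "'a::euclidean_space set \<Rightarrow> 'a \<Rightarrow> 'a set" where
  "tangent_space M p = {v. \<exists>\<gamma> \<epsilon>. 0 < \<epsilon> \<and> smooth_on {-\<epsilon><..<\<epsilon>} \<gamma> \<and> \<gamma> ` {-\<epsilon><..<\<epsilon>} \<subseteq> M \<and>
     \<gamma> (0::real) = p \<and> (\<gamma> has_vector_derivative v) (at 0)}"

text \<open>For a map \<open>f\<close> on a submanifold \<open>M\<close>, \<^const>\<open>frechet_derivative\<close> with the filter
  \<^term>\<open>at p within M\<close> selects one of possibly many linear maps, but these all agree on
  \<open>tangent_space M p\<close>.  The differential is only ever applied to tangent vectors.\<close>

abbreviation differential ::
    "'a::euclidean_space set \<Rightarrow> ('a \<Rightarrow> 'b::euclidean_space) \<Rightarrow> 'a \<Rightarrow> 'a \<Rightarrow> 'b" where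
  "differential M f p \<equiv> frechet_derivative f (at p within M)"

definition orth_proj :: "'a::euclidean_space set \<Rightarrow> 'a \<Rightarrow> 'a" where
  "orth_proj S v = (THE u. u \<in> S \<and> (\<forall>w\<in>S. (v - u) \<bullet> w = 0))"

definition orthonormal_basis :: "'a::euclidean_space set \<Rightarrow> 'a set" where
  "orthonormal_basis S = (SOME b. b \<subseteq> S \<and> pairwise orthogonal b \<and> (\<forall>e\<in>b. norm e = 1) \<and> span b = S)"

section \<open>Immersions into the unit sphere\<close>

text \<open>The sphere \<open>S\<^sup>n\<close> is \<^term>\<open>sphere 0 1\<close> in a Euclidean space of dimension \<open>n + 1\<close>.  An immersed
  submanifold is a manifold \<open>M\<close> with an immersion \<open>F\<close> into the sphere; \<open>M\<close> carries the metric pulled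
  back by \<open>F\<close>, whatever Euclidean space \<open>M\<close> lies in.  An embedded submanifold of the
  sphere is the case where \<open>F\<close> is the identity.\<close>

abbreviation usphere :: "'a::euclidean_space set" where
  "usphere \<equiv> sphere 0 1"

definition immersed_in_sphere ::
    "nat \<Rightarrow> 'b::euclidean_space set \<Rightarrow> ('b \<Rightarrow> 'a::euclidean_space) \<Rightarrow> bool" where
  "immersed_in_sphere m M F \<longleftrightarrow> embedded_manifold m M \<and> smooth_on M F \<and> F ` M \<subseteq> usphere \<and>
     (\<forall>p\<in>M. inj_on (differential M F p) (tangent_space M p))"

text \<open>As usual, \<open>T\<^sub>pM\<close> is identified with its image under the differential of \<open>F\<close>, so that it becomes
  a subspace of the tangent space of the sphere at \<open>F p\<close>.  All vector fields on \<open>M\<close>, tangent or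
  normal, are accordingly functions into the Euclidean space containing the sphere.\<close>

definition tang :: "'b::euclidean_space set \<Rightarrow> ('b \<Rightarrow> 'a::euclidean_space) \<Rightarrow> 'b \<Rightarrow> 'a set" where
  "tang M F p = differential M F p ` tangent_space M p"

definition nor :: "'b::euclidean_space set \<Rightarrow> ('b \<Rightarrow> 'a::euclidean_space) \<Rightarrow> 'b \<Rightarrow> 'a set" where
  "nor M F p = {v \<in> tangent_space usphere (F p). \<forall>x\<in>tang M F p. v \<bullet> x = 0}"

text \<open>The derivative at \<open>p\<close>, in the Euclidean space containing the sphere, of a field \<open>V\<close> along \<open>F\<close>
  in the direction of the tangent field \<open>X\<close>.\<close>

definition field_deriv :: "'b::euclidean_space set \<Rightarrow> ('b \<Rightarrow> 'a::euclidean_space) \<Rightarrow>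
    ('b \<Rightarrow> 'a) \<Rightarrow> ('b \<Rightarrow> 'a) \<Rightarrow> 'b \<Rightarrow> 'a" where
  "field_deriv M F X V p =
     differential M V p (inv_into (tangent_space M p) (differential M F p) (X p))"

text \<open>The Levi-Civita connection of the sphere acting on fields along \<open>F\<close>, and the connection it
  induces on the tangent and on the normal bundle of \<open>M\<close>.\<close>

definition sconn :: "'b::euclidean_space set \<Rightarrow> ('b \<Rightarrow> 'a::euclidean_space) \<Rightarrow>
    ('b \<Rightarrow> 'a) \<Rightarrow> ('b \<Rightarrow> 'a) \<Rightarrow> 'b \<Rightarrow> 'a" where
  "sconn M F X V p = orth_proj (tangent_space usphere (F p)) (field_deriv M F X V p)"

definition tconn :: "'b::euclidean_space set \<Rightarrow> ('b \<Rightarrow> 'a::euclidean_space) \<Rightarrow>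
    ('b \<Rightarrow> 'a) \<Rightarrow> ('b \<Rightarrow> 'a) \<Rightarrow> 'b \<Rightarrow> 'a" where
  "tconn M F X Y p = orth_proj (tang M F p) (sconn M F X Y p)"

definition nconn :: "'b::euclidean_space set \<Rightarrow> ('b \<Rightarrow> 'a::euclidean_space) \<Rightarrow>
    ('b \<Rightarrow> 'a) \<Rightarrow> ('b \<Rightarrow> 'a) \<Rightarrow> 'b \<Rightarrow> 'a" where
  "nconn M F X V p = orth_proj (nor M F p) (sconn M F X V p)"

text \<open>To evaluate tensors defined through fields on a single tangent vector \<open>v\<close>, we extend \<open>v\<close> to the
  smooth tangent field whose value at \<open>q\<close> is the projection of \<open>v\<close> onto the tangent space at \<open>q\<close>.
  Tensoriality makes the choice of the extension, like that of the orthonormal bases, immaterial.\<close>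

definition tang_ext :: "'b::euclidean_space set \<Rightarrow> ('b \<Rightarrow> 'a::euclidean_space) \<Rightarrow> 'a \<Rightarrow> 'b \<Rightarrow> 'a" where
  "tang_ext M F v q = orth_proj (tang M F q) v"

definition second_fund :: "'b::euclidean_space set \<Rightarrow> ('b \<Rightarrow> 'a::euclidean_space) \<Rightarrow>
    ('b \<Rightarrow> 'a) \<Rightarrow> ('b \<Rightarrow> 'a) \<Rightarrow> 'b \<Rightarrow> 'a" where
  "second_fund M F X Y p = sconn M F X Y p - tconn M F X Y p"

definition mean_curvature :: "'b::euclidean_space set \<Rightarrow> ('b \<Rightarrow> 'a::euclidean_space) \<Rightarrow> 'b \<Rightarrow> 'a" where
  "mean_curvature M F p =
     (\<Sum>e\<in>orthonormal_basis (tang M F p). second_fund M F (tang_ext M F e) (tang_ext M F e) p)"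

definition minimal :: "'b::euclidean_space set \<Rightarrow> ('b \<Rightarrow> 'a::euclidean_space) \<Rightarrow> bool" where
  "minimal M F \<longleftrightarrow> (\<forall>p\<in>M. mean_curvature M F p = 0)"

section \<open>The Jacobi operator\<close>

definition normal_hessian :: "'b::euclidean_space set \<Rightarrow> ('b \<Rightarrow> 'a::euclidean_space) \<Rightarrow>
    ('b \<Rightarrow> 'a) \<Rightarrow> ('b \<Rightarrow> 'a) \<Rightarrow> ('b \<Rightarrow> 'a) \<Rightarrow> 'b \<Rightarrow> 'a" where
  "normal_hessian M F V X Y p =
     nconn M F X (nconn M F Y V) p - nconn M F (tconn M F X Y) V p"

definition normal_laplacian :: "'b::euclidean_space set \<Rightarrow> ('b \<Rightarrow> 'a::euclidean_space) \<Rightarrow>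
    ('b \<Rightarrow> 'a) \<Rightarrow> 'b \<Rightarrow> 'a" where
  "normal_laplacian M F V p =
     (\<Sum>e\<in>orthonormal_basis (tang M F p). normal_hessian M F V (tang_ext M F e) (tang_ext M F e) p)"

text \<open>The curvature of the sphere, as the sphere immersed in itself by the identity, with the sign
  \<open>R(X,Y)Z = \<nabla>\<^sub>X\<nabla>\<^sub>YZ - \<nabla>\<^sub>Y\<nabla>\<^sub>XZ - \<nabla>\<^bsub>[X,Y]\<^esub>Z\<close>, which makes \<open>R(X,Y)Y \<bullet> X\<close> positive.\<close>

definition sphere_curv_field :: "('a::euclidean_space \<Rightarrow> 'a) \<Rightarrow> ('a \<Rightarrow> 'a) \<Rightarrow> ('a \<Rightarrow> 'a) \<Rightarrow> 'a \<Rightarrow> 'a" where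
  "sphere_curv_field X Y Z =
     (let D = sconn usphere (\<lambda>x. x);
          bracket = (\<lambda>q. field_deriv usphere (\<lambda>x. x) X Y q - field_deriv usphere (\<lambda>x. x) Y X q)
      in (\<lambda>p. D X (D Y Z) p - D Y (D X Z) p - D bracket Z p))"

definition sphere_curv :: "'a::euclidean_space \<Rightarrow> 'a \<Rightarrow> 'a \<Rightarrow> 'a \<Rightarrow> 'a" where
  "sphere_curv p u v w =
     (let ext = tang_ext usphere (\<lambda>x. x) in sphere_curv_field (ext u) (ext v) (ext w) p)"

definition curv_term :: "'b::euclidean_space set \<Rightarrow> ('b \<Rightarrow> 'a::euclidean_space) \<Rightarrow>
    ('b \<Rightarrow> 'a) \<Rightarrow> 'b \<Rightarrow> 'a" where
  "curv_term M F V p =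
     (\<Sum>e\<in>orthonormal_basis (tang M F p). orth_proj (nor M F p) (sphere_curv (F p) (V p) e e))"

text \<open>Sections are set to zero outside \<open>M\<close>, so that distinct functions are distinct sections.\<close>

definition normal_sections :: "'b::euclidean_space set \<Rightarrow> ('b \<Rightarrow> 'a::euclidean_space) \<Rightarrow> ('b \<Rightarrow> 'a) set" where
  "normal_sections M F =
     {V. smooth_on M V \<and> (\<forall>p\<in>M. V p \<in> nor M F p) \<and> (\<forall>p. p \<notin> M \<longrightarrow> V p = 0)}"

definition simons_term :: "'b::euclidean_space set \<Rightarrow> ('b \<Rightarrow> 'a::euclidean_space) \<Rightarrow>
    ('b \<Rightarrow> 'a) \<Rightarrow> 'b \<Rightarrow> 'a" where
  "simons_term M F V p = (THE u. u \<in> nor M F p \<and> (\<forall>W\<in>normal_sections M F.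
     u \<bullet> W p = (\<Sum>e\<in>orthonormal_basis (tang M F p).
       orth_proj (tang M F p) (sconn M F (tang_ext M F e) V p) \<bullet>
       orth_proj (tang M F p) (sconn M F (tang_ext M F e) W p))))"

definition jacobi :: "'b::euclidean_space set \<Rightarrow> ('b \<Rightarrow> 'a::euclidean_space) \<Rightarrow>
    ('b \<Rightarrow> 'a) \<Rightarrow> 'b \<Rightarrow> 'a" where
  "jacobi M F V p = - normal_laplacian M F V p - curv_term M F V p - simons_term M F V p"

definition eigenspace :: "'b::euclidean_space set \<Rightarrow> ('b \<Rightarrow> 'a::euclidean_space) \<Rightarrow>
    real \<Rightarrow> ('b \<Rightarrow> 'a) set" where
  "eigenspace M F \<mu> = {V \<in> normal_sections M F. \<forall>p\<in>M. jacobi M F V p = \<mu> *\<^sub>R V p}"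

definition eigenvalues :: "'b::euclidean_space set \<Rightarrow> ('b \<Rightarrow> 'a::euclidean_space) \<Rightarrow> real set" where
  "eigenvalues M F = {\<mu>. \<exists>V\<in>eigenspace M F \<mu>. V \<noteq> (\<lambda>_. 0)}"

text \<open>The smallest eigenvalue, as an infimum so that the definition does not depend on the spectral
  theory that provides its existence for compact \<open>M\<close>.\<close>

definition lambda1 :: "'b::euclidean_space set \<Rightarrow> ('b \<Rightarrow> 'a::euclidean_space) \<Rightarrow> ereal" where
  "lambda1 M F = (INF \<mu>\<in>eigenvalues M F. ereal \<mu>)"

lemma lambda1_eq:
  assumes "\<mu> \<in> eigenvalues M F" "\<And>\<nu>. \<nu> \<in> eigenvalues M F \<Longrightarrow> \<mu> \<le> \<nu>"
  shows "lambda1 M F = ereal \<mu>"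
  unfolding lambda1_def
  by (rule antisym) (use assms in \<open>auto intro: INF_lower INF_greatest\<close>)

section \<open>Dimension of a space of sections\<close>

interpretation fun_space: vector_space
  "\<lambda>(c::real) (f :: 'b \<Rightarrow> 'a::real_vector). (\<lambda>x. c *\<^sub>R f x)"
  by unfold_locales (auto simp: plus_fun_def scaleR_right_distrib scaleR_left_distrib)

text \<open>The library's \<open>dim\<close> is \<open>0\<close> for infinite-dimensional spaces; here these have dimension \<open>\<infinity>\<close>.\<close>

definition edim :: "('b \<Rightarrow> 'a::real_vector) set \<Rightarrow> enat" where
  "edim E = (SUP B\<in>{B. finite B \<and> B \<subseteq> E \<and> \<not> fun_space.dependent B}. enat (card B))"

lemma edim_eq_card_basis:
  assumes "finite B" "B \<subseteq> E" "\<not> fun_space.dependent B" "E \<subseteq> fun_space.span B"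
  shows "edim E = enat (card B)"
proof (rule antisym)
  show "edim E \<le> enat (card B)"
    unfolding edim_def
    using fun_space.independent_span_bound[OF assms(1)] assms(4) by (force intro!: SUP_least)
  show "enat (card B) \<le> edim E"
    unfolding edim_def using assms by (auto intro: SUP_upper)
qed

section \<open>Isometry with the round sphere\<close>

text \<open>\<open>M\<close> with the metric induced by \<open>F\<close> is isometric, as a Riemannian manifold, to the submanifold
  \<open>N\<close> of a Euclidean space.\<close>

definition isometric_to :: "'b::euclidean_space set \<Rightarrow> ('b \<Rightarrow> 'a::euclidean_space) \<Rightarrow>
    'c::euclidean_space set \<Rightarrow> bool" where
  "isometric_to M F N \<longleftrightarrow> (\<exists>f g. homeomorphism M N f g \<and> smooth_on M f \<and> smooth_on N g \<and>
     (\<forall>p\<in>M. \<forall>x\<in>tangent_space M p. \<forall>y\<in>tangent_space M p.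
        differential M f p x \<bullet> differential M f p y = differential M F p x \<bullet> differential M F p y))"

end

theory Submission
  imports Defs
begin

text \<open>For a constant vector \<open>a\<close> let \<open>V\<close> be the section of the normal bundle obtained by projecting \<open>a\<close>.
  If \<open>P\<close> denotes the projection onto the tangent spaces, then \<open>(\<nabla>\<^sub>v P) P w\<close> is symmetric in \<open>v\<close> and \<open>w\<close> (it is
  the second fundamental form of the immersion into Euclidean space) and, by minimality, has trace
  \<open>- m F\<close>; differentiating this trace once more gives \<open>\<Delta> V = - A V\<close> for the Simons term \<open>A\<close>, so \<open>J V = - m V\<close>.
  Evaluation at a point shows that these sections span a space of dimension at least \<open>n - m\<close>.

  If they span no more, the normal spaces are constant, \<open>F\<close> takes values in a great sphere of
  dimension \<open>m\<close>, and it is a local diffeomorphism onto it, hence a covering.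

  Conversely, if \<open>M\<close> is the round sphere, the cone \<open>U x = |x| F (x / |x|)\<close> is an isometric immersion of flat space
  and harmonic. Applying the Laplacian to the constant function \<open>|\<partial>\<^sub>b U|\<^sup>2\<close> shows that \<open>U\<close> is linear.  The normal
  bundle is then flat with constant fibre, and an eigensection is a harmonic vector-valued function on
  the sphere, which is constant: integrate \<open>\<psi>(|x|) W \<cdot> \<Delta> W\<close> by parts for its extension \<open>W\<close> of degree \<open>0\<close>.\<close>

section \<open>Calculus of smooth maps on open sets\<close>

text \<open>A trace over the moving tangent space cannot be differentiated as it stands. It is
  rewritten as a sum over the fixed ambient \<open>Basis\<close> with \<open>P p b\<close> in one
  slot, and only the variation of this projection has to be accounted for. The number
  \<open>-m\<close> then comes from the curvature term alone, since the Laplacian of a projected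
  constant cancels the Simons term. In the converse, isometry of the flat cone with its image makes
  the second derivatives of \<open>U\<close> normal to the cone; this is what turns the Laplacian of
  the constant function into a sum of squares. The extension \<open>W\<close> is singular at the
  origin, so the integration by parts is confined to an annulus. The cut-off is radial, hence its
  gradient only meets the Euler derivative of \<open>W\<close>, which is zero. As just one
  integration by parts occurs, a cut-off of class C^1 is enough. In the other direction a local
  diffeomorphism onto a great sphere must be shown to be injective: if that is not assumed, it
  follows from lifting the identity of a simply connected sphere to a connected
  \<open>M\<close>.\<close>

abbreviation fderiv :: "('a::real_normed_vector \<Rightarrow> 'b::real_normed_vector) \<Rightarrow> 'a \<Rightarrow> 'a \<Rightarrow> 'b" where
  "fderiv f x \<equiv> frechet_derivative f (at x)"

lemma fderiv_eq: "(f has_derivative f') (at x) \<Longrightarrow> fderiv f x = f'"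
  by (metis frechet_derivative_at)

lemma fderiv_worksI: "f differentiable (at x) \<Longrightarrow> (f has_derivative fderiv f x) (at x)"
  by (simp add: frechet_derivative_works)

lemma Ck_on_cong:
  assumes "open U" "\<And>x. x \<in> U \<Longrightarrow> f x = g x" "Ck_on k U f"
  shows "Ck_on k U g"
  using assms(2,3)
proof (induction k arbitrary: f g)
  case 0
  then show ?case by (simp cong: continuous_on_cong)
next
  case (Suc k)
  have d: "g differentiable (at x)" if "x \<in> U" for x
    using Suc.prems that assms(1)
    by (metis Ck_on.simps(2) differentiable_def has_derivative_transform_within_open)
  have "fderiv f x = fderiv g x" if "x \<in> U" for x
    using Suc.prems that assms(1)
    by (intro frechet_derivative_transform_within_open[where X=U]) auto
  then show ?case
    using Suc.IH[of "\<lambda>x. fderiv f x v" "\<lambda>x. fderiv g x v" for v] Suc.prems d by simp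
qed

lemma Ck_on_SucD: "Ck_on (Suc k) U f \<Longrightarrow> Ck_on k U f"
proof (induction k arbitrary: f)
  case 0
  then show ?case
    by (auto intro!: differentiable_imp_continuous_on differentiable_at_imp_differentiable_on)
next
  case (Suc k)
  have "Ck_on k U (\<lambda>x. fderiv f x v)" for v
    by (rule Suc.IH) (use Suc.prems in simp)
  with Suc.prems show ?case by simp
qed

lemma Ck_on_subset: "Ck_on k U f \<Longrightarrow> V \<subseteq> U \<Longrightarrow> Ck_on k V f"
  by (induction k arbitrary: f) (auto intro: continuous_on_subset)

lemma Ck_on_local:
  assumes "\<And>x. x \<in> U \<Longrightarrow> \<exists>V. open V \<and> x \<in> V \<and> Ck_on k (U \<inter> V) f"
  shows "Ck_on k U f"
  using assms
proof (induction k arbitrary: f)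
  case 0
  have "(f \<longlongrightarrow> f x) (at x within U)" if x: "x \<in> U" for x
  proof -
    obtain V where V: "open V" "x \<in> V" "Ck_on 0 (U \<inter> V) f" using 0[OF x] by blast
    then have "(f \<longlongrightarrow> f x) (at x within (U \<inter> V))"
      using x unfolding Ck_on.simps continuous_on_def by blast
    moreover have "at x within (U \<inter> V) = at x within U"
      by (rule at_within_nhd[OF V(2,1)]) blast
    ultimately show ?thesis by simp
  qed
  then show ?case unfolding Ck_on.simps continuous_on_def by blast
next
  case (Suc k)
  have "f differentiable (at x)" if x: "x \<in> U" for x
  proof -
    obtain V where "x \<in> V" "Ck_on (Suc k) (U \<inter> V) f" using Suc.prems[OF x] by blast
    then show ?thesis using x unfolding Ck_on.simps by blast
  qed
  moreover have "Ck_on k U (\<lambda>x. fderiv f x v)" for v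
  proof (rule Suc.IH)
    fix x assume "x \<in> U"
    from Suc.prems[OF this] show "\<exists>V. open V \<and> x \<in> V \<and> Ck_on k (U \<inter> V) (\<lambda>x. fderiv f x v)"
      unfolding Ck_on.simps by blast
  qed
  ultimately show ?case unfolding Ck_on.simps by blast
qed

text \<open>On open sets smoothness needs no local extensions. This form, equivalent to
  \<open>smooth_on\<close> by \<open>smooth_on_open_iff\<close>, passes directly through the
  derivative rules.\<close>

definition smooth_open :: "'a::euclidean_space set \<Rightarrow> ('a \<Rightarrow> 'b::euclidean_space) \<Rightarrow> bool" where
  "smooth_open U f \<longleftrightarrow> (\<forall>k. Ck_on k U f)"

lemma smooth_openD_diff: "smooth_open U f \<Longrightarrow> x \<in> U \<Longrightarrow> f differentiable (at x)"
  unfolding smooth_open_def by (metis Ck_on.simps(2))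

lemma smooth_openD_deriv: "smooth_open U f \<Longrightarrow> x \<in> U \<Longrightarrow> (f has_derivative fderiv f x) (at x)"
  by (intro fderiv_worksI smooth_openD_diff)

lemma smooth_openD_fderiv: "smooth_open U f \<Longrightarrow> smooth_open U (\<lambda>x. fderiv f x v)"
  unfolding smooth_open_def by (metis Ck_on.simps(2))

lemma smooth_openD_cont: "smooth_open U f \<Longrightarrow> continuous_on U f"
  unfolding smooth_open_def by (metis Ck_on.simps(1))

lemma smooth_open_cong: "open U \<Longrightarrow> smooth_open U f \<Longrightarrow> (\<And>x. x \<in> U \<Longrightarrow> f x = g x) \<Longrightarrow> smooth_open U g"
  unfolding smooth_open_def by (metis Ck_on_cong)

lemma smooth_open_subset: "smooth_open U f \<Longrightarrow> V \<subseteq> U \<Longrightarrow> smooth_open V f"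
  unfolding smooth_open_def by (metis Ck_on_subset)

lemma smooth_on_open_iff:
  assumes "open U"
  shows "smooth_on U f \<longleftrightarrow> smooth_open U f"
proof
  assume *: "smooth_on U f"
  show "smooth_open U f"
    unfolding smooth_open_def
  proof (intro allI Ck_on_local)
    fix k x assume x: "x \<in> U"
    obtain V g where "open V" "x \<in> V" and g: "\<forall>k. Ck_on k V g" and eq: "\<forall>q\<in>U \<inter> V. f q = g q"
      using bspec[OF *[unfolded smooth_on_def] x] by (elim exE conjE) (rule that)
    have "Ck_on k (U \<inter> V) g" using g Ck_on_subset[of k V g] by auto
    then have "Ck_on k (U \<inter> V) f"
      using eq assms \<open>open V\<close> Ck_on_cong[of "U \<inter> V" g f k] by auto
    then show "\<exists>V. open V \<and> x \<in> V \<and> Ck_on k (U \<inter> V) f"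
      using \<open>open V\<close> \<open>x \<in> V\<close> by blast
  qed
next
  assume "smooth_open U f"
  then show "smooth_on U f"
    unfolding smooth_on_def smooth_open_def using assms by blast
qed

lemma Ck_on_const: "Ck_on k U (\<lambda>x. c)"
  by (induction k arbitrary: c) auto

lemma smooth_open_const [simp]: "smooth_open U (\<lambda>x. c)"
  by (simp add: smooth_open_def Ck_on_const)

lemma smooth_open_linear:
  assumes "bounded_linear f"
  shows "smooth_open U f"
proof -
  have d: "(f has_derivative f) (at x)" for x
    by (simp add: assms bounded_linear_imp_has_derivative)
  then have "fderiv f x = f" for x
    by (rule fderiv_eq)
  then have "Ck_on k U f" for k
    using d by (cases k)
      (auto simp: Ck_on_const differentiable_def linear_continuous_on assms)
  then show ?thesis by (simp add: smooth_open_def)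
qed

lemma smooth_open_ident: "smooth_open U (\<lambda>x. x)"
  by (simp add: smooth_open_linear bounded_linear_ident)

lemma Ck_on_add:
  assumes "open U"
  shows "Ck_on k U f \<Longrightarrow> Ck_on k U g \<Longrightarrow> Ck_on k U (\<lambda>x. f x + g x)"
proof (induction k arbitrary: f g)
  case 0 then show ?case by (simp add: continuous_on_add)
next
  case (Suc k)
  have d: "((\<lambda>x. f x + g x) has_derivative (\<lambda>v. fderiv f x v + fderiv g x v)) (at x)" if "x \<in> U" for x
    using Suc.prems that by (auto intro!: derivative_intros fderiv_worksI)
  have "Ck_on k U (\<lambda>x. fderiv (\<lambda>x. f x + g x) x v)" for v
    by (rule Ck_on_cong[OF assms, of "\<lambda>x. fderiv f x v + fderiv g x v"])
      (use Suc d in \<open>auto simp: fderiv_eq[OF d]\<close>)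
  then show ?case using d by (auto simp: differentiable_def)
qed

lemma smooth_open_add: "open U \<Longrightarrow> smooth_open U f \<Longrightarrow> smooth_open U g \<Longrightarrow> smooth_open U (\<lambda>x. f x + g x)"
  unfolding smooth_open_def by (metis Ck_on_add)

lemma Ck_on_sum:
  assumes "open U" "finite I"
  shows "(\<And>i. i \<in> I \<Longrightarrow> Ck_on k U (f i)) \<Longrightarrow> Ck_on k U (\<lambda>x. \<Sum>i\<in>I. f i x)"
  using assms(2) by (induction I) (auto simp: Ck_on_const intro: Ck_on_add[OF assms(1)])

lemma smooth_open_sum:
  assumes "open U" "finite I" "\<And>i. i \<in> I \<Longrightarrow> smooth_open U (f i)"
  shows "smooth_open U (\<lambda>x. \<Sum>i\<in>I. f i x)"
  using assms unfolding smooth_open_def by (metis Ck_on_sum)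

lemma Ck_on_bilinear:
  assumes "open U" "bounded_bilinear B"
  shows "Ck_on k U f \<Longrightarrow> Ck_on k U g \<Longrightarrow> Ck_on k U (\<lambda>x. B (f x) (g x))"
proof (induction k arbitrary: f g)
  case 0 then show ?case using assms by (simp add: bounded_bilinear.continuous_on)
next
  case (Suc k)
  have d: "((\<lambda>x. B (f x) (g x)) has_derivative (\<lambda>v. B (f x) (fderiv g x v) + B (fderiv f x v) (g x))) (at x)"
    if "x \<in> U" for x
    using Suc.prems that by (auto intro!: bounded_bilinear.FDERIV[OF assms(2)] fderiv_worksI)
  have "Ck_on k U (\<lambda>x. fderiv (\<lambda>x. B (f x) (g x)) x v)" for v
    by (rule Ck_on_cong[OF assms(1), of "\<lambda>x. B (f x) (fderiv g x v) + B (fderiv f x v) (g x)"])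
      (use Suc d Ck_on_SucD[OF Suc.prems(1)] Ck_on_SucD[OF Suc.prems(2)] in
         \<open>auto simp: fderiv_eq[OF d] intro!: Ck_on_add assms\<close>)
  then show ?case using d by (auto simp: differentiable_def)
qed

lemma smooth_open_bilinear:
  "open U \<Longrightarrow> bounded_bilinear B \<Longrightarrow> smooth_open U f \<Longrightarrow> smooth_open U g \<Longrightarrow> smooth_open U (\<lambda>x. B (f x) (g x))"
  unfolding smooth_open_def by (metis Ck_on_bilinear)

lemma Ck_on_diff:
  assumes "open U" "Ck_on k U f" "Ck_on k U g"
  shows "Ck_on k U (\<lambda>x. f x - g x)"
  using Ck_on_add[OF assms(1,2) Ck_on_bilinear[OF assms(1) bounded_bilinear_scaleR Ck_on_const[of _ _ "-1"] assms(3)]]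
  by simp

lemmas smooth_open_inner = smooth_open_bilinear[OF _ bounded_bilinear_inner]
lemmas smooth_open_scaleR = smooth_open_bilinear[OF _ bounded_bilinear_scaleR]
lemmas smooth_open_mult = smooth_open_bilinear[OF _ bounded_bilinear_mult]

lemma smooth_open_scaleR_const: "open U \<Longrightarrow> smooth_open U f \<Longrightarrow> smooth_open U (\<lambda>x. c *\<^sub>R f x)"
  by (rule smooth_open_scaleR) auto

lemma smooth_open_minus: "open U \<Longrightarrow> smooth_open U f \<Longrightarrow> smooth_open U (\<lambda>x. - f x)"
  using smooth_open_scaleR_const[of U f "-1"] by simp

lemma smooth_open_diff: "open U \<Longrightarrow> smooth_open U f \<Longrightarrow> smooth_open U g \<Longrightarrow> smooth_open U (\<lambda>x. f x - g x)"
  using smooth_open_add[of U f "\<lambda>x. - g x"] smooth_open_minus[of U g] by simp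

lemma linear_expand:
  fixes f :: "'a::euclidean_space \<Rightarrow> 'b::real_vector"
  assumes "linear f"
  shows "f x = (\<Sum>b\<in>Basis. (x \<bullet> b) *\<^sub>R f b)"
  by (metis (no_types, lifting) assms euclidean_representation linear_scale linear_sum sum.cong)

lemma linear_fderiv: "f differentiable (at x) \<Longrightarrow> linear (fderiv f x)"
  by (simp add: linear_frechet_derivative)

lemma Ck_on_compose:
  fixes f :: "'a::euclidean_space \<Rightarrow> 'b::euclidean_space" and g :: "'b \<Rightarrow> 'c::euclidean_space"
  assumes "open U" "open V" "f ` U \<subseteq> V"
  shows "Ck_on k U f \<Longrightarrow> Ck_on k V g \<Longrightarrow> Ck_on k U (\<lambda>x. g (f x))"
proof (induction k arbitrary: g)
  case 0 then show ?case using assms continuous_on_compose2 by auto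
next
  case (Suc k)
  have d: "((\<lambda>x. g (f x)) has_derivative (\<lambda>v. fderiv g (f x) (fderiv f x v))) (at x)" if "x \<in> U" for x
    using Suc.prems that assms(3)
    by (intro has_derivative_compose[of f "fderiv f x" x UNIV g "fderiv g (f x)"] fderiv_worksI) auto
  \<comment> \<open>The direction \<open>fderiv f x v\<close> varies with \<open>x\<close>.
    Expanding it in the basis leaves derivatives of \<open>g\<close> in fixed directions, to which
    the induction hypothesis applies.\<close>
  have e: "fderiv (\<lambda>x. g (f x)) x v = (\<Sum>b\<in>Basis. (fderiv f x v \<bullet> b) *\<^sub>R fderiv g (f x) b)" if "x \<in> U" for x v
  proof -
    have "linear (fderiv g (f x))" using Suc.prems assms(3) that by (intro linear_fderiv) auto
    then show ?thesis unfolding fderiv_eq[OF d[OF that]] by (rule linear_expand)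
  qed
  have "Ck_on k U (\<lambda>x. fderiv g (f x) b)" for b
    using Suc.IH[OF Ck_on_SucD[OF Suc.prems(1)], of "\<lambda>y. fderiv g y b"] Suc.prems(2) by simp
  then have "Ck_on k U (\<lambda>x. fderiv (\<lambda>x. g (f x)) x v)" for v
    by (intro Ck_on_cong[OF assms(1) e[symmetric]])
      (use Suc.prems in
        \<open>auto intro!: Ck_on_sum assms Ck_on_bilinear[OF _ bounded_bilinear_scaleR]
           Ck_on_bilinear[OF _ bounded_bilinear_inner] Ck_on_const\<close>)
  then show ?case using d by (auto simp: differentiable_def)
qed

lemma smooth_open_compose:
  "open U \<Longrightarrow> open V \<Longrightarrow> f ` U \<subseteq> V \<Longrightarrow> smooth_open U f \<Longrightarrow> smooth_open V g \<Longrightarrow> smooth_open U (\<lambda>x. g (f x))"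
  unfolding smooth_open_def by (metis Ck_on_compose)

lemma fderiv_compose:
  assumes "f differentiable (at x)" "g differentiable (at (f x))"
  shows "fderiv (\<lambda>x. g (f x)) x v = fderiv g (f x) (fderiv f x v)"
  using has_derivative_compose[of f "fderiv f x" x UNIV g "fderiv g (f x)"] assms
  by (simp add: fderiv_worksI fderiv_eq)

text \<open>The exponent is arbitrary so that the derivative, again a multiple of a power, stays in
  the family and the induction closes.\<close>

lemma smooth_open_powr: "smooth_open {0<..} (\<lambda>t::real. t powr s)"
proof -
  have "Ck_on k {0<..} (\<lambda>t::real. t powr s)" for k
  proof (induction k arbitrary: s)
    case 0 show ?case by (auto intro!: continuous_intros)
  next
    case (Suc k)
    have d: "((\<lambda>t. t powr s) has_derivative (\<lambda>v. (s * x powr (s - 1)) * v)) (at x)" if "x \<in> {0<..}" for x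
      using that has_real_derivative_powr[of x s]
      by (simp add: has_field_derivative_def)
    have "Ck_on k {0<..} (\<lambda>x. fderiv (\<lambda>t. t powr s) x v)" for v
      by (rule Ck_on_cong[of _ "\<lambda>x. (s * x powr (s - 1)) * v"])
        (auto simp: fderiv_eq[OF d] intro!: Ck_on_bilinear[OF _ bounded_bilinear_mult] Ck_on_const Suc)
    then show ?case using d by (auto simp: differentiable_def)
  qed
  then show ?thesis by (simp add: smooth_open_def)
qed

lemma smooth_open_norm_powr: "smooth_open (-{0}) (\<lambda>x::'a::euclidean_space. norm x powr s)"
proof -
  have "smooth_open (-{0::'a}) (\<lambda>x. (x \<bullet> x) powr (s/2))"
    by (rule smooth_open_compose[OF _ _ _ _ smooth_open_powr]) (auto intro: smooth_open_inner smooth_open_ident)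
  then show ?thesis
    by (rule smooth_open_cong[rotated]) (auto simp: powr_half_sqrt norm_eq_sqrt_inner powr_powr simp flip: powr_half_sqrt)
qed

lemma smooth_open_norm: "smooth_open (-{0}) (norm :: 'a::euclidean_space \<Rightarrow> real)"
  by (rule smooth_open_cong[OF _ smooth_open_norm_powr[of 1]]) auto

lemma smooth_open_normalize: "smooth_open (-{0}) (\<lambda>x::'a::euclidean_space. x /\<^sub>R norm x)"
proof (rule smooth_open_cong)
  show "smooth_open (-{0}) (\<lambda>x::'a. (norm x powr (-1)) *\<^sub>R x)"
    by (intro smooth_open_scaleR smooth_open_norm_powr smooth_open_ident) auto
qed (auto simp: powr_minus)

section \<open>Linear equations depending smoothly on a parameter\<close>

text \<open>Where \<open>\<phi>\<close> vanishes, continuity of \<open>c\<close> suffices: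
  \<open>\<phi> y *\<^sub>R (c y - c x)\<close> is a term of order \<open>norm (y - x)\<close> times
  one tending to zero. \<open>Ck_on_solve\<close> needs this for a factor not yet known to be
  differentiable.\<close>

lemma has_derivative_scaleR_vanishing:
  fixes \<phi> :: "'a::real_normed_vector \<Rightarrow> real" and c :: "'a \<Rightarrow> 'b::real_normed_vector"
  assumes \<phi>: "(\<phi> has_derivative \<phi>') (at x)" "\<phi> x = 0" and c: "isCont c x"
  shows "((\<lambda>y. \<phi> y *\<^sub>R c y) has_derivative (\<lambda>h. \<phi>' h *\<^sub>R c x)) (at x)"
proof -
  have bl: "bounded_linear \<phi>'" using \<phi> has_derivative_bounded_linear by blast
  then obtain K where K: "\<And>h. norm (\<phi>' h) \<le> norm h * K" using bounded_linear.bounded by blast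
  have lim: "(\<lambda>y. norm (\<phi> y - \<phi> x - \<phi>' (y - x)) / norm (y - x)) \<midarrow>x\<rightarrow> 0"
    using \<phi> by (simp add: has_derivative_iff_norm)
  have "(\<lambda>y. (norm (\<phi> y - \<phi> x - \<phi>' (y - x)) / norm (y - x) + K) * norm (c y - c x)) \<midarrow>x\<rightarrow> (0 + K) * 0"
    using c by (intro tendsto_intros lim) (simp add: LIM_zero isCont_def tendsto_norm_zero)
  then have lim0: "(\<lambda>y. (norm (\<phi> y - \<phi> x - \<phi>' (y - x)) / norm (y - x) + K) * norm (c y - c x)) \<midarrow>x\<rightarrow> 0" by simp
  have bnd: "norm (norm (\<phi> y *\<^sub>R (c y - c x)) / norm (y - x))
    \<le> (norm (\<phi> y - \<phi> x - \<phi>' (y - x)) / norm (y - x) + K) * norm (c y - c x)" if "y \<noteq> x" for y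
  proof -
    have "norm (\<phi> y) \<le> norm (\<phi> y - \<phi> x - \<phi>' (y - x)) + norm (y - x) * K"
      using norm_triangle_ineq2[of "\<phi> y" "\<phi>' (y - x)"] K[of "y - x"] \<phi>(2) by simp
    then have "norm (\<phi> y) / norm (y - x) \<le> norm (\<phi> y - \<phi> x - \<phi>' (y - x)) / norm (y - x) + K"
      using that by (simp add: field_simps)
    then show ?thesis
      using mult_right_mono[of _ _ "norm (c y - c x)"] by fastforce
  qed
  have "\<forall>\<^sub>F y in at x. norm (norm (\<phi> y *\<^sub>R (c y - c x)) / norm (y - x))
    \<le> (norm (\<phi> y - \<phi> x - \<phi>' (y - x)) / norm (y - x) + K) * norm (c y - c x)"
    unfolding eventually_at_filter by (intro always_eventually allI impI bnd)
  from Lim_null_comparison[OF this lim0]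
  have "(\<lambda>y. norm (\<phi> y *\<^sub>R (c y - c x)) / norm (y - x)) \<midarrow>x\<rightarrow> 0" .
  then have "((\<lambda>y. \<phi> y *\<^sub>R (c y - c x)) has_derivative (\<lambda>h. 0)) (at x)"
    using \<phi>(2) by (simp add: has_derivative_iff_norm)
  then have "((\<lambda>y. \<phi> y *\<^sub>R c x + \<phi> y *\<^sub>R (c y - c x)) has_derivative (\<lambda>h. \<phi>' h *\<^sub>R c x + 0)) (at x)"
    by (intro has_derivative_add has_derivative_scaleR_left \<phi>)
  then show ?thesis by (simp add: algebra_simps)
qed

text \<open>A lower bound \<open>B\<close> for \<open>G z\<close> survives as \<open>B/2\<close> for
  nearby \<open>G x\<close>, and \<open>G x\<close> maps \<open>H x w - H z w\<close> to
  \<open>G z (H z w) - G x (H z w)\<close>, which tends to zero.\<close>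

lemma continuous_on_solve:
  fixes G :: "'a::topological_space \<Rightarrow> 'b::euclidean_space \<Rightarrow> 'c::euclidean_space"
  assumes linG: "\<And>x. x \<in> U \<Longrightarrow> linear (G x)"
    and GH: "\<And>x w. x \<in> U \<Longrightarrow> G x (H x w) = w"
    and HG: "\<And>x w. x \<in> U \<Longrightarrow> H x (G x w) = w"
    and contG: "\<And>w. continuous_on U (\<lambda>x. G x w)"
  shows "continuous_on U (\<lambda>x. H x w)"
  unfolding continuous_on_def
proof
  fix z assume z: "z \<in> U"
  have "inj (G z)" using HG[OF z] by (metis injI)
  then obtain B where B: "0 < B" "\<And>y. B * norm y \<le> norm (G z y)"
    using linear_inj_bounded_below_pos[OF linG[OF z]] by blast
  \<comment> \<open>A bound for the operator norm of \<open>G x - G z\<close>, made of finitely many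
    continuous terms.\<close>
  define s where "s x = (\<Sum>b\<in>Basis. norm (G x b - G z b))" for x
  have tG: "((\<lambda>x. G x y) \<longlongrightarrow> G z y) (at z within U)" for y
    using contG z by (auto simp: continuous_on_def)
  have "(s \<longlongrightarrow> (\<Sum>b\<in>(Basis::'b set). norm (G z b - G z b))) (at z within U)"
    unfolding s_def by (intro tendsto_intros tG)
  then have "(s \<longlongrightarrow> 0) (at z within U)" by simp
  then have ev: "\<forall>\<^sub>F x in at z within U. s x < B/2"
    using B(1) by (intro order_tendstoD(2)) auto
  have est: "norm (G x y - G z y) \<le> s x * norm y" if "x \<in> U" for x y
  proof -
    have "G x y - G z y = (\<Sum>b\<in>Basis. (y \<bullet> b) *\<^sub>R (G x b - G z b))"
      using linear_expand[OF linG[OF that], of y] linear_expand[OF linG[OF z], of y]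
      by (simp add: sum_subtractf scaleR_diff_right)
    also have "norm \<dots> \<le> (\<Sum>b\<in>Basis. norm y * norm (G x b - G z b))"
      by (intro sum_norm_le) (auto intro!: mult_right_mono simp: Basis_le_norm)
    finally show ?thesis by (simp add: s_def sum_distrib_left mult.commute)
  qed
  have *: "\<forall>\<^sub>F x in at z within U. x \<in> U" by (simp add: eventually_at_filter)
  have "\<forall>\<^sub>F x in at z within U. norm (H x w - H z w) \<le> norm (G z (H z w) - G x (H z w)) / (B/2)"
    using ev *
  proof eventually_elim
    fix x assume x: "s x < B/2" "x \<in> U"
    let ?d = "H x w - H z w"
    have e: "norm (G z (H z w) - G x (H z w)) = norm (G x ?d)"
      using GH x z linG by (simp add: linear_diff)
    have "B / 2 * norm ?d \<le> norm (G x ?d)"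
    proof -
      have "B * norm ?d \<le> norm (G x ?d) + s x * norm ?d"
        using B(2)[of ?d] est[OF x(2), of ?d] norm_triangle_ineq2[of "G z ?d" "G x ?d"]
        by (simp add: norm_minus_commute)
      moreover have "s x * norm ?d \<le> B/2 * norm ?d" using x by (intro mult_right_mono) auto
      ultimately show ?thesis by (simp add: algebra_simps)
    qed
    then show "norm ?d \<le> norm (G z (H z w) - G x (H z w)) / (B/2)"
      unfolding e using B(1) by (simp add: field_simps)
  qed
  moreover have "((\<lambda>x. norm (G z (H z w) - G x (H z w)) / (B/2)) \<longlongrightarrow> norm (G z (H z w) - G z (H z w)) / (B/2)) (at z within U)"
    using B(1) by (intro tendsto_divide tendsto_norm tendsto_diff tendsto_const tG) simp
  then have "((\<lambda>x. norm (G z (H z w) - G x (H z w)) / (B/2)) \<longlongrightarrow> 0) (at z within U)"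
    by simp
  ultimately have "((\<lambda>x. H x w - H z w) \<longlongrightarrow> 0) (at z within U)"
    by (rule Lim_null_comparison)
  then show "((\<lambda>x. H x w) \<longlongrightarrow> H z w) (at z within U)" by (rule LIM_zero_cancel)
qed

text \<open>Differentiating \<open>G y = w\<close> gives \<open>G (y') = w' - G' y\<close>, so \<open>y\<close> is as smooth as the data.\<close>

lemma Ck_on_solve:
  fixes G :: "'a::euclidean_space \<Rightarrow> 'b::euclidean_space \<Rightarrow> 'c::euclidean_space"
    and H :: "'a \<Rightarrow> 'c \<Rightarrow> 'b"
  assumes U: "open U"
    and linG: "\<And>x. x \<in> U \<Longrightarrow> linear (G x)"
    and GH: "\<And>x w. x \<in> U \<Longrightarrow> G x (H x w) = w"
    and HG: "\<And>x w. x \<in> U \<Longrightarrow> H x (G x w) = w"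
  shows "(\<And>w. Ck_on k U (\<lambda>x. G x w)) \<Longrightarrow> Ck_on k U w \<Longrightarrow> Ck_on k U (\<lambda>x. H x (w x))"
proof (induction k arbitrary: w)
  have linH: "linear (H x)" if "x \<in> U" for x
  proof (rule linearI)
    fix u v c
    have "H x (G x (H x u + H x v)) = H x (G x (H x u) + G x (H x v))"
      by (simp add: linG[OF that] linear_add)
    then show "H x (u + v) = H x u + H x v" by (simp add: GH HG that)
    have "H x (G x (c *\<^sub>R H x u)) = H x (c *\<^sub>R G x (H x u))"
      by (simp add: linG[OF that] linear_scale)
    then show "H x (c *\<^sub>R u) = c *\<^sub>R H x u" by (simp add: GH HG that)
  qed
  note H_expand = linear_expand[OF linH]
  have contH: "continuous_on U (\<lambda>x. H x w)" if "\<And>w. continuous_on U (\<lambda>x. G x w)" for w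
    using continuous_on_solve[OF linG GH HG that] by blast
  {
    case 0
    have "continuous_on U (\<lambda>x. (\<Sum>b\<in>Basis. (w x \<bullet> b) *\<^sub>R H x b))"
      using 0 by (intro continuous_intros contH) auto
    moreover have "(\<Sum>b\<in>Basis. (w x \<bullet> b) *\<^sub>R H x b) = H x (w x)" if "x \<in> U" for x
      using H_expand[OF that] by metis
    ultimately show ?case by (simp cong: continuous_on_cong)
  next
    case (Suc k)
    let ?y = "\<lambda>x. H x (w x)"
    have y: "Ck_on k U ?y" by (intro Suc.IH Ck_on_SucD[OF Suc.prems(1)] Ck_on_SucD[OF Suc.prems(2)])
    have cH: "isCont (\<lambda>x. H x b) x" if "x \<in> U" for x b
    proof -
      have "continuous_on U (\<lambda>x. G x w)" for w
        using Suc.prems(1)[of w] U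
        by (auto simp: continuous_on_eq_continuous_at intro: differentiable_imp_continuous_within)
      then show ?thesis using contH that U continuous_on_eq_continuous_at by blast
    qed
    \<comment> \<open>The derivative of the right side minus \<open>G z y\<close> in
      \<open>z\<close>, with \<open>y\<close> frozen at the solution in the point of
      differentiation.\<close>
    define \<phi>' where "\<phi>' x h = fderiv w x h - (\<Sum>b\<in>Basis. (?y x \<bullet> b) *\<^sub>R fderiv (\<lambda>x. G x b) x h)" for x h
    have d: "(?y has_derivative (\<lambda>h. H x (\<phi>' x h))) (at x)" if x: "x \<in> U" for x
    proof -
      define y0 where "y0 = ?y x"
      define \<phi> where "\<phi> z = w z - (\<Sum>b\<in>Basis. (y0 \<bullet> b) *\<^sub>R G z b)" for z
      have \<phi>: "(\<phi> has_derivative \<phi>' x) (at x)"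
        unfolding \<phi>_def \<phi>'_def y0_def using Suc.prems x
        by (auto intro!: derivative_eq_intros fderiv_worksI)
      have \<phi>_eq: "\<phi> z = w z - G z y0" if "z \<in> U" for z
        unfolding \<phi>_def using linear_expand[OF linG[OF that]] by metis
      have "\<phi> x = 0" using \<phi>_eq[OF x] GH x y0_def by simp
      then have "((\<lambda>z. \<Sum>b\<in>Basis. (\<phi> z \<bullet> b) *\<^sub>R H z b) has_derivative
          (\<lambda>h. \<Sum>b\<in>Basis. (\<phi>' x h \<bullet> b) *\<^sub>R H x b)) (at x)"
        by (intro has_derivative_sum has_derivative_scaleR_vanishing has_derivative_inner_left \<phi> cH x) auto
      then have *: "((\<lambda>z. y0 + (\<Sum>b\<in>Basis. (\<phi> z \<bullet> b) *\<^sub>R H z b)) has_derivative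
          (\<lambda>h. H x (\<phi>' x h))) (at x)"
        using has_derivative_add[OF has_derivative_const[of y0]] unfolding H_expand[OF x, symmetric] by fastforce
      \<comment> \<open>\<open>H z (\<phi> z)\<close> is the increment of the solution from
        \<open>y0\<close>. As \<open>\<phi>\<close> vanishes at \<open>x\<close>, no derivative of
        \<open>H\<close> is involved.\<close>
      have "y0 + (\<Sum>b\<in>Basis. (\<phi> z \<bullet> b) *\<^sub>R H z b) = ?y z" if "z \<in> U" for z
        unfolding H_expand[OF that, symmetric] \<phi>_eq[OF that] linear_diff[OF linH[OF that]]
        by (simp add: HG that)
      then show ?thesis by (rule has_derivative_transform_within_open[OF * U x])
    qed
    have "Ck_on k U (\<lambda>x. fderiv ?y x v)" for v
    proof (rule Ck_on_cong[OF U, of "\<lambda>x. H x (\<phi>' x v)"])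
      show "Ck_on k U (\<lambda>x. H x (\<phi>' x v))"
      proof (rule Suc.IH)
        show "Ck_on k U (\<lambda>x. G x w)" for w by (rule Ck_on_SucD[OF Suc.prems(1)])
        show "Ck_on k U (\<lambda>x. \<phi>' x v)"
          unfolding \<phi>'_def using Suc.prems
          by (intro Ck_on_diff Ck_on_sum U Ck_on_bilinear[OF U bounded_bilinear_scaleR]
            Ck_on_bilinear[OF U bounded_bilinear_inner] Ck_on_const finite_Basis y) auto
      qed
    qed (simp add: fderiv_eq[OF d])
    then show ?case using d by (auto simp: differentiable_def)
  }
qed

lemma smooth_open_solve:
  fixes G :: "'a::euclidean_space \<Rightarrow> 'b::euclidean_space \<Rightarrow> 'c::euclidean_space"
  assumes "open U" "\<And>x. x \<in> U \<Longrightarrow> linear (G x)"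
    and "\<And>x w. x \<in> U \<Longrightarrow> G x (H x w) = w"
    and "\<And>x w. x \<in> U \<Longrightarrow> H x (G x w) = w"
    and "\<And>w. smooth_open U (\<lambda>x. G x w)" "smooth_open U w"
  shows "smooth_open U (\<lambda>x. H x (w x))"
  unfolding smooth_open_def
  by (intro allI Ck_on_solve[where G=G, OF assms(1-4)]) (use assms(5,6) smooth_open_def in auto)

lemma smooth_open_apply:
  fixes G :: "'a::euclidean_space \<Rightarrow> 'b::euclidean_space \<Rightarrow> 'c::euclidean_space"
  assumes "open U" "\<And>x. x \<in> U \<Longrightarrow> linear (G x)" "\<And>w. smooth_open U (\<lambda>x. G x w)" "smooth_open U w"
  shows "smooth_open U (\<lambda>x. G x (w x))"
proof (rule smooth_open_cong[OF \<open>open U\<close>])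
  show "smooth_open U (\<lambda>x. \<Sum>b\<in>Basis. (w x \<bullet> b) *\<^sub>R G x b)"
    by (intro smooth_open_sum smooth_open_scaleR smooth_open_inner assms smooth_open_const finite_Basis)
  show "(\<Sum>b\<in>Basis. (w x \<bullet> b) *\<^sub>R G x b) = G x (w x)" if "x \<in> U" for x
    using linear_expand[OF assms(2)[OF that]] by metis
qed

lemma fderiv_apply:
  fixes G :: "'a::euclidean_space \<Rightarrow> 'b::euclidean_space \<Rightarrow> 'c::euclidean_space"
  assumes U: "open U" "x \<in> U" and linG: "\<And>x. x \<in> U \<Longrightarrow> linear (G x)"
    and G: "\<And>w. (\<lambda>x. G x w) differentiable (at x)" and w: "w differentiable (at x)"
  shows "fderiv (\<lambda>x. G x (w x)) x v = fderiv (\<lambda>z. G z (w x)) x v + G x (fderiv w x v)"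
proof -
  have eq: "(\<Sum>b\<in>Basis. (u \<bullet> b) *\<^sub>R G z b) = G z u" if "z \<in> U" for z u
    using linear_expand[OF linG[OF that]] by metis
  have "((\<lambda>x. \<Sum>b\<in>Basis. (w x \<bullet> b) *\<^sub>R G x b) has_derivative
    (\<lambda>v. \<Sum>b\<in>Basis. (w x \<bullet> b) *\<^sub>R fderiv (\<lambda>x. G x b) x v + (fderiv w x v \<bullet> b) *\<^sub>R G x b)) (at x)"
    using G w by (auto intro!: derivative_eq_intros fderiv_worksI)
  then have 1: "((\<lambda>x. G x (w x)) has_derivative
    (\<lambda>v. (\<Sum>b\<in>Basis. (w x \<bullet> b) *\<^sub>R fderiv (\<lambda>x. G x b) x v) + G x (fderiv w x v))) (at x)"
    unfolding sum.distrib eq[OF U(2)]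
    by (rule has_derivative_transform_within_open[OF _ U]) (rule eq)
  have "((\<lambda>z. \<Sum>b\<in>Basis. (w x \<bullet> b) *\<^sub>R G z b) has_derivative
    (\<lambda>v. \<Sum>b\<in>Basis. (w x \<bullet> b) *\<^sub>R fderiv (\<lambda>x. G x b) x v)) (at x)"
    using G by (auto intro!: derivative_eq_intros fderiv_worksI)
  then have 2: "((\<lambda>z. G z (w x)) has_derivative
    (\<lambda>v. (\<Sum>b\<in>Basis. (w x \<bullet> b) *\<^sub>R fderiv (\<lambda>x. G x b) x v))) (at x)"
    by (rule has_derivative_transform_within_open[OF _ U]) (rule eq)
  show ?thesis by (simp add: fderiv_eq[OF 1] fderiv_eq[OF 2])
qed

section \<open>Symmetry of second derivatives\<close>

text \<open>The mean value theorem is used twice: in direction \<open>v\<close> for the difference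
  of \<open>f\<close> along two parallel segments, then in direction \<open>w\<close> for the
  derivative so obtained.\<close>

lemma second_difference_mvt:
  fixes f :: "'a::euclidean_space \<Rightarrow> real"
  assumes t: "0 < t" and ball: "\<And>y. dist y x \<le> t * (norm v + norm w) \<Longrightarrow> y \<in> U"
    and df: "\<And>y. y \<in> U \<Longrightarrow> f differentiable (at y)"
    and ddf: "\<And>y. y \<in> U \<Longrightarrow> (\<lambda>y. fderiv f y v) differentiable (at y)"
  shows "\<exists>\<xi>. dist \<xi> x \<le> t * (norm v + norm w) \<and>
    f (x + t *\<^sub>R v + t *\<^sub>R w) - f (x + t *\<^sub>R v) - f (x + t *\<^sub>R w) + f x
      = t * t * fderiv (\<lambda>y. fderiv f y v) \<xi> w"
proof -
  have near: "dist (x + s *\<^sub>R v + r *\<^sub>R w) x \<le> t * (norm v + norm w)" if "0 \<le> s" "s \<le> t" "0 \<le> r" "r \<le> t" for s r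
  proof -
    have "dist (x + s *\<^sub>R v + r *\<^sub>R w) x \<le> s * norm v + r * norm w"
      using norm_triangle_ineq[of "s *\<^sub>R v" "r *\<^sub>R w"] that by (simp add: dist_norm add.assoc)
    also have "\<dots> \<le> t * norm v + t * norm w"
      using that by (intro add_mono mult_right_mono) auto
    finally show ?thesis by (simp add: distrib_left)
  qed
  have D: "((\<lambda>s. g (a + s *\<^sub>R u)) has_real_derivative fderiv g (a + s *\<^sub>R u) u) (at s)"
    if "g differentiable (at (a + s *\<^sub>R u))" for g :: "'a \<Rightarrow> real" and a s u
  proof -
    have "((\<lambda>s. a + s *\<^sub>R u) has_derivative (\<lambda>h. h *\<^sub>R u)) (at s)"
      by (auto intro!: derivative_eq_intros)
    from has_derivative_compose[OF this fderiv_worksI[OF that]]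
    show ?thesis
      using linear_scale[OF linear_fderiv[OF that]]
      by (simp add: has_field_derivative_def mult_commute_abs)
  qed
  define \<phi> where "\<phi> s = f ((x + t *\<^sub>R w) + s *\<^sub>R v) - f (x + s *\<^sub>R v)" for s
  have "\<exists>z>0. z < t \<and> \<phi> t - \<phi> 0 = (t - 0) * (fderiv f ((x + t *\<^sub>R w) + z *\<^sub>R v) v - fderiv f (x + z *\<^sub>R v) v)"
    unfolding \<phi>_def
  proof (rule MVT2[OF t], rule DERIV_diff)
    fix s assume s: "0 \<le> s" "s \<le> t"
    have "x + t *\<^sub>R w + s *\<^sub>R v \<in> U" "x + s *\<^sub>R v \<in> U"
      using near[of s t] near[of s 0] t s by (auto intro!: ball simp: add.commute add.left_commute)
    then show "((\<lambda>s. f ((x + t *\<^sub>R w) + s *\<^sub>R v)) has_real_derivative fderiv f ((x + t *\<^sub>R w) + s *\<^sub>R v) v) (at s)"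
      "((\<lambda>s. f (x + s *\<^sub>R v)) has_real_derivative fderiv f (x + s *\<^sub>R v) v) (at s)"
      by (auto intro!: D df)
  qed
  then obtain z where z: "0 < z" "z < t" and
    e1: "\<phi> t - \<phi> 0 = t * (fderiv f ((x + z *\<^sub>R v) + t *\<^sub>R w) v - fderiv f ((x + z *\<^sub>R v) + 0 *\<^sub>R w) v)"
    by (auto simp: algebra_simps)
  have "\<exists>y>0. y < t \<and> fderiv f ((x + z *\<^sub>R v) + t *\<^sub>R w) v - fderiv f ((x + z *\<^sub>R v) + 0 *\<^sub>R w) v
    = (t - 0) * fderiv (\<lambda>y. fderiv f y v) ((x + z *\<^sub>R v) + y *\<^sub>R w) w"
  proof (rule MVT2[OF t])
    fix s assume "0 \<le> s" "s \<le> t"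
    then show "((\<lambda>s. fderiv f ((x + z *\<^sub>R v) + s *\<^sub>R w) v) has_real_derivative
        fderiv (\<lambda>y. fderiv f y v) ((x + z *\<^sub>R v) + s *\<^sub>R w) w) (at s)"
      using near[of z s] z by (intro D ddf ball) auto
  qed
  then obtain y where y: "0 < y" "y < t" and
    e2: "fderiv f ((x + z *\<^sub>R v) + t *\<^sub>R w) v - fderiv f ((x + z *\<^sub>R v) + 0 *\<^sub>R w) v
    = t * fderiv (\<lambda>y. fderiv f y v) ((x + z *\<^sub>R v) + y *\<^sub>R w) w" by auto
  have "\<phi> t - \<phi> 0 = t * t * fderiv (\<lambda>y. fderiv f y v) ((x + z *\<^sub>R v) + y *\<^sub>R w) w"
    unfolding e1 e2 by simp
  moreover have "\<phi> t - \<phi> 0 = f (x + t *\<^sub>R v + t *\<^sub>R w) - f (x + t *\<^sub>R v) - f (x + t *\<^sub>R w) + f x"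
    by (simp add: \<phi>_def algebra_simps)
  moreover have "dist ((x + z *\<^sub>R v) + y *\<^sub>R w) x \<le> t * (norm v + norm w)"
    using near[of z y] y z by simp
  ultimately show ?thesis by metis
qed

text \<open>The second difference is symmetric in the two directions, so some value of one mixed
  derivative near \<open>x\<close> equals some value of the other near \<open>x\<close>. Continuity
  then excludes a gap at \<open>x\<close>.\<close>

lemma fderiv_commute_real:
  fixes f :: "'a::euclidean_space \<Rightarrow> real"
  assumes U: "open U" and x: "x \<in> U" and f: "smooth_open U f"
  shows "fderiv (\<lambda>y. fderiv f y v) x w = fderiv (\<lambda>y. fderiv f y w) x v" (is "?A x = ?B x")
proof (rule ccontr)
  assume "?A x \<noteq> ?B x"
  then have e: "\<bar>?A x - ?B x\<bar> / 2 > 0" by simp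
  have "isCont ?A x" "isCont ?B x"
    using smooth_openD_cont[OF smooth_openD_fderiv[OF smooth_openD_fderiv[OF f, of v], of w]]
      smooth_openD_cont[OF smooth_openD_fderiv[OF smooth_openD_fderiv[OF f, of w], of v]] U x
    by (auto simp: continuous_on_eq_continuous_at)
  then obtain d1 d2 where d: "d1 > 0" "d2 > 0"
    and A: "\<And>y. dist y x < d1 \<Longrightarrow> dist (?A y) (?A x) < \<bar>?A x - ?B x\<bar> / 2"
    and B: "\<And>y. dist y x < d2 \<Longrightarrow> dist (?B y) (?B x) < \<bar>?A x - ?B x\<bar> / 2"
    using e unfolding continuous_at_eps_delta dist_norm real_norm_def by metis
  obtain d3 where d3: "d3 > 0" "ball x d3 \<subseteq> U" using U x open_contains_ball by metis
  \<comment> \<open>The summand 1 keeps the divisor positive for \<open>v = w = 0\<close>; the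
    factor 2 in \<open>t\<close> makes the three bounds below strict.\<close>
  define m where "m = norm v + norm w + 1"
  have m: "m > 0" by (simp add: m_def add_nonneg_pos)
  define t where "t = min (min d1 d2) d3 / (2 * m)"
  have t: "t > 0" using d d3 m by (simp add: t_def)
  have "t * (norm v + norm w) \<le> t * m" using t by (intro mult_left_mono) (auto simp: m_def)
  also have "t * m = min (min d1 d2) d3 / 2" using m by (simp add: t_def)
  finally have small: "t * (norm v + norm w) < d1" "t * (norm v + norm w) < d2" "t * (norm v + norm w) < d3"
    using d d3(1) by linarith+
  have inU: "y \<in> U" if "dist y x \<le> t * (norm v + norm w)" for y
    using that small d3 by (auto simp: dist_commute subset_iff)
  have inU': "y \<in> U" if "dist y x \<le> t * (norm w + norm v)" for y
    using that inU by (simp add: add.commute)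
  note dif = smooth_openD_diff[OF f] and dif2 = smooth_openD_diff[OF smooth_openD_fderiv[OF f]]
  obtain \<xi> where \<xi>: "dist \<xi> x \<le> t * (norm v + norm w)" and 1:
    "f (x + t *\<^sub>R v + t *\<^sub>R w) - f (x + t *\<^sub>R v) - f (x + t *\<^sub>R w) + f x = t * t * ?A \<xi>"
    using second_difference_mvt[OF t inU dif dif2] by blast
  obtain \<eta> where \<eta>: "dist \<eta> x \<le> t * (norm w + norm v)" and 2:
    "f (x + t *\<^sub>R w + t *\<^sub>R v) - f (x + t *\<^sub>R w) - f (x + t *\<^sub>R v) + f x = t * t * ?B \<eta>"
    using second_difference_mvt[OF t inU' dif dif2] by blast
  have "t * t * ?A \<xi> = t * t * ?B \<eta>" using 1 2 by (simp add: algebra_simps)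
  then have "?A \<xi> = ?B \<eta>" using t by simp
  moreover have "dist (?A \<xi>) (?A x) < \<bar>?A x - ?B x\<bar> / 2" using \<xi> small by (intro A) linarith
  moreover have "dist (?B \<eta>) (?B x) < \<bar>?A x - ?B x\<bar> / 2" using \<eta> small by (intro B) (simp add: add.commute)
  ultimately show False by (simp add: dist_real_def abs_if split: if_splits)
qed

lemma fderiv_inner:
  assumes "f differentiable (at x)"
  shows "fderiv (\<lambda>y. f y \<bullet> b) x v = fderiv f x v \<bullet> b"
  using has_derivative_inner_left[OF fderiv_worksI[OF assms], of b] by (simp add: fderiv_eq)

lemma fderiv_cong:
  assumes "open U" "x \<in> U" "\<And>y. y \<in> U \<Longrightarrow> f y = g y" "f differentiable (at x)"
  shows "fderiv f x = fderiv g x"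
  using assms by (intro frechet_derivative_transform_within_open[where X=U]) auto

lemma fderiv_commute:
  fixes f :: "'a::euclidean_space \<Rightarrow> 'b::euclidean_space"
  assumes U: "open U" and x: "x \<in> U" and f: "smooth_open U f"
  shows "fderiv (\<lambda>y. fderiv f y v) x w = fderiv (\<lambda>y. fderiv f y w) x v"
proof (rule euclidean_eqI)
  fix b :: 'b assume "b \<in> Basis"
  have *: "fderiv (\<lambda>y. fderiv f y v) x w \<bullet> b = fderiv (\<lambda>y. fderiv (\<lambda>y. f y \<bullet> b) y v) x w" for v w
  proof -
    have d: "(\<lambda>y. fderiv f y v \<bullet> b) differentiable (at x)"
      by (rule smooth_openD_diff[OF smooth_open_inner[OF U smooth_openD_fderiv[OF f] smooth_open_const] x])
    have "fderiv (\<lambda>y. fderiv f y v) x w \<bullet> b = fderiv (\<lambda>y. fderiv f y v \<bullet> b) x w"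
      by (simp add: fderiv_inner smooth_openD_diff[OF smooth_openD_fderiv[OF f] x])
    also have "\<dots> = fderiv (\<lambda>y. fderiv (\<lambda>y. f y \<bullet> b) y v) x w"
      using fderiv_cong[OF U x _ d] smooth_openD_diff[OF f] by (metis fderiv_inner)
    finally show ?thesis .
  qed
  show "fderiv (\<lambda>y. fderiv f y v) x w \<bullet> b = fderiv (\<lambda>y. fderiv f y w) x v \<bullet> b"
    unfolding * by (rule fderiv_commute_real[OF U x smooth_open_inner[OF U f smooth_open_const]])
qed

text \<open>The C^1 inverse function theorem gives the derivative of \<open>g\<close> as
  \<open>inv (fderiv f (g y))\<close>. If \<open>g\<close> is of class k, so is this derivative by
  \<open>Ck_on_solve\<close>, and \<open>g\<close> gains one order.\<close>

lemma smooth_inverse_function: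
  fixes f :: "'a::euclidean_space \<Rightarrow> 'a"
  assumes U: "open U" and x0: "x0 \<in> U" and f: "smooth_open U f" and inj: "inj (fderiv f x0)"
  obtains U' V g where "open U'" "U' \<subseteq> U" "x0 \<in> U'" "open V" "f x0 \<in> V" "homeomorphism U' V f g" "smooth_open V g"
proof -
  define f' where "f' x = Blinfun (fderiv f x)" for x
  have bl: "bounded_linear (fderiv f x)" if "x \<in> U" for x
    using smooth_openD_deriv[OF f that] has_derivative_bounded_linear by blast
  have f'_app: "blinfun_apply (f' x) = fderiv f x" if "x \<in> U" for x
    unfolding f'_def using bl[OF that] by (rule bounded_linear_Blinfun_apply)
  have cont: "continuous_on U f'"
  proof (rule continuous_on_blinfun_componentwise)
    fix i :: 'a
    have "continuous_on U (\<lambda>x. fderiv f x i)" by (rule smooth_openD_cont[OF smooth_openD_fderiv[OF f]])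
    then show "continuous_on U (\<lambda>x. blinfun_apply (f' x) i)"
      by (rule continuous_on_eq) (simp add: f'_app)
  qed
  have lin0: "linear (fderiv f x0)" by (rule linear_fderiv[OF smooth_openD_diff[OF f x0]])
  obtain h where h: "linear h" "\<And>y. h (fderiv f x0 y) = y"
    using linear_injective_left_inverse[OF lin0 inj] by (auto simp: fun_eq_iff)
  have "Blinfun h o\<^sub>L f' x0 = id_blinfun"
    using h by (intro blinfun_eqI)
      (simp add: f'_app[OF x0] bounded_linear_Blinfun_apply linear_conv_bounded_linear)
  from inverse_function_theorem[OF U _ cont x0 this, of f]
  obtain U' V g g' where *: "open U'" "U' \<subseteq> U" "x0 \<in> U'" "open V" "f x0 \<in> V" "homeomorphism U' V f g"
    and dg: "\<And>y. y \<in> V \<Longrightarrow> (g has_derivative (g' y)) (at y)"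
    and g': "\<And>y. y \<in> V \<Longrightarrow> g' y = inv (blinfun_apply (f' (g y)))"
    and bij: "\<And>y. y \<in> V \<Longrightarrow> bij (blinfun_apply (f' (g y)))"
    using smooth_openD_deriv[OF f] by (metis f'_app)
  have gU: "g y \<in> U" if "y \<in> V" for y
    using * that by (metis homeomorphism_image2 imageI subsetD)
  have "Ck_on k V g" for k
  proof (induction k)
    case 0
    then show ?case using * by (simp add: homeomorphism_cont2)
  next
    case (Suc k)
    have "Ck_on k V (\<lambda>y. inv (fderiv f (g y)) v)" for v
    proof (rule Ck_on_solve[where G = "\<lambda>y. fderiv f (g y)" and H = "\<lambda>y. inv (fderiv f (g y))" and w = "\<lambda>_. v"])
      fix y assume y: "y \<in> V"
      show "linear (fderiv f (g y))" by (rule linear_fderiv[OF smooth_openD_diff[OF f gU[OF y]]])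
      have b: "bij (fderiv f (g y))" using bij[OF y] by (simp add: f'_app[OF gU[OF y]])
      show "fderiv f (g y) (inv (fderiv f (g y)) w) = w" for w
        using b by (simp add: bij_is_surj surj_f_inv_f)
      show "inv (fderiv f (g y)) (fderiv f (g y) w) = w" for w
        using b by (simp add: bij_is_inj)
    next
      show "Ck_on k V (\<lambda>y. fderiv f (g y) w)" for w
        using smooth_openD_fderiv[OF f, of w] gU unfolding smooth_open_def
        by (intro Ck_on_compose[OF \<open>open V\<close> U _ Suc.IH]) auto
    qed (use \<open>open V\<close> in \<open>auto intro: Ck_on_const\<close>)
    then have "Ck_on k V (\<lambda>y. fderiv g y v)" for v
      by (rule Ck_on_cong[OF \<open>open V\<close>, rotated]) (simp add: fderiv_eq[OF dg] g' f'_app[OF gU])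
    then show ?case using dg by (auto simp: differentiable_def)
  qed
  then show thesis using that[OF *] by (simp add: smooth_open_def)
qed

section \<open>Orthogonal projections\<close>

lemma orth_proj_unique:
  assumes "subspace S" "u \<in> S" "\<And>w. w \<in> S \<Longrightarrow> (v - u) \<bullet> w = 0"
  shows "orth_proj S v = u"
  unfolding orth_proj_def
proof (rule the_equality)
  fix u' assume u': "u' \<in> S \<and> (\<forall>w\<in>S. (v - u') \<bullet> w = 0)"
  have "u - u' \<in> S" using assms u' by (simp add: subspace_diff)
  then have "(v - u') \<bullet> (u - u') - (v - u) \<bullet> (u - u') = 0" using u' assms by simp
  then have "(u - u') \<bullet> (u - u') = 0" by (simp add: inner_diff_left algebra_simps)
  then show "u' = u" by simp
qed (use assms in auto)

lemma orth_proj_props: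
  assumes "subspace S"
  shows orth_proj_in: "orth_proj S v \<in> S"
    and orth_proj_orth: "w \<in> S \<Longrightarrow> (v - orth_proj S v) \<bullet> w = 0"
proof -
  obtain y z where "y \<in> span S" "\<And>w. w \<in> span S \<Longrightarrow> orthogonal z w" "v = y + z"
    using orthogonal_subspace_decomp_exists[of S v] by blast
  then have *: "y \<in> S" "\<And>w. w \<in> S \<Longrightarrow> (v - y) \<bullet> w = 0"
    using assms by (auto simp: span_eq_iff[THEN iffD2] orthogonal_def)
  then have "orth_proj S v = y" by (intro orth_proj_unique assms)
  with * show "orth_proj S v \<in> S" "w \<in> S \<Longrightarrow> (v - orth_proj S v) \<bullet> w = 0" by auto
qed

lemma linear_orth_proj:
  assumes S: "subspace S"
  shows "linear (orth_proj S)"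
proof (rule linearI)
  fix u v :: 'a and c :: real
  have 1: "(u + v - (orth_proj S u + orth_proj S v)) \<bullet> w = 0" if "w \<in> S" for w
    using orth_proj_orth[OF S that, of u] orth_proj_orth[OF S that, of v]
    by (simp add: inner_diff_left inner_add_left)
  show "orth_proj S (u + v) = orth_proj S u + orth_proj S v"
    by (rule orth_proj_unique[OF S subspace_add[OF S orth_proj_in[OF S] orth_proj_in[OF S]] 1])
  have 2: "(c *\<^sub>R u - c *\<^sub>R orth_proj S u) \<bullet> w = 0" if "w \<in> S" for w
    using orth_proj_orth[OF S that, of u] by (simp add: inner_diff_left)
  show "orth_proj S (c *\<^sub>R u) = c *\<^sub>R orth_proj S u"
    by (rule orth_proj_unique[OF S subspace_mul[OF S orth_proj_in[OF S]] 2])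
qed

lemma orth_proj_id: "subspace S \<Longrightarrow> v \<in> S \<Longrightarrow> orth_proj S v = v"
  by (rule orth_proj_unique) auto

lemma orth_proj_eq_0: "subspace S \<Longrightarrow> (\<And>w. w \<in> S \<Longrightarrow> v \<bullet> w = 0) \<Longrightarrow> orth_proj S v = 0"
  by (rule orth_proj_unique) (auto simp: subspace_0)

lemma orth_proj_idem: "subspace S \<Longrightarrow> orth_proj S (orth_proj S v) = orth_proj S v"
  by (simp add: orth_proj_id orth_proj_in)

lemma orth_proj_inner: "subspace S \<Longrightarrow> w \<in> S \<Longrightarrow> orth_proj S v \<bullet> w = v \<bullet> w"
  using orth_proj_orth[of S w v] by (simp add: inner_diff_left)

lemma orth_proj_sym: "subspace S \<Longrightarrow> orth_proj S v \<bullet> w = v \<bullet> orth_proj S w"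
  by (metis inner_commute orth_proj_in orth_proj_inner)

lemma orthonormal_basis_props:
  assumes "subspace S"
  shows orthonormal_basis_subset: "orthonormal_basis S \<subseteq> S"
    and orthonormal_basis_finite: "finite (orthonormal_basis S)"
    and orthonormal_basis_card: "card (orthonormal_basis S) = dim S"
    and orthonormal_basis_span: "span (orthonormal_basis S) = S"
    and orthonormal_basis_inner: "\<And>e e'. e \<in> orthonormal_basis S \<Longrightarrow> e' \<in> orthonormal_basis S \<Longrightarrow> e \<bullet> e' = (if e = e' then 1 else 0)"
proof -
  let ?P = "\<lambda>b. b \<subseteq> S \<and> pairwise orthogonal b \<and> (\<forall>e\<in>b. norm e = 1) \<and> span b = S"
  obtain B where "?P B" using orthonormal_basis_subspace[OF assms] by metis
  then have *: "?P (orthonormal_basis S)" unfolding orthonormal_basis_def by (rule someI)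
  then show "orthonormal_basis S \<subseteq> S" "span (orthonormal_basis S) = S" by auto
  have ind: "independent (orthonormal_basis S)"
    using * by (intro pairwise_orthogonal_independent) auto
  then show "finite (orthonormal_basis S)" by (rule independent_imp_finite)
  show "card (orthonormal_basis S) = dim S"
    using * ind by (metis dim_span_eq_card_independent)
  show "e \<bullet> e' = (if e = e' then 1 else 0)" if "e \<in> orthonormal_basis S" "e' \<in> orthonormal_basis S" for e e'
    using * that by (auto simp: pairwise_def orthogonal_def dot_square_norm)
qed

text \<open>The sum of \<open>e\<close> tensor \<open>e\<close> over the orthonormal basis equals
  the sum of \<open>orth_proj S b\<close> tensor \<open>b\<close>. On the right the basis does not
  depend on \<open>S\<close>, so that traces over moving tangent spaces can be
  differentiated.\<close>

lemma sum_orthonormal_basis: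
  fixes B :: "'a::euclidean_space \<Rightarrow> 'a \<Rightarrow> 'b::real_vector"
  assumes S: "subspace S" and B1: "\<And>v. linear (\<lambda>u. B u v)" and B2: "\<And>u. linear (B u)"
  shows "(\<Sum>e\<in>orthonormal_basis S. B e e) = (\<Sum>b\<in>Basis. B (orth_proj S b) b)"
proof -
  let ?O = "orthonormal_basis S"
  note O = orthonormal_basis_props[OF S]
  have proj: "orth_proj S b = (\<Sum>e\<in>?O. (b \<bullet> e) *\<^sub>R e)" for b
  proof (rule orth_proj_unique[OF S])
    show "(\<Sum>e\<in>?O. (b \<bullet> e) *\<^sub>R e) \<in> S"
      using O by (intro subspace_sum S subspace_mul) auto
    have *: "(b - (\<Sum>e\<in>?O. (b \<bullet> e) *\<^sub>R e)) \<bullet> e' = 0" if "e' \<in> ?O" for e'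
    proof -
      have "(\<Sum>e\<in>?O. (b \<bullet> e) *\<^sub>R e) \<bullet> e' = (\<Sum>e\<in>?O. (b \<bullet> e) * (if e = e' then 1 else 0))"
        unfolding inner_sum_left using O(5) that by (intro sum.cong) auto
      also have "\<dots> = b \<bullet> e'" using O(2) that by (simp add: if_distrib cong: if_cong)
      finally show ?thesis by (simp add: inner_diff_left)
    qed
    fix w assume "w \<in> S"
    then have "w \<in> span ?O" using O(4) by simp
    then show "(b - (\<Sum>e\<in>?O. (b \<bullet> e) *\<^sub>R e)) \<bullet> w = 0"
      by (induction rule: span_induct_alt) (auto simp: inner_add_right *)
  qed
  have 1: "B (\<Sum>e\<in>?O. (b \<bullet> e) *\<^sub>R e) b = (\<Sum>e\<in>?O. (b \<bullet> e) *\<^sub>R B e b)" for b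
    by (simp add: linear_sum[OF B1] linear_scale[OF B1])
  have "(\<Sum>e\<in>?O. B e e) = (\<Sum>e\<in>?O. \<Sum>b\<in>Basis. (e \<bullet> b) *\<^sub>R B e b)"
    by (intro sum.cong refl linear_expand[OF B2])
  also have "\<dots> = (\<Sum>b\<in>Basis. \<Sum>e\<in>?O. (b \<bullet> e) *\<^sub>R B e b)"
    by (subst sum.swap) (simp add: inner_commute)
  also have "\<dots> = (\<Sum>b\<in>Basis. B (orth_proj S b) b)"
    unfolding proj 1 ..
  finally show ?thesis .
qed

section \<open>Smooth maps, tangent spaces and parametrizations\<close>

lemma smooth_onE:
  assumes "smooth_on S f" "p \<in> S"
  obtains U g where "open U" "p \<in> U" "smooth_open U g" "\<And>q. q \<in> S \<Longrightarrow> q \<in> U \<Longrightarrow> f q = g q"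
  using bspec[OF assms(1)[unfolded smooth_on_def] assms(2)] unfolding smooth_open_def by auto

lemma smooth_onI:
  assumes "\<And>p. p \<in> S \<Longrightarrow> \<exists>U g. open U \<and> p \<in> U \<and> smooth_open U g \<and> (\<forall>q\<in>S \<inter> U. f q = g q)"
  shows "smooth_on S f"
  using assms unfolding smooth_on_def smooth_open_def by blast

lemma smooth_on_const [simp]: "smooth_on S (\<lambda>x. c)"
  by (intro smooth_onI exI[of _ UNIV] exI[of _ "\<lambda>x. c"]) auto

lemma smooth_on_subset_cong:
  assumes "smooth_on S f" "T \<subseteq> S" "\<And>x. x \<in> T \<Longrightarrow> f x = g x"
  shows "smooth_on T g"
proof (rule smooth_onI)
  fix p assume p: "p \<in> T"
  then have "p \<in> S" using assms by blast
  then obtain U h where U: "open U" "p \<in> U" "smooth_open U h" "\<And>q. q \<in> S \<Longrightarrow> q \<in> U \<Longrightarrow> f q = h q"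
    using smooth_onE[OF assms(1)] by metis
  have "\<forall>q\<in>T \<inter> U. g q = h q"
  proof
    fix q assume q: "q \<in> T \<inter> U"
    then have "f q = h q" by (intro U(4)) (use assms(2) in auto)
    then show "g q = h q" using q assms(3) by auto
  qed
  with U show "\<exists>U h. open U \<and> p \<in> U \<and> smooth_open U h \<and> (\<forall>q\<in>T \<inter> U. g q = h q)" by blast
qed

lemmas smooth_on_cong = smooth_on_subset_cong[OF _ subset_refl]

lemma open_vimage_sm: "open U \<Longrightarrow> smooth_open U f \<Longrightarrow> open V \<Longrightarrow> open (U \<inter> f -` V)"
  using continuous_on_open_vimage[of U f] smooth_openD_cont by (metis inf_commute)

lemma smooth_on_compose:
  assumes f: "smooth_on S f" and g: "smooth_on T g" and fS: "f ` S \<subseteq> T"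
  shows "smooth_on S (\<lambda>x. g (f x))"
proof (rule smooth_onI)
  fix p assume p: "p \<in> S"
  obtain U f' where U: "open U" "p \<in> U" "smooth_open U f'" "\<And>q. q \<in> S \<Longrightarrow> q \<in> U \<Longrightarrow> f q = f' q"
    using smooth_onE[OF f p] by blast
  have "f p \<in> T" using p fS by auto
  then obtain V g' where V: "open V" "f p \<in> V" "smooth_open V g'" "\<And>q. q \<in> T \<Longrightarrow> q \<in> V \<Longrightarrow> g q = g' q"
    using smooth_onE[OF g] by blast
  have o: "open (U \<inter> f' -` V)" by (rule open_vimage_sm[OF U(1,3) V(1)])
  have "smooth_open (U \<inter> f' -` V) (\<lambda>x. g' (f' x))"
    by (rule smooth_open_compose[OF o V(1) _ smooth_open_subset[OF U(3)] V(3)]) auto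
  moreover have "p \<in> U \<inter> f' -` V" using p U V by auto
  moreover have "\<forall>q\<in>S \<inter> (U \<inter> f' -` V). g (f q) = g' (f' q)" using U(4) V(4) fS by force
  ultimately show "\<exists>U h. open U \<and> p \<in> U \<and> smooth_open U h \<and> (\<forall>q\<in>S \<inter> U. g (f q) = h q)"
    using o by (intro exI[of _ "U \<inter> f' -` V"] exI[of _ "\<lambda>x. g' (f' x)"]) auto
qed

lemma smooth_on_continuous:
  assumes "smooth_on S f"
  shows "continuous_on S f"
  unfolding continuous_on_def
proof
  fix p assume p: "p \<in> S"
  obtain U f' where U: "open U" "p \<in> U" "smooth_open U f'" "\<And>q. q \<in> S \<Longrightarrow> q \<in> U \<Longrightarrow> f q = f' q"
    using smooth_onE[OF assms p] by blast
  have "(f' \<longlongrightarrow> f' p) (at p within S)"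
    using smooth_openD_cont[OF U(3)] U(1,2) continuous_on_eq_continuous_at tendsto_within_subset
    by (metis continuous_at subset_UNIV)
  moreover have "\<forall>\<^sub>F q in at p within S. f' q = f q"
    unfolding eventually_at_topological using U by (intro exI[of _ U]) auto
  ultimately show "(f \<longlongrightarrow> f p) (at p within S)"
    using U(4)[OF p U(2)] Lim_transform_eventually by fastforce
qed

lemma has_derivative_differential:
  assumes "smooth_on M V" "p \<in> M"
  shows "(V has_derivative differential M V p) (at p within M)"
proof -
  obtain U g where U: "open U" "p \<in> U" "smooth_open U g" "\<And>q. q \<in> M \<Longrightarrow> q \<in> U \<Longrightarrow> V q = g q"
    using smooth_onE[OF assms] by blast
  obtain d where d: "d > 0" "ball p d \<subseteq> U" using U open_contains_ball by metis
  have "(g has_derivative fderiv g p) (at p within M)"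
    using smooth_openD_deriv[OF U(3,2)] has_derivative_at_withinI by blast
  then have "(V has_derivative fderiv g p) (at p within M)"
    by (rule has_derivative_transform_within[OF _ d(1) assms(2)])
      (use U(4) d(2) in \<open>auto simp: dist_commute subset_iff\<close>)
  then show ?thesis using differentiableI frechet_derivative_works by blast
qed

text \<open>A derivative of \<open>V\<close> within \<open>M\<close> suffices for the chain rule
  because \<open>\<rho>\<close> stays in \<open>M\<close>; the choice made by
  \<open>differential\<close> is therefore harmless.\<close>

lemma fderiv_differential:
  assumes V: "smooth_on M V" and W: "open W" "x \<in> W" "\<rho> ` W \<subseteq> M" and \<rho>: "\<rho> differentiable (at x)"
  shows "fderiv (\<lambda>y. V (\<rho> y)) x \<xi> = differential M V (\<rho> x) (fderiv \<rho> x \<xi>)"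
proof -
  have "(\<rho> has_derivative fderiv \<rho> x) (at x within W)"
    using fderiv_worksI[OF \<rho>] has_derivative_at_withinI by blast
  moreover have "(V has_derivative differential M V (\<rho> x)) (at (\<rho> x) within \<rho> ` W)"
    using has_derivative_differential[OF V] W has_derivative_subset by blast
  ultimately have "((V \<circ> \<rho>) has_derivative differential M V (\<rho> x) \<circ> fderiv \<rho> x) (at x within W)"
    by (rule diff_chain_within)
  then have "((V \<circ> \<rho>) has_derivative differential M V (\<rho> x) \<circ> fderiv \<rho> x) (at x)"
    unfolding at_within_open[OF W(2,1)] .
  from fun_cong[OF fderiv_eq[OF this], of \<xi>] show ?thesis by (simp add: o_def)
qed

lemma smooth_on_Ioo: "smooth_on {a<..<b::real} f \<longleftrightarrow> smooth_open {a<..<b} f"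
  by (rule smooth_on_open_iff) simp

lemma tangent_spaceE:
  assumes "v \<in> tangent_space M p"
  obtains \<gamma> and \<epsilon> :: real where "0 < \<epsilon>" "smooth_open {-\<epsilon><..<\<epsilon>} \<gamma>" "\<gamma> ` {-\<epsilon><..<\<epsilon>} \<subseteq> M" "\<gamma> 0 = p" "\<gamma> differentiable (at 0)" "fderiv \<gamma> 0 1 = v"
proof -
  obtain \<gamma> and \<epsilon> :: real where *: "0 < \<epsilon>" "smooth_on {-\<epsilon><..<\<epsilon>} \<gamma>" "\<gamma> ` {-\<epsilon><..<\<epsilon>} \<subseteq> M" "\<gamma> (0::real) = p"
    "(\<gamma> has_vector_derivative v) (at 0)"
    using assms unfolding tangent_space_def by auto
  have "fderiv \<gamma> 0 = (\<lambda>h. h *\<^sub>R v)" using *(5) unfolding has_vector_derivative_def by (rule fderiv_eq)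
  then have "fderiv \<gamma> 0 1 = v" by simp
  then show thesis
    using that[of \<epsilon> \<gamma>] * differentiableI_vector[OF *(5)] by (simp add: smooth_on_Ioo)
qed

lemma tangent_spaceI:
  assumes "0 < \<epsilon>" "smooth_open {-\<epsilon><..<\<epsilon>} \<gamma>" "\<gamma> ` {-\<epsilon><..<\<epsilon>} \<subseteq> M" "\<gamma> (0::real) = p" "fderiv \<gamma> 0 1 = v"
  shows "v \<in> tangent_space M p"
proof -
  have "(\<gamma> has_derivative fderiv \<gamma> 0) (at 0)" using assms smooth_openD_deriv by (metis greaterThanLessThan_iff neg_less_0_iff_less)
  moreover from this have lin: "linear (fderiv \<gamma> 0)" by (intro linear_fderiv) (auto simp: differentiable_def)
  have "fderiv \<gamma> 0 = (\<lambda>h. h *\<^sub>R v)"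
    using linear_scale[OF lin, of _ 1] assms(5) by (simp add: fun_eq_iff)
  ultimately have "(\<gamma> has_vector_derivative v) (at 0)"
    unfolding has_vector_derivative_def by simp
  then show ?thesis
    using assms unfolding tangent_space_def by (auto simp: smooth_on_Ioo)
qed

lemma fderiv_in_tangent_space:
  assumes W: "open W" "x \<in> W" "smooth_open W \<rho>" "\<rho> ` W \<subseteq> M"
  shows "fderiv \<rho> x \<xi> \<in> tangent_space M (\<rho> x)"
proof -
  have smooth_open: "smooth_open UNIV (\<lambda>t. x + t *\<^sub>R \<xi>)" for t :: real
    by (intro smooth_open_add smooth_open_scaleR smooth_open_ident smooth_open_const open_UNIV)
  have "open ((\<lambda>t. x + t *\<^sub>R \<xi>) -` W)" (is "open ?T")
    using open_vimage_sm[OF open_UNIV smooth_open W(1)] by simp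
  moreover have "0 \<in> ?T" using W by simp
  ultimately obtain \<epsilon> where \<epsilon>: "\<epsilon> > 0" "ball 0 \<epsilon> \<subseteq> ?T" using open_contains_ball by metis
  have sub: "{-\<epsilon><..<\<epsilon>} \<subseteq> ?T" using \<epsilon> by (auto simp: dist_real_def subset_iff)
  have d: "((\<lambda>t. x + t *\<^sub>R \<xi>) has_derivative (\<lambda>h. h *\<^sub>R \<xi>)) (at 0)"
    by (auto intro!: derivative_eq_intros)
  show ?thesis
  proof (rule tangent_spaceI[OF \<epsilon>(1), of "\<lambda>t. \<rho> (x + t *\<^sub>R \<xi>)"])
    show "smooth_open {-\<epsilon><..<\<epsilon>} (\<lambda>t. \<rho> (x + t *\<^sub>R \<xi>))"
      by (rule smooth_open_compose[OF _ W(1) _ smooth_open_subset[OF smooth_open] W(3)]) (use sub in auto)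
    show "fderiv (\<lambda>t. \<rho> (x + t *\<^sub>R \<xi>)) 0 1 = fderiv \<rho> x \<xi>"
      using fderiv_compose[of "\<lambda>t. x + t *\<^sub>R \<xi>" 0 \<rho> 1] d smooth_openD_diff[OF W(3,2)]
      by (auto simp: fderiv_eq[OF d] differentiable_def)
  qed (use sub W in auto)
qed

text \<open>Differentiate \<open>\<rho> (\<tau> (\<gamma> t)) = \<gamma> t\<close> for a curve with
  velocity \<open>v\<close>. This exhibits tangent vectors as values of the derivative of a
  parametrization.\<close>

lemma tangent_space_left_inverse:
  assumes \<tau>: "smooth_on M \<tau>" and p: "open U" "p \<in> U"
    and inv: "\<And>q. q \<in> M \<Longrightarrow> q \<in> U \<Longrightarrow> \<rho> (\<tau> q) = q"
    and \<rho>: "\<rho> differentiable (at (\<tau> p))" and v: "v \<in> tangent_space M p"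
  shows "fderiv \<rho> (\<tau> p) (differential M \<tau> p v) = v"
proof -
  obtain \<gamma> and \<epsilon> :: real where *: "0 < \<epsilon>" "smooth_open {-\<epsilon><..<\<epsilon>} \<gamma>" "\<gamma> ` {-\<epsilon><..<\<epsilon>} \<subseteq> M" "\<gamma> 0 = p" "\<gamma> differentiable (at 0)" "fderiv \<gamma> 0 1 = v"
    by (rule tangent_spaceE[OF v]) (rule that)
  have smooth_open: "smooth_on {-\<epsilon><..<\<epsilon>} (\<lambda>t. \<tau> (\<gamma> t))"
    by (rule smooth_on_compose[OF _ \<tau>]) (use * in \<open>auto simp: smooth_on_Ioo\<close>)
  have d: "fderiv (\<lambda>t. \<tau> (\<gamma> t)) 0 1 = differential M \<tau> p v"
    using fderiv_differential[OF \<tau> _ _ *(3,5)] * by auto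
  have dif: "(\<lambda>t. \<tau> (\<gamma> t)) differentiable (at 0)"
    using smooth_open *(1) by (intro smooth_openD_diff[of "{-\<epsilon><..<\<epsilon>}"]) (auto simp: smooth_on_Ioo)
  have o: "open ({-\<epsilon><..<\<epsilon>} \<inter> \<gamma> -` U)" by (rule open_vimage_sm[OF _ *(2) p(1)]) simp
  have "fderiv (\<lambda>t. \<rho> (\<tau> (\<gamma> t))) 0 1 = fderiv \<rho> (\<tau> p) (differential M \<tau> p v)"
    using fderiv_compose[OF dif, of \<rho>] \<rho> *(4) d by simp
  moreover have "fderiv (\<lambda>t. \<rho> (\<tau> (\<gamma> t))) 0 1 = fderiv \<gamma> 0 1"
    using fderiv_cong[OF o _ _ *(5), of "\<lambda>t. \<rho> (\<tau> (\<gamma> t))"] inv * p by fastforce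
  ultimately show ?thesis using * by simp
qed

lemma fderiv_normalize:
  assumes "x \<noteq> (0::'a::euclidean_space)"
  shows "fderiv (\<lambda>x. x /\<^sub>R norm x) x v = (v - ((x \<bullet> v) / (norm x)\<^sup>2) *\<^sub>R x) /\<^sub>R norm x"
proof -
  note GDERIV_norm[OF assms, unfolded gderiv_def, derivative_intros]
  have "((\<lambda>x. x /\<^sub>R norm x) has_derivative
    (\<lambda>v. (v - ((x \<bullet> v) / (norm x)\<^sup>2) *\<^sub>R x) /\<^sub>R norm x)) (at x)"
    using assms
    by (auto intro!: derivative_eq_intros simp: fun_eq_iff sgn_div_norm power2_eq_square algebra_simps divide_simps inner_commute)
  then show ?thesis by (simp add: fderiv_eq)
qed

text \<open>One inclusion differentiates \<open>\<gamma> t \<bullet> \<gamma> t = 1\<close>; the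
  other uses the radial projection, whose derivative at \<open>p\<close> fixes the vectors
  orthogonal to \<open>p\<close>.\<close>

lemma tangent_space_usphere:
  fixes p :: "'a::euclidean_space"
  assumes p: "p \<in> usphere"
  shows "tangent_space usphere p = {v. v \<bullet> p = 0}"
proof (intro equalityI subsetI CollectI)
  fix v assume "v \<in> tangent_space usphere p"
  then obtain \<gamma> and \<epsilon> :: real where *: "0 < \<epsilon>" "smooth_open {-\<epsilon><..<\<epsilon>} \<gamma>" "\<gamma> ` {-\<epsilon><..<\<epsilon>} \<subseteq> usphere" "\<gamma> 0 = p" "\<gamma> differentiable (at 0)" "fderiv \<gamma> 0 1 = v"
    by (rule tangent_spaceE) (rule that)
  have d: "((\<lambda>t. \<gamma> t \<bullet> \<gamma> t) has_derivative (\<lambda>h. \<gamma> 0 \<bullet> fderiv \<gamma> 0 h + fderiv \<gamma> 0 h \<bullet> \<gamma> 0)) (at 0)"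
    by (intro has_derivative_inner fderiv_worksI *)
  have "\<gamma> t \<bullet> \<gamma> t = 1" if "t \<in> {-\<epsilon><..<\<epsilon>}" for t
  proof -
    have "\<gamma> t \<in> usphere" using *(3) that by blast
    then show ?thesis by (simp add: dot_square_norm)
  qed
  then have "((\<lambda>t. 1) has_derivative (\<lambda>h. \<gamma> 0 \<bullet> fderiv \<gamma> 0 h + fderiv \<gamma> 0 h \<bullet> \<gamma> 0)) (at 0)"
    using *(1) by (intro has_derivative_transform_within_open[OF d, of "{-\<epsilon><..<\<epsilon>}"]) auto
  then have "(\<lambda>h. \<gamma> 0 \<bullet> fderiv \<gamma> 0 h + fderiv \<gamma> 0 h \<bullet> \<gamma> 0) = (\<lambda>h. 0)"
    using has_derivative_unique has_derivative_const by blast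
  from fun_cong[OF this, of 1] show "v \<bullet> p = 0" using * by (simp add: inner_commute)
next
  fix v assume "v \<in> {v. v \<bullet> p = 0}"
  moreover have "p \<noteq> 0" "norm p = 1" using p by auto
  ultimately have "fderiv (\<lambda>x. x /\<^sub>R norm x) p v = v"
    by (simp add: fderiv_normalize inner_commute)
  moreover have img: "(\<lambda>x::'a. x /\<^sub>R norm x) ` (-{0}) \<subseteq> usphere"
    by clarsimp (metis left_inverse norm_eq_zero)
  have "fderiv (\<lambda>x. x /\<^sub>R norm x) p v \<in> tangent_space usphere (p /\<^sub>R norm p)"
    by (rule fderiv_in_tangent_space[OF _ _ smooth_open_normalize img]) (use \<open>p \<noteq> 0\<close> in auto)
  ultimately show "v \<in> tangent_space usphere p" using \<open>norm p = 1\<close> by simp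
qed

text \<open>The domain may have larger dimension than \<open>M\<close>. This admits inverse charts
  precomposed with a linear projection, and later the extension of degree 0 of a parametrization by
  the round sphere.\<close>

definition param :: "'b::euclidean_space set \<Rightarrow> 'c::euclidean_space set \<Rightarrow> ('c \<Rightarrow> 'b) \<Rightarrow> bool" where
  "param M W \<rho> \<longleftrightarrow> open W \<and> smooth_open W \<rho> \<and> \<rho> ` W \<subseteq> M \<and> (\<forall>x\<in>W. tangent_space M (\<rho> x) = range (fderiv \<rho> x))"

text \<open>The inverse of the slice chart is precomposed with the projection onto \<open>L\<close>,
  so that it lives on an open set of the full space and ordinary derivatives apply; the price is the
  kernel of that projection. \<open>\<sigma>\<close> is the chart itself, extended smoothly to an
  open set.\<close>

lemma slice_chart:
  fixes M :: "'b::euclidean_space set"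
  assumes M: "embedded_manifold m M" and p: "p \<in> M"
  obtains W and \<rho> :: "'b \<Rightarrow> 'b" and L U \<sigma> where "param M W \<rho>" "subspace L" "dim L = m"
    "\<And>x \<xi>. x \<in> W \<Longrightarrow> fderiv \<rho> x \<xi> = 0 \<longleftrightarrow> orth_proj L \<xi> = 0"
    "open U" "p \<in> U" "smooth_open U \<sigma>" "\<sigma> ` U \<subseteq> W \<inter> L" "\<And>q. q \<in> M \<Longrightarrow> q \<in> U \<Longrightarrow> \<rho> (\<sigma> q) = q"
proof -
  obtain U W \<Phi> \<Psi> L where U: "open U" "p \<in> U" "open W" and hom: "homeomorphism U W \<Phi> \<Psi>"
    and sm0: "smooth_on U \<Phi>" "smooth_on W \<Psi>" and L: "subspace (L::'b set)" "dim L = m"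
    and slice: "\<Phi> ` (M \<inter> U) = W \<inter> L"
    using M p unfolding embedded_manifold_def by metis
  have smooth_open: "smooth_open U \<Phi>" "smooth_open W \<Psi>" using sm0 U by (auto simp: smooth_on_open_iff)
  define \<pi> where "\<pi> = orth_proj L"
  have \<pi>: "linear \<pi>" "\<pi> x \<in> L" "y \<in> L \<Longrightarrow> \<pi> y = y" for x y
    using L by (auto simp: \<pi>_def linear_orth_proj orth_proj_in orth_proj_id)
  have bl: "bounded_linear \<pi>" using \<pi> linear_conv_bounded_linear by blast
  have \<pi>d: "(\<pi> has_derivative \<pi>) (at x)" for x
    using bl bounded_linear_imp_has_derivative by blast
  define W' where "W' = \<pi> -` W"
  have oW': "open W'"
    using open_vimage_sm[OF open_UNIV smooth_open_linear[OF bl] U(3)] by (simp add: W'_def)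
  define \<rho> where "\<rho> x = \<Psi> (\<pi> x)" for x
  have sm\<rho>: "smooth_open W' \<rho>"
    unfolding \<rho>_def by (rule smooth_open_compose[OF oW' U(3) _ smooth_open_linear[OF bl] smooth_open(2)]) (auto simp: W'_def)
  have \<rho>M: "\<rho> x \<in> M \<inter> U" "\<Phi> (\<rho> x) = \<pi> x" if "x \<in> W'" for x
  proof -
    have "\<pi> x \<in> W \<inter> L" using that \<pi> by (auto simp: W'_def)
    then obtain q where q: "q \<in> M \<inter> U" "\<Phi> q = \<pi> x" using slice by (metis imageE)
    moreover have "\<Psi> (\<Phi> q) = q" using hom q homeomorphism_apply1 by blast
    ultimately show "\<rho> x \<in> M \<inter> U" "\<Phi> (\<rho> x) = \<pi> x" unfolding \<rho>_def by auto
  qed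
  have \<Phi>L: "\<Phi> q \<in> W \<inter> L" "\<Psi> (\<Phi> q) = q" if "q \<in> M" "q \<in> U" for q
    using that slice hom by (auto simp: homeomorphism_apply1)
  define U' where "U' = U \<inter> (\<lambda>q. \<pi> (\<Phi> q)) -` W"
  define \<sigma> where "\<sigma> q = \<pi> (\<Phi> q)" for q
  have sm\<sigma>U: "smooth_open U \<sigma>"
    unfolding \<sigma>_def by (rule smooth_open_compose[OF U(1) open_UNIV _ smooth_open(1) smooth_open_linear[OF bl]]) auto
  have U': "open U'" "p \<in> U'"
    using open_vimage_sm[OF U(1) sm\<sigma>U U(3)] \<Phi>L[OF p U(2)] \<pi> U unfolding U'_def \<sigma>_def by auto
  have sm\<sigma>: "smooth_open U' \<sigma>" using sm\<sigma>U smooth_open_subset U'_def by blast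
  have \<sigma>U: "\<sigma> ` U' \<subseteq> W' \<inter> L" using \<pi> by (auto simp: U'_def W'_def \<sigma>_def)
  have \<rho>\<sigma>: "\<rho> (\<sigma> q) = q" if "q \<in> M" "q \<in> U" for q
    using \<Phi>L[OF that] \<pi> by (auto simp: \<rho>_def \<sigma>_def)
  have \<rho>\<pi>: "fderiv \<rho> x \<xi> = fderiv \<rho> (\<pi> x) (\<pi> \<xi>)" if "x \<in> W'" for x \<xi>
  proof -
    have "\<pi> x \<in> W'" using that \<pi> by (auto simp: W'_def)
    then have "fderiv (\<lambda>x. \<rho> (\<pi> x)) x \<xi> = fderiv \<rho> (\<pi> x) (fderiv \<pi> x \<xi>)"
      by (intro fderiv_compose smooth_openD_diff[OF sm\<rho>]) (use \<pi>d differentiable_def in blast)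
    moreover have "(\<lambda>x. \<rho> (\<pi> x)) = \<rho>" using \<pi> by (simp add: \<rho>_def fun_eq_iff)
    ultimately show ?thesis by (simp add: fderiv_eq[OF \<pi>d])
  qed
  have tan: "tangent_space M (\<rho> x) = range (fderiv \<rho> x)" if x: "x \<in> W'" for x
  proof (intro equalityI subsetI)
    fix v assume v: "v \<in> tangent_space M (\<rho> x)"
    obtain \<gamma> and \<epsilon> :: real where *: "0 < \<epsilon>" "smooth_open {-\<epsilon><..<\<epsilon>} \<gamma>" "\<gamma> ` {-\<epsilon><..<\<epsilon>} \<subseteq> M" "\<gamma> 0 = \<rho> x" "\<gamma> differentiable (at 0)" "fderiv \<gamma> 0 1 = v"
      by (rule tangent_spaceE[OF v]) (rule that)
    have xU: "\<rho> x \<in> U" using \<rho>M[OF x] by simp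
    have \<sigma>x: "\<sigma> (\<rho> x) = \<pi> x" using \<rho>M[OF x] \<pi> by (simp add: \<sigma>_def)
    have \<pi>x: "\<pi> x \<in> W'" using x \<pi> by (auto simp: W'_def)
    have d1: "\<sigma> differentiable (at (\<gamma> 0))" using *(4) xU smooth_openD_diff[OF sm\<sigma>U] by simp
    have d2: "(\<lambda>t. \<sigma> (\<gamma> t)) differentiable (at 0)"
      using differentiable_chain_at[OF *(5) d1] by (simp add: o_def)
    have o: "open ({-\<epsilon><..<\<epsilon>} \<inter> \<gamma> -` U)" by (rule open_vimage_sm[OF _ *(2) U(1)]) simp
    have "fderiv \<gamma> 0 1 = fderiv (\<lambda>t. \<rho> (\<sigma> (\<gamma> t))) 0 1"
      using fderiv_cong[OF o _ _ *(5), of "\<lambda>t. \<rho> (\<sigma> (\<gamma> t))"] \<rho>\<sigma> * xU by fastforce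
    also have "\<dots> = fderiv \<rho> (\<pi> x) (fderiv (\<lambda>t. \<sigma> (\<gamma> t)) 0 1)"
      using fderiv_compose[OF d2, of \<rho>] *(4) \<sigma>x smooth_openD_diff[OF sm\<rho> \<pi>x] by simp
    also have "fderiv (\<lambda>t. \<sigma> (\<gamma> t)) 0 1 = \<pi> (fderiv (\<lambda>t. \<Phi> (\<gamma> t)) 0 1)"
    proof -
      have "(\<lambda>t. \<Phi> (\<gamma> t)) differentiable (at 0)"
        using differentiable_chain_at[OF *(5), of \<Phi>] *(4) xU smooth_openD_diff[OF smooth_open(1)] by (simp add: o_def)
      then show ?thesis
        unfolding \<sigma>_def using fderiv_compose[of "\<lambda>t. \<Phi> (\<gamma> t)" 0 \<pi> 1] \<pi>d
        by (auto simp: fderiv_eq[OF \<pi>d] differentiable_def)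
    qed
    also have "fderiv \<rho> (\<pi> x) (\<pi> (fderiv (\<lambda>t. \<Phi> (\<gamma> t)) 0 1)) = fderiv \<rho> x (fderiv (\<lambda>t. \<Phi> (\<gamma> t)) 0 1)"
      by (simp add: \<rho>\<pi>[OF x])
    finally show "v \<in> range (fderiv \<rho> x)" using * by auto
  next
    fix v assume "v \<in> range (fderiv \<rho> x)"
    then show "v \<in> tangent_space M (\<rho> x)"
      using fderiv_in_tangent_space[OF oW' x sm\<rho>] \<rho>M by blast
  qed
  have ker: "fderiv \<rho> x \<xi> = 0 \<longleftrightarrow> \<pi> \<xi> = 0" if x: "x \<in> W'" for x \<xi>
  proof
    assume "\<pi> \<xi> = 0"
    moreover have "\<pi> x \<in> W'" using x \<pi> by (auto simp: W'_def)
    ultimately show "fderiv \<rho> x \<xi> = 0"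
      using linear_0[OF linear_fderiv[OF smooth_openD_diff[OF sm\<rho>]]] by (simp add: \<rho>\<pi>[OF x])
  next
    assume 0: "fderiv \<rho> x \<xi> = 0"
    have dd: "\<Phi> differentiable (at (\<rho> x))" using \<rho>M[OF x] smooth_openD_diff[OF smooth_open(1)] by simp
    have "fderiv \<pi> x \<xi> = fderiv (\<lambda>x. \<Phi> (\<rho> x)) x \<xi>"
      using fderiv_cong[OF oW' x, of \<pi> "\<lambda>x. \<Phi> (\<rho> x)"] \<rho>M \<pi>d differentiable_def by metis
    also have "\<dots> = fderiv \<Phi> (\<rho> x) (fderiv \<rho> x \<xi>)"
      by (rule fderiv_compose[OF smooth_openD_diff[OF sm\<rho> x] dd])
    also have "\<dots> = 0" using 0 linear_0[OF linear_fderiv[OF dd]] by simp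
    finally show "\<pi> \<xi> = 0" by (simp add: fderiv_eq[OF \<pi>d])
  qed
  have "param M W' \<rho>" unfolding param_def using oW' sm\<rho> \<rho>M tan by auto
  from that[OF this L ker[unfolded \<pi>_def] U' sm\<sigma> \<sigma>U] show thesis
    using \<rho>\<sigma> by (auto simp: U'_def)
qed

section \<open>Differentiation of fields along an immersion\<close>

text \<open>The choice operator inside \<open>frechet_derivative\<close> sees the same candidates
  for both functions, so it picks the same map, even off the tangent space.\<close>

lemma differential_cong:
  assumes "p \<in> M" "\<And>q. q \<in> M \<Longrightarrow> f q = g q"
  shows "differential M f p = differential M g p"
proof -
  have "(f has_derivative D) (at p within M) \<longleftrightarrow> (g has_derivative D) (at p within M)" for D
    using assms has_derivative_transform[of p M] by metis
  then show ?thesis unfolding frechet_derivative_def by simp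
qed

locale immersed_submanifold =
  fixes m :: nat and M :: "'b::euclidean_space set" and F :: "'b \<Rightarrow> 'a::euclidean_space"
  assumes immersed: "immersed_in_sphere m M F"
begin

lemma smooth_F: "smooth_on M F"
  and F_sphere: "p \<in> M \<Longrightarrow> norm (F p) = 1"
  and inj_dF: "p \<in> M \<Longrightarrow> inj_on (differential M F p) (tangent_space M p)"
  and embedded: "embedded_manifold m M"
  using immersed unfolding immersed_in_sphere_def by (auto simp: image_subset_iff)

lemma F_F: "p \<in> M \<Longrightarrow> F p \<bullet> F p = 1"
  by (simp add: F_sphere dot_square_norm)

abbreviation "P p \<equiv> orth_proj (tang M F p)"

text \<open>A constant vector \<open>v\<close> of the ambient space acts on fields through its tangential part, that is,
  as the derivative along \<^term>\<open>tang_ext M F v\<close>.  Local frames of the tangent bundle are thereby avoided.\<close>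

definition dd :: "'a \<Rightarrow> ('b \<Rightarrow> 'd::euclidean_space) \<Rightarrow> 'b \<Rightarrow> 'd" where
  "dd v V p = differential M V p (inv_into (tangent_space M p) (differential M F p) (P p v))"

lemma param_sm: "param M W \<rho> \<Longrightarrow> smooth_on M V \<Longrightarrow> smooth_open W (\<lambda>y. V (\<rho> y))"
  using smooth_on_compose[of W \<rho> M V] smooth_on_open_iff unfolding param_def by metis

lemma param_fderiv:
  assumes "param M W \<rho>" "x \<in> W" "smooth_on M V"
  shows "fderiv (\<lambda>y. V (\<rho> y)) x \<xi> = differential M V (\<rho> x) (fderiv \<rho> x \<xi>)"
  using assms unfolding param_def by (intro fderiv_differential[of _ _ W] smooth_openD_diff[of W]) auto

lemma param_tang:
  assumes "param M W \<rho>" "x \<in> W"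
  shows "tang M F (\<rho> x) = range (fderiv (\<lambda>y. F (\<rho> y)) x)"
  using assms unfolding tang_def param_fderiv[OF assms smooth_F, abs_def] param_def by auto

lemma param_inv_into:
  assumes "param M W \<rho>" "x \<in> W"
  shows "inv_into (tangent_space M (\<rho> x)) (differential M F (\<rho> x)) (fderiv (\<lambda>y. F (\<rho> y)) x \<xi>) = fderiv \<rho> x \<xi>"
proof -
  have "\<rho> x \<in> M" "fderiv \<rho> x \<xi> \<in> tangent_space M (\<rho> x)" using assms unfolding param_def by auto
  then show ?thesis
    unfolding param_fderiv[OF assms smooth_F] by (intro inv_into_f_f inj_dF)
qed

lemma param_field_deriv:
  assumes "param M W \<rho>" "x \<in> W" "smooth_on M V" "X (\<rho> x) = fderiv (\<lambda>y. F (\<rho> y)) x \<xi>"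
  shows "field_deriv M F X V (\<rho> x) = fderiv (\<lambda>y. V (\<rho> y)) x \<xi>"
  unfolding field_deriv_def assms(4) param_inv_into[OF assms(1,2)] param_fderiv[OF assms(1-3)] ..

lemma param_dd:
  assumes "param M W \<rho>" "x \<in> W" "smooth_on M V" "P (\<rho> x) v = fderiv (\<lambda>y. F (\<rho> y)) x \<xi>"
  shows "dd v V (\<rho> x) = fderiv (\<lambda>y. V (\<rho> y)) x \<xi>"
  unfolding dd_def assms(4) param_inv_into[OF assms(1,2)] param_fderiv[OF assms(1-3)] ..

text \<open>\<open>A x\<close> lifts the tangential part of an ambient vector to the parameter
  domain, so that \<open>dd\<close> becomes an ordinary directional derivative in a smoothly varying
  direction.\<close>

definition frame :: "'c::euclidean_space set \<Rightarrow> ('c \<Rightarrow> 'b) \<Rightarrow> ('c \<Rightarrow> 'a \<Rightarrow> 'c) \<Rightarrow> bool" where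
  "frame W \<rho> A \<longleftrightarrow> param M W \<rho> \<and> (\<forall>x\<in>W. linear (A x)) \<and> (\<forall>w. smooth_open W (\<lambda>x. A x w)) \<and>
     (\<forall>x\<in>W. \<forall>w. fderiv (\<lambda>y. F (\<rho> y)) x (A x w) = P (\<rho> x) w)"

text \<open>\<open>A x w\<close> solves the normal equations of the least squares problem
  \<open>fderiv h x y = w\<close>. With \<open>T x\<close> the adjoint of \<open>fderiv h x\<close>,
  the operator \<open>T x (fderiv h x y)\<close> is completed by \<open>y - \<pi> y\<close> to an
  invertible one, and \<open>smooth_open_solve\<close> yields smooth dependence on
  \<open>x\<close>.\<close>

lemma frame_exists:
  assumes p: "p \<in> M"
  obtains W and \<rho> :: "'b \<Rightarrow> 'b" and A U \<sigma> where "frame W \<rho> A"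
    "open U" "p \<in> U" "smooth_open U \<sigma>" "\<sigma> ` U \<subseteq> W" "\<And>q. q \<in> M \<Longrightarrow> q \<in> U \<Longrightarrow> \<rho> (\<sigma> q) = q"
    "subspace (tang M F p)" "dim (tang M F p) = m"
proof -
  obtain W and \<rho> :: "'b \<Rightarrow> 'b" and L U \<sigma> where \<rho>: "param M W \<rho>" and L: "subspace L" "dim L = m"
    and ker: "\<And>x \<xi>. x \<in> W \<Longrightarrow> fderiv \<rho> x \<xi> = 0 \<longleftrightarrow> orth_proj L \<xi> = 0"
    and U: "open U" "p \<in> U" "smooth_open U \<sigma>" "\<sigma> ` U \<subseteq> W" "\<And>q. q \<in> M \<Longrightarrow> q \<in> U \<Longrightarrow> \<rho> (\<sigma> q) = q"
    using slice_chart[OF embedded p] by (metis le_inf_iff)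
  have W: "open W" using \<rho> by (simp add: param_def)
  define h where "h y = F (\<rho> y)" for y
  have smh: "smooth_open W h" unfolding h_def by (rule param_sm[OF \<rho> smooth_F])
  define \<pi> where "\<pi> = orth_proj L"
  have lin\<pi>: "linear \<pi>" unfolding \<pi>_def by (rule linear_orth_proj[OF L(1)])
  have lin: "linear (fderiv h x)" if "x \<in> W" for x by (rule linear_fderiv[OF smooth_openD_diff[OF smh that]])
  have kerh: "fderiv h x \<xi> = 0 \<longleftrightarrow> \<pi> \<xi> = 0" if x: "x \<in> W" for x \<xi>
  proof
    assume "\<pi> \<xi> = 0"
    then have "fderiv \<rho> x \<xi> = fderiv \<rho> x 0"
      using ker[OF x, of \<xi>] ker[OF x, of 0] linear_0[OF lin\<pi>] by (simp add: \<pi>_def)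
    then show "fderiv h x \<xi> = 0"
      using param_fderiv[OF \<rho> x smooth_F, of \<xi>] param_fderiv[OF \<rho> x smooth_F, of 0] linear_0[OF lin[OF x]]
      unfolding h_def by simp
  next
    assume 0: "fderiv h x \<xi> = 0"
    have "fderiv \<rho> x \<xi> = inv_into (tangent_space M (\<rho> x)) (differential M F (\<rho> x)) (fderiv h x \<xi>)"
      unfolding h_def param_inv_into[OF \<rho> x] ..
    also have "\<dots> = inv_into (tangent_space M (\<rho> x)) (differential M F (\<rho> x)) (fderiv h x 0)"
      using 0 linear_0[OF lin[OF x]] by simp
    also have "\<dots> = fderiv \<rho> x 0"
      unfolding h_def param_inv_into[OF \<rho> x] ..
    finally show "\<pi> \<xi> = 0" using ker[OF x, of \<xi>] ker[OF x, of 0] linear_0[OF lin\<pi>] by (simp add: \<pi>_def)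
  qed
  have tang: "tang M F (\<rho> x) = range (fderiv h x)" if "x \<in> W" for x
    using param_tang[OF \<rho> that] unfolding h_def .
  have sub: "subspace (tang M F (\<rho> x))" if "x \<in> W" for x
    unfolding tang[OF that] by (rule linear_subspace_image[OF lin[OF that] subspace_UNIV])
  have dim: "dim (tang M F (\<rho> x)) = m" if x: "x \<in> W" for x
  proof -
    have "fderiv h x \<xi> = fderiv h x (\<pi> \<xi>)" for \<xi>
    proof -
      have "\<pi> (\<xi> - \<pi> \<xi>) = 0"
        using L by (simp add: linear_diff[OF lin\<pi>]) (simp add: \<pi>_def orth_proj_idem)
      then have "fderiv h x (\<xi> - \<pi> \<xi>) = 0" by (simp add: kerh[OF x])
      then show ?thesis by (simp add: linear_diff[OF lin[OF x]])
    qed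
    moreover have "\<pi> \<xi> \<in> L" for \<xi> unfolding \<pi>_def by (rule orth_proj_in[OF L(1)])
    ultimately have "range (fderiv h x) = fderiv h x ` L" by (metis (no_types, lifting) UNIV_I image_cong image_iff image_subset_iff subsetI subset_antisym)
    moreover have "inj_on (fderiv h x) (span L)"
    proof -
      have "\<xi> = 0" if "\<xi> \<in> L" "fderiv h x \<xi> = 0" for \<xi>
        using that kerh[OF x, of \<xi>] orth_proj_id[OF L(1)] by (simp add: \<pi>_def)
      then show ?thesis
        using linear_inj_on_iff_eq_0[OF lin[OF x], of L] L(1) by (simp add: span_eq_iff[THEN iffD2])
    qed
    ultimately show ?thesis using dim_image_eq[OF lin[OF x]] L tang[OF x] by metis
  qed
  define T where "T x w = (\<Sum>b\<in>Basis. (fderiv h x b \<bullet> w) *\<^sub>R b)" for x w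
  have T_inner: "T x w \<bullet> \<xi> = fderiv h x \<xi> \<bullet> w" if "x \<in> W" for x w \<xi>
  proof -
    have "fderiv h x \<xi> \<bullet> w = (\<Sum>b\<in>Basis. (\<xi> \<bullet> b) * (fderiv h x b \<bullet> w))"
      by (subst linear_expand[OF lin[OF that]]) (simp add: inner_sum_left)
    moreover have "T x w \<bullet> \<xi> = (\<Sum>b\<in>Basis. (fderiv h x b \<bullet> w) * (b \<bullet> \<xi>))"
      unfolding T_def by (simp add: inner_sum_left)
    ultimately show ?thesis by (simp add: inner_commute mult.commute)
  qed
  have smT: "smooth_open W (\<lambda>x. T x (w x))" if "smooth_open W w" for w
    unfolding T_def by (intro smooth_open_sum smooth_open_scaleR smooth_open_inner smooth_openD_fderiv smh that smooth_open_const W finite_Basis)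
  define G where "G x y = T x (fderiv h x y) + (y - \<pi> y)" for x y
  have linT: "linear (T x)" for x
    unfolding T_def by (intro linearI) (simp_all add: inner_add_right scaleR_add_left sum.distrib scaleR_sum_right)
  have linG: "linear (G x)" if "x \<in> W" for x
  proof -
    have "linear (\<lambda>y. T x (fderiv h x y))"
      using linear_compose[OF lin[OF that] linT] by (simp add: o_def)
    then show ?thesis unfolding G_def
      by (intro linear_compose_add linear_compose_sub lin\<pi> linear_ident)
  qed
  have \<pi>_orth: "(y - \<pi> y) \<bullet> y = (y - \<pi> y) \<bullet> (y - \<pi> y)" for y
    using orth_proj_orth[OF L(1) orth_proj_in[OF L(1)], of y y] by (simp add: \<pi>_def inner_diff_right)
  have injG: "inj (G x)" if x: "x \<in> W" for x
    unfolding linear_injective_0[OF linG[OF x]]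
  proof (intro allI impI)
    fix y assume "G x y = 0"
    then have "0 = G x y \<bullet> y" by simp
    also have "\<dots> = fderiv h x y \<bullet> fderiv h x y + (y - \<pi> y) \<bullet> (y - \<pi> y)"
      unfolding G_def by (simp add: inner_add_left T_inner[OF x] \<pi>_orth)
    finally have "fderiv h x y \<bullet> fderiv h x y = 0" "(y - \<pi> y) \<bullet> (y - \<pi> y) = 0"
      using inner_ge_zero[of "fderiv h x y"] inner_ge_zero[of "y - \<pi> y"] by linarith+
    then show "y = 0" using kerh[OF x, of y] by simp
  qed
  define H where "H x = inv (G x)" for x
  have HG: "H x (G x w) = w" "G x (H x w) = w" if "x \<in> W" for x w
    using injG[OF that] linear_injective_imp_surjective[OF linG[OF that] injG[OF that]]
    unfolding H_def by (auto simp: surj_f_inv_f)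
  have smG: "smooth_open W (\<lambda>x. G x w)" for w
    unfolding G_def by (intro smooth_open_add smT smooth_openD_fderiv smh smooth_open_const W)
  define A where "A x w = H x (T x w)" for x w
  have linH: "linear (H x)" if "x \<in> W" for x
    using inj_linear_imp_inv_linear[OF linG[OF that] injG[OF that]] unfolding H_def .
  have "linear (A x)" if "x \<in> W" for x
  proof -
    have "A x = H x \<circ> T x" by (simp add: A_def fun_eq_iff)
    then show ?thesis using linear_compose[OF linT linH[OF that]] by simp
  qed
  moreover have "smooth_open W (\<lambda>x. A x w)" for w
    unfolding A_def by (rule smooth_open_solve[where G=G, OF W linG HG(2,1) smG smT[OF smooth_open_const]])
  moreover have "fderiv h x (A x w) = P (\<rho> x) w" if x: "x \<in> W" for x w
  proof (rule orth_proj_unique[OF sub[OF x], symmetric])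
    show "fderiv h x (A x w) \<in> tang M F (\<rho> x)" using tang[OF x] by simp
    let ?y = "A x w"
    have eq: "(fderiv h x \<xi> \<bullet> fderiv h x ?y) + (?y - \<pi> ?y) \<bullet> \<xi> = fderiv h x \<xi> \<bullet> w" for \<xi>
    proof -
      have "G x ?y = T x w" unfolding A_def by (rule HG(2)[OF x])
      then have "G x ?y \<bullet> \<xi> = fderiv h x \<xi> \<bullet> w" by (simp add: T_inner[OF x])
      then show ?thesis unfolding G_def by (simp add: inner_add_left T_inner[OF x])
    qed
    have "\<pi> (?y - \<pi> ?y) = 0"
      using L by (simp add: linear_diff[OF lin\<pi>]) (simp add: \<pi>_def orth_proj_idem)
    then have "fderiv h x (?y - \<pi> ?y) = 0" by (simp add: kerh[OF x])
    \<comment> \<open>The test vector lies in the kernel of \<open>fderiv h x\<close>, which leaves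
      only its squared norm. So the completing term does not disturb the solution.\<close>
    then have "?y - \<pi> ?y = 0" using eq[of "?y - \<pi> ?y"] by simp
    then have "fderiv h x \<xi> \<bullet> fderiv h x ?y = fderiv h x \<xi> \<bullet> w" for \<xi> using eq[of \<xi>] by simp
    then show "(w - fderiv h x ?y) \<bullet> v = 0" if "v \<in> tang M F (\<rho> x)" for v
      using that unfolding tang[OF x] by (auto simp: inner_diff_left inner_diff_right inner_commute)
  qed
  ultimately have "frame W \<rho> A" unfolding frame_def h_def using \<rho> by blast
  moreover have "\<sigma> p \<in> W" "\<rho> (\<sigma> p) = p" using U p by auto
  ultimately show thesis using that U sub[of "\<sigma> p"] dim[of "\<sigma> p"] by metis
qed

lemma frame_at:
  assumes p: "p \<in> M"
  obtains W and \<rho> :: "'b \<Rightarrow> 'b" and A x where "frame W \<rho> A" "x \<in> W" "\<rho> x = p"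
proof -
  obtain W and \<rho> :: "'b \<Rightarrow> 'b" and A U \<sigma> where "frame W \<rho> A"
    "open U" "p \<in> U" "smooth_open U \<sigma>" "\<sigma> ` U \<subseteq> W" "\<And>q. q \<in> M \<Longrightarrow> q \<in> U \<Longrightarrow> \<rho> (\<sigma> q) = q"
    using frame_exists[OF p] by metis
  then show thesis using that[of W \<rho> A "\<sigma> p"] p by auto
qed

lemma subspace_tang: "p \<in> M \<Longrightarrow> subspace (tang M F p)"
  and dim_tang: "p \<in> M \<Longrightarrow> dim (tang M F p) = m"
  using frame_exists by metis+

text \<open>As \<open>\<sigma>\<close> is smooth on an open set of the ambient space,
  \<open>V (\<rho> (\<sigma> q))\<close> is the local extension that \<open>smooth_on\<close> asks
  for.\<close>

lemma smooth_on_frameI: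
  assumes "\<And>W A (\<rho> :: 'b \<Rightarrow> 'b). frame W \<rho> A \<Longrightarrow> smooth_open W (\<lambda>x. V (\<rho> x))"
  shows "smooth_on M V"
proof (rule smooth_onI)
  fix p assume p: "p \<in> M"
  obtain W and \<rho> :: "'b \<Rightarrow> 'b" and A U \<sigma> where fr: "frame W \<rho> A"
    and U: "open U" "p \<in> U" "smooth_open U \<sigma>" "\<sigma> ` U \<subseteq> W" "\<And>q. q \<in> M \<Longrightarrow> q \<in> U \<Longrightarrow> \<rho> (\<sigma> q) = q"
    using frame_exists[OF p] by metis
  have W: "open W" using fr by (simp add: frame_def param_def)
  have "smooth_open U (\<lambda>q. V (\<rho> (\<sigma> q)))"
    by (rule smooth_open_compose[OF U(1) W U(4,3) assms[OF fr]])
  then show "\<exists>U g. open U \<and> p \<in> U \<and> smooth_open U g \<and> (\<forall>q\<in>M \<inter> U. V q = g q)"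
    using U by (intro exI[of _ U] exI[of _ "\<lambda>q. V (\<rho> (\<sigma> q))"]) auto
qed

context
  fixes W \<rho> A x assumes fr: "frame W \<rho> A" and x: "x \<in> W"
begin

lemma frame_dd: "smooth_on M V \<Longrightarrow> dd v V (\<rho> x) = fderiv (\<lambda>y. V (\<rho> y)) x (A x v)"
  using fr x by (intro param_dd[of W]) (auto simp: frame_def)

lemma frame_P: "P (\<rho> x) v = fderiv (\<lambda>y. F (\<rho> y)) x (A x v)"
  using fr x by (auto simp: frame_def)

lemma frame_M: "\<rho> x \<in> M"
  using fr x by (auto simp: frame_def param_def)

end

lemma frame_open: "frame W \<rho> A \<Longrightarrow> open W"
  and frame_sm: "frame W \<rho> A \<Longrightarrow> smooth_on M V \<Longrightarrow> smooth_open W (\<lambda>x. V (\<rho> x))"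
  and frame_sm_A: "frame W \<rho> A \<Longrightarrow> smooth_open W (\<lambda>x. A x w)"
  and frame_linear_A: "frame W \<rho> A \<Longrightarrow> x \<in> W \<Longrightarrow> linear (A x)"
  by (auto simp: frame_def param_def intro: param_sm)

lemma smooth_P: "smooth_on M (\<lambda>q. P q v)"
proof (rule smooth_on_frameI)
  fix W A and \<rho> :: "'b \<Rightarrow> 'b" assume fr: "frame W \<rho> A"
  have smh: "smooth_open W (\<lambda>y. F (\<rho> y))" by (rule frame_sm[OF fr smooth_F])
  have "smooth_open W (\<lambda>x. fderiv (\<lambda>y. F (\<rho> y)) x (A x v))"
    by (rule smooth_open_apply[OF frame_open[OF fr] linear_fderiv[OF smooth_openD_diff[OF smh]] smooth_openD_fderiv[OF smh] frame_sm_A[OF fr]])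
  then show "smooth_open W (\<lambda>x. P (\<rho> x) v)"
    by (rule smooth_open_cong[OF frame_open[OF fr]]) (simp add: frame_P[OF fr])
qed

lemma smooth_dd:
  assumes V: "smooth_on M V"
  shows "smooth_on M (dd v V)"
proof (rule smooth_on_frameI)
  fix W A and \<rho> :: "'b \<Rightarrow> 'b" assume fr: "frame W \<rho> A"
  have smh: "smooth_open W (\<lambda>y. V (\<rho> y))" by (rule frame_sm[OF fr V])
  have "smooth_open W (\<lambda>x. fderiv (\<lambda>y. V (\<rho> y)) x (A x v))"
    by (rule smooth_open_apply[OF frame_open[OF fr] linear_fderiv[OF smooth_openD_diff[OF smh]] smooth_openD_fderiv[OF smh] frame_sm_A[OF fr]])
  then show "smooth_open W (\<lambda>x. dd v V (\<rho> x))"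
    by (rule smooth_open_cong[OF frame_open[OF fr]]) (simp add: frame_dd[OF fr _ V])
qed

lemma smooth_bilinear:
  assumes "bounded_bilinear B" "smooth_on M V" "smooth_on M V'"
  shows "smooth_on M (\<lambda>q. B (V q) (V' q))"
  by (rule smooth_on_frameI)
    (rule smooth_open_bilinear[OF frame_open assms(1) frame_sm[OF _ assms(2)] frame_sm[OF _ assms(3)]])

lemmas smooth_scaleR = smooth_bilinear[OF bounded_bilinear_scaleR]
  and smooth_inner = smooth_bilinear[OF bounded_bilinear_inner]

lemma smooth_add: "smooth_on M V \<Longrightarrow> smooth_on M V' \<Longrightarrow> smooth_on M (\<lambda>q. V q + V' q)"
  by (rule smooth_on_frameI) (rule smooth_open_add[OF frame_open frame_sm frame_sm])

lemma smooth_diff: "smooth_on M V \<Longrightarrow> smooth_on M V' \<Longrightarrow> smooth_on M (\<lambda>q. V q - V' q)"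
  by (rule smooth_on_frameI) (rule smooth_open_diff[OF frame_open frame_sm frame_sm])

lemma dd_cong:
  assumes "p \<in> M" "\<And>q. q \<in> M \<Longrightarrow> V q = V' q"
  shows "dd v V p = dd v V' p"
  using differential_cong[of p M V V'] assms by (simp add: dd_def)

lemma linear_dd:
  assumes p: "p \<in> M" and V: "smooth_on M V"
  shows "linear (\<lambda>v. dd v V p)"
proof -
  obtain W and \<rho> :: "'b \<Rightarrow> 'b" and A x where fr: "frame W \<rho> A" "x \<in> W" "\<rho> x = p"
    by (rule frame_at[OF p])
  have "linear (\<lambda>v. fderiv (\<lambda>y. V (\<rho> y)) x (A x v))"
    using linear_compose[OF frame_linear_A[OF fr(1,2)] linear_fderiv[OF smooth_openD_diff[OF frame_sm[OF fr(1) V] fr(2)]]]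
    by (simp add: o_def)
  then show ?thesis using frame_dd[OF fr(1,2) V] fr(3) by simp
qed

lemma dd_P: "p \<in> M \<Longrightarrow> dd (P p v) V p = dd v V p"
  unfolding dd_def by (simp add: orth_proj_idem subspace_tang)

lemma dd_const: "p \<in> M \<Longrightarrow> dd v (\<lambda>q. c) p = 0"
  by (rule frame_at, assumption) (use frame_dd[of _ _ _ _ "\<lambda>q. c" v] in \<open>auto simp: frechet_derivative_const\<close>)

lemma dd_F:
  assumes p: "p \<in> M"
  shows "dd v F p = P p v"
proof -
  obtain W and \<rho> :: "'b \<Rightarrow> 'b" and A x where fr: "frame W \<rho> A" "x \<in> W" "\<rho> x = p"
    by (rule frame_at[OF p])
  show ?thesis using frame_dd[OF fr(1,2) smooth_F] frame_P[OF fr(1,2)] fr(3) by simp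
qed

lemma dd_bilinear:
  assumes p: "p \<in> M" and B: "bounded_bilinear B" and V: "smooth_on M V" "smooth_on M V'"
  shows "dd v (\<lambda>q. B (V q) (V' q)) p = B (V p) (dd v V' p) + B (dd v V p) (V' p)"
proof -
  obtain W and \<rho> :: "'b \<Rightarrow> 'b" and A x where fr: "frame W \<rho> A" "x \<in> W" "\<rho> x = p"
    by (rule frame_at[OF p])
  have "((\<lambda>y. B (V (\<rho> y)) (V' (\<rho> y))) has_derivative (\<lambda>\<xi>. B (V (\<rho> x)) (fderiv (\<lambda>y. V' (\<rho> y)) x \<xi>) + B (fderiv (\<lambda>y. V (\<rho> y)) x \<xi>) (V' (\<rho> x)))) (at x)"
    by (intro bounded_bilinear.FDERIV[OF B] smooth_openD_deriv[OF frame_sm[OF fr(1)] fr(2)] V)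
  from fun_cong[OF fderiv_eq[OF this]] show ?thesis
    using frame_dd[OF fr(1,2) V(1)] frame_dd[OF fr(1,2) V(2)] frame_dd[OF fr(1,2) smooth_bilinear[OF B V]] fr(3) by simp
qed

lemmas dd_scaleR = dd_bilinear[OF _ bounded_bilinear_scaleR]
  and dd_inner = dd_bilinear[OF _ bounded_bilinear_inner]

lemma dd_add:
  assumes p: "p \<in> M" and V: "smooth_on M V" "smooth_on M V'"
  shows "dd v (\<lambda>q. V q + V' q) p = dd v V p + dd v V' p"
proof -
  obtain W and \<rho> :: "'b \<Rightarrow> 'b" and A x where fr: "frame W \<rho> A" "x \<in> W" "\<rho> x = p"
    by (rule frame_at[OF p])
  have "((\<lambda>y. V (\<rho> y) + V' (\<rho> y)) has_derivative (\<lambda>\<xi>. fderiv (\<lambda>y. V (\<rho> y)) x \<xi> + fderiv (\<lambda>y. V' (\<rho> y)) x \<xi>)) (at x)"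
    by (intro has_derivative_add smooth_openD_deriv[OF frame_sm[OF fr(1)] fr(2)] V)
  from fun_cong[OF fderiv_eq[OF this]] show ?thesis
    using frame_dd[OF fr(1,2) V(1)] frame_dd[OF fr(1,2) V(2)] frame_dd[OF fr(1,2) smooth_add[OF V]] fr(3) by simp
qed

lemma dd_scale: "p \<in> M \<Longrightarrow> smooth_on M V \<Longrightarrow> dd v (\<lambda>q. c *\<^sub>R V q) p = c *\<^sub>R dd v V p"
  using dd_scaleR[of p "\<lambda>q. c" V v] by (simp add: dd_const)

lemma dd_diff:
  assumes p: "p \<in> M" and V: "smooth_on M V" "smooth_on M V'"
  shows "dd v (\<lambda>q. V q - V' q) p = dd v V p - dd v V' p"
  using dd_add[OF p V(1) smooth_scaleR[OF smooth_on_const[of _ "-1"] V(2)]] dd_scale[OF p V(2), of v "-1"] by simp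

lemma dd_sum:
  assumes p: "p \<in> M" and V: "\<And>i. i \<in> I \<Longrightarrow> smooth_on M (V i)" and I: "finite I"
  shows "smooth_on M (\<lambda>q. \<Sum>i\<in>I. V i q) \<and> dd v (\<lambda>q. \<Sum>i\<in>I. V i q) p = (\<Sum>i\<in>I. dd v (V i) p)"
  using I V by (induction I) (auto simp: dd_const[OF p] dd_add[OF p] smooth_add)

lemma dd_apply:
  assumes p: "p \<in> M" and lin: "\<And>q. q \<in> M \<Longrightarrow> linear (G q)" and G: "\<And>w. smooth_on M (\<lambda>q. G q w)"
    and w: "smooth_on M w"
  shows "dd v (\<lambda>q. G q (w q)) p = dd v (\<lambda>q. G q (w p)) p + G p (dd v w p)"
proof -
  obtain W and \<rho> :: "'b \<Rightarrow> 'b" and A x where fr: "frame W \<rho> A" "x \<in> W" "\<rho> x = p"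
    by (rule frame_at[OF p])
  have "smooth_on M (\<lambda>q. G q (w q))"
  proof (rule smooth_on_frameI)
    fix W A and \<rho> :: "'b \<Rightarrow> 'b" assume fr: "frame W \<rho> A"
    show "smooth_open W (\<lambda>x. G (\<rho> x) (w (\<rho> x)))"
      by (rule smooth_open_apply[OF frame_open[OF fr] lin[OF frame_M[OF fr]] frame_sm[OF fr G] frame_sm[OF fr w]])
  qed
  moreover have "fderiv (\<lambda>y. G (\<rho> y) (w (\<rho> y))) x (A x v) =
    fderiv (\<lambda>y. G (\<rho> y) (w (\<rho> x))) x (A x v) + G (\<rho> x) (fderiv (\<lambda>y. w (\<rho> y)) x (A x v))"
    by (rule fderiv_apply[OF frame_open[OF fr(1)] fr(2) lin[OF frame_M[OF fr(1)]]
      smooth_openD_diff[OF frame_sm[OF fr(1) G] fr(2)] smooth_openD_diff[OF frame_sm[OF fr(1) w] fr(2)]])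
  ultimately show ?thesis
    using frame_dd[OF fr(1,2) G] frame_dd[OF fr(1,2) w] frame_dd[OF fr(1,2), of "\<lambda>q. G q (w q)"] fr(3)
    by simp
qed

text \<open>In a parametrization the second derivatives cancel, and what remains is the derivative
  of \<open>V\<close> along a parameter vector \<open>Z\<close> that does not depend on
  \<open>V\<close>. Taking \<open>V = F\<close> identifies the image of \<open>Z\<close>, since
  \<open>dd a F q\<close> is \<open>P q a\<close>.\<close>

lemma dd_commutator:
  assumes p: "p \<in> M" and V: "smooth_on M V"
  shows "dd e (dd a V) p - dd a (dd e V) p = dd (dd e (\<lambda>q. P q a) p - dd a (\<lambda>q. P q e) p) V p"
proof -
  obtain W and \<rho> :: "'b \<Rightarrow> 'b" and A x where fr: "frame W \<rho> A" "x \<in> W" "\<rho> x = p"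
    by (rule frame_at[OF p])
  note W = frame_open[OF fr(1)]
  define Z where "Z = fderiv (\<lambda>y. A y a) x (A x e) - fderiv (\<lambda>y. A y e) x (A x a)"
  have Z: "dd e (dd a V) p - dd a (dd e V) p = fderiv (\<lambda>y. V (\<rho> y)) x Z" if V: "smooth_on M V"
    for V :: "'b \<Rightarrow> 'x::euclidean_space"
  proof -
    let ?f = "\<lambda>y. V (\<rho> y)"
    have smf: "smooth_open W ?f" by (rule frame_sm[OF fr(1) V])
    have *: "dd e (dd a V) p = fderiv (\<lambda>z. fderiv ?f z (A x a)) x (A x e) + fderiv ?f x (fderiv (\<lambda>y. A y a) x (A x e))" for e a
    proof -
      have "dd e (dd a V) p = fderiv (\<lambda>y. dd a V (\<rho> y)) x (A x e)"
        using frame_dd[OF fr(1,2) smooth_dd[OF V]] fr(3) by simp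
      also have "fderiv (\<lambda>y. dd a V (\<rho> y)) x = fderiv (\<lambda>y. fderiv ?f y (A y a)) x"
        using frame_dd[OF fr(1) _ V] by (intro fderiv_cong[OF W fr(2)] smooth_openD_diff[OF frame_sm[OF fr(1) smooth_dd[OF V]] fr(2)])
      also have "\<dots> (A x e) = fderiv (\<lambda>z. fderiv ?f z (A x a)) x (A x e) + fderiv ?f x (fderiv (\<lambda>y. A y a) x (A x e))"
        by (rule fderiv_apply[OF W fr(2) linear_fderiv[OF smooth_openD_diff[OF smf]] smooth_openD_diff[OF smooth_openD_fderiv[OF smf] fr(2)]
          smooth_openD_diff[OF frame_sm_A[OF fr(1)] fr(2)]])
      finally show ?thesis .
    qed
    show ?thesis unfolding *[of e a] *[of a e] fderiv_commute[OF W fr(2) smf, of "A x a" "A x e"] Z_def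
      by (simp add: linear_diff[OF linear_fderiv[OF smooth_openD_diff[OF smf fr(2)]]])
  qed
  have dF: "dd v (dd a F) p = dd v (\<lambda>q. P q a) p" for v a
    by (rule dd_cong[OF p]) (rule dd_F)
  define z where "z = dd e (\<lambda>q. P q a) p - dd a (\<lambda>q. P q e) p"
  have zZ: "fderiv (\<lambda>y. F (\<rho> y)) x Z = z" using Z[OF smooth_F] unfolding dF z_def by simp
  have par: "param M W \<rho>" using fr(1) by (simp add: frame_def)
  have "z \<in> tang M F (\<rho> x)" using zZ param_tang[OF par fr(2)] by blast
  then have "P (\<rho> x) z = fderiv (\<lambda>y. F (\<rho> y)) x Z"
    using zZ orth_proj_id subspace_tang[OF frame_M[OF fr(1,2)]] by metis
  then have "dd z V p = fderiv (\<lambda>y. V (\<rho> y)) x Z"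
    using param_dd[OF par fr(2) V, of z Z] fr(3) by simp
  then show ?thesis using Z[OF V] unfolding z_def by simp
qed

text \<open>\<open>P (\<rho> y)\<close> fixes \<open>fderiv h y \<xi>\<close>. Differentiating this
  shows the left side to be the part of a second derivative of \<open>h\<close> orthogonal to the
  tangent space, and second derivatives are symmetric.\<close>

lemma dd_P_symmetric:
  assumes p: "p \<in> M"
  shows "dd v (\<lambda>q. P q (P p w)) p = dd w (\<lambda>q. P q (P p v)) p"
proof -
  obtain W and \<rho> :: "'b \<Rightarrow> 'b" and A x where fr: "frame W \<rho> A" "x \<in> W" "\<rho> x = p"
    by (rule frame_at[OF p])
  note W = frame_open[OF fr(1)]
  define h where "h y = F (\<rho> y)" for y
  have smh: "smooth_open W h" unfolding h_def by (rule frame_sm[OF fr(1) smooth_F])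
  have par: "param M W \<rho>" using fr(1) by (simp add: frame_def)
  have *: "dd v (\<lambda>q. P q (P p w)) p = fderiv (\<lambda>y. fderiv h y (A x w)) x (A x v)
      - P p (fderiv (\<lambda>y. fderiv h y (A x w)) x (A x v))" for v w
  proof -
    have Ph: "P (\<rho> y) (fderiv h y (A x w)) = fderiv h y (A x w)" if "y \<in> W" for y
      using param_tang[OF par that] by (intro orth_proj_id subspace_tang frame_M[OF fr(1) that]) (auto simp: h_def[abs_def])
    have "fderiv (\<lambda>y. fderiv h y (A x w)) x (A x v) = fderiv (\<lambda>y. P (\<rho> y) (fderiv h y (A x w))) x (A x v)"
      using fderiv_cong[OF W fr(2) Ph[symmetric] smooth_openD_diff[OF smooth_openD_fderiv[OF smh] fr(2)]] by metis
    also have "\<dots> = fderiv (\<lambda>y. P (\<rho> y) (fderiv h x (A x w))) x (A x v) + P (\<rho> x) (fderiv (\<lambda>y. fderiv h y (A x w)) x (A x v))"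
      by (rule fderiv_apply[OF W fr(2) linear_orth_proj[OF subspace_tang[OF frame_M[OF fr(1)]]]
         smooth_openD_diff[OF frame_sm[OF fr(1) smooth_P] fr(2)] smooth_openD_diff[OF smooth_openD_fderiv[OF smh] fr(2)]])
    also have "fderiv (\<lambda>y. P (\<rho> y) (fderiv h x (A x w))) x (A x v) = dd v (\<lambda>q. P q (P p w)) p"
      using frame_dd[OF fr(1,2) smooth_P, of v] frame_P[OF fr(1,2), of w] fr(3) by (simp add: h_def[abs_def])
    finally show ?thesis unfolding fr(3) by (metis add_diff_cancel_right')
  qed
  show ?thesis unfolding *[of v w] *[of w v] fderiv_commute[OF W fr(2) smh, of "A x w" "A x v"] ..
qed

end

section \<open>The Jacobi operator on projections of constant vectors\<close>

text \<open>A tangent vector is the velocity of a curve in \<open>M\<close>, and the derivative of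
  \<open>f\<close> along this curve does not depend on which derivative within \<open>M\<close>
  computes it.\<close>

lemma differential_unique:
  assumes f: "(f has_derivative f') (at p within M)" and v: "v \<in> tangent_space M p"
  shows "differential M f p v = f' v"
proof -
  obtain \<gamma> and \<epsilon> :: real where *: "0 < \<epsilon>" "smooth_open {-\<epsilon><..<\<epsilon>} \<gamma>" "\<gamma> ` {-\<epsilon><..<\<epsilon>} \<subseteq> M" "\<gamma> 0 = p" "\<gamma> differentiable (at 0)" "fderiv \<gamma> 0 1 = v"
    by (rule tangent_spaceE[OF v]) (rule that)
  have D: "((f \<circ> \<gamma>) has_derivative D \<circ> fderiv \<gamma> 0) (at 0)" if "(f has_derivative D) (at p within M)" for D
  proof -
    have "(\<gamma> has_derivative fderiv \<gamma> 0) (at 0 within {-\<epsilon><..<\<epsilon>})"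
      using fderiv_worksI[OF *(5)] has_derivative_at_withinI by blast
    moreover have "(f has_derivative D) (at (\<gamma> 0) within \<gamma> ` {-\<epsilon><..<\<epsilon>})"
      using that * has_derivative_subset by metis
    ultimately have "((f \<circ> \<gamma>) has_derivative D \<circ> fderiv \<gamma> 0) (at 0 within {-\<epsilon><..<\<epsilon>})"
      by (rule diff_chain_within)
    moreover have "at 0 within {-\<epsilon><..<\<epsilon>} = at 0" using *(1) by (intro at_within_open) auto
    ultimately show ?thesis by simp
  qed
  have "(f has_derivative differential M f p) (at p within M)"
    using f differentiableI frechet_derivative_works by blast
  from has_derivative_unique[OF D[OF this] D[OF f]] show ?thesis
    using *(6) by (metis comp_apply)
qed

lemma subspace_orth: "subspace {v. v \<bullet> q = 0}"
  by (auto simp: subspace_def inner_add_left)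

lemma orth_proj_sphere:
  assumes "q \<in> usphere"
  shows "orth_proj (tangent_space usphere q) v = v - (v \<bullet> q) *\<^sub>R q"
  unfolding tangent_space_usphere[OF assms]
proof (rule orth_proj_unique[OF subspace_orth])
  have "q \<bullet> q = 1" using assms by (simp add: dot_square_norm)
  then show "v - (v \<bullet> q) *\<^sub>R q \<in> {v. v \<bullet> q = 0}" by (simp add: inner_diff_left)
qed (simp add: inner_commute)

lemma sphere_differential_id:
  assumes "q \<in> usphere" "v \<bullet> q = 0"
  shows "inv_into (tangent_space usphere q) (differential usphere (\<lambda>x. x) q) v = v"
proof (rule inv_into_f_eq)
  have *: "differential usphere (\<lambda>x. x) q v = v" if "v \<in> tangent_space usphere q" for v :: 'a
    using differential_unique[OF has_derivative_ident that] .
  then show "inj_on (differential usphere (\<lambda>x. x) q) (tangent_space usphere q)"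
    by (intro inj_onI) simp
  show "v \<in> tangent_space usphere q" using assms by (simp add: tangent_space_usphere)
  then show "differential usphere (\<lambda>x. x) q v = v" by (rule *)
qed

lemma sphere_field_deriv:
  assumes q: "q \<in> usphere" and V: "(V has_derivative V') (at q within usphere)" and X: "X q \<bullet> q = 0"
  shows "field_deriv usphere (\<lambda>x. x) X V q = V' (X q)"
  unfolding field_deriv_def sphere_differential_id[of q "X q", OF q X]
  by (rule differential_unique[OF V]) (use q X in \<open>simp add: tangent_space_usphere\<close>)

lemma sphere_tang: "q \<in> usphere \<Longrightarrow> tang usphere (\<lambda>x. x) q = tangent_space usphere q"
  unfolding tang_def using differential_unique[OF has_derivative_ident] by (force simp: image_def)

lemma sphere_tang_ext: "q \<in> usphere \<Longrightarrow> tang_ext usphere (\<lambda>x. x) v q = v - (v \<bullet> q) *\<^sub>R q"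
  unfolding tang_ext_def by (simp add: sphere_tang orth_proj_sphere)

lemma sphere_tang_ext_deriv:
  fixes q :: "'a::euclidean_space"
  assumes q: "q \<in> usphere"
  shows "(tang_ext usphere (\<lambda>x. x) v has_derivative (\<lambda>h. - (v \<bullet> h) *\<^sub>R q - (v \<bullet> q) *\<^sub>R h)) (at q within usphere)"
proof -
  have "((\<lambda>q. v - (v \<bullet> q) *\<^sub>R q) has_derivative (\<lambda>h. - (v \<bullet> h) *\<^sub>R q - (v \<bullet> q) *\<^sub>R h)) (at q within usphere)"
    by (auto intro!: derivative_eq_intros simp: algebra_simps)
  then show ?thesis
    by (rule has_derivative_transform[OF q, rotated]) (simp add: sphere_tang_ext)
qed

lemma sphere_sconn_tang_ext:
  fixes q :: "'a::euclidean_space"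
  assumes q: "q \<in> usphere"
  shows "sconn usphere (\<lambda>x. x) (tang_ext usphere (\<lambda>x. x) u) (tang_ext usphere (\<lambda>x. x) v) q
    = - (v \<bullet> q) *\<^sub>R (u - (u \<bullet> q) *\<^sub>R q)"
proof -
  have qq: "q \<bullet> q = 1" using q by (simp add: dot_square_norm)
  have "field_deriv usphere (\<lambda>x. x) (tang_ext usphere (\<lambda>x. x) u) (tang_ext usphere (\<lambda>x. x) v) q
    = - (v \<bullet> (u - (u \<bullet> q) *\<^sub>R q)) *\<^sub>R q - (v \<bullet> q) *\<^sub>R (u - (u \<bullet> q) *\<^sub>R q)"
    by (subst sphere_field_deriv[OF q sphere_tang_ext_deriv[OF q]])
      (simp_all add: sphere_tang_ext[OF q] inner_diff_left qq)
  then show ?thesis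
    unfolding sconn_def orth_proj_sphere[OF q] by (simp add: inner_diff_left qq)
qed

text \<open>With \<open>U\<close> and \<open>E\<close> projections of constants, the bracket is zero
  at \<open>p\<close>, and so is the derivative of \<open>?D E E\<close> along \<open>u\<close>;
  only \<open>?D E (?D U E) p = - u\<close> remains.\<close>

lemma sphere_curv_eq:
  fixes p :: "'a::euclidean_space"
  assumes p: "p \<in> usphere" and u: "u \<bullet> p = 0" and e: "e \<bullet> p = 0" "e \<bullet> e = 1" "u \<bullet> e = 0"
  shows "sphere_curv p u e e = u"
proof -
  define U E where "U = tang_ext usphere (\<lambda>x::'a. x) u" and "E = tang_ext usphere (\<lambda>x::'a. x) e"
  let ?D = "sconn usphere (\<lambda>x::'a. x)"
  have val: "U p = u" "E p = e" using p u e by (simp_all add: U_def E_def sphere_tang_ext)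
  \<comment> \<open>The formula of \<open>sphere_sconn_tang_ext\<close> has the factor
    \<open>e \<bullet> q\<close>, which vanishes at \<open>p\<close>, so only its derivative
    contributes.\<close>
  have d: "(?D X E has_derivative (\<lambda>h. - (e \<bullet> h) *\<^sub>R x)) (at p within usphere)"
    if "X = tang_ext usphere (\<lambda>x::'a. x) x" "x \<bullet> p = 0" for X x
  proof -
    have "((\<lambda>q. - (e \<bullet> q) *\<^sub>R (x - (x \<bullet> q) *\<^sub>R q)) has_derivative (\<lambda>h. - (e \<bullet> h) *\<^sub>R x)) (at p within usphere)"
      by (auto intro!: derivative_eq_intros simp: e that)
    then show ?thesis
      by (rule has_derivative_transform[OF p, rotated]) (simp add: sphere_sconn_tang_ext E_def that)
  qed
  have 1: "?D U (?D E E) p = 0"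
    unfolding sconn_def[of usphere "\<lambda>x. x" U] using sphere_field_deriv[OF p d[OF E_def e(1)], of U] val u e p
    by (simp add: orth_proj_sphere inner_commute)
  have 2: "?D E (?D U E) p = - u"
    unfolding sconn_def[of usphere "\<lambda>x. x" E] using sphere_field_deriv[OF p d[OF U_def u], of E] val u e p
    by (simp add: orth_proj_sphere)
  define br where "br q = field_deriv usphere (\<lambda>x::'a. x) U E q - field_deriv usphere (\<lambda>x. x) E U q" for q
  have br: "br p = 0"
    unfolding br_def
    using sphere_field_deriv[OF p sphere_tang_ext_deriv[OF p, of e], of U]
      sphere_field_deriv[OF p sphere_tang_ext_deriv[OF p, of u], of E] val u e
    by (simp add: U_def[symmetric] E_def[symmetric] inner_commute)
  have 3: "?D br E p = 0"
    unfolding sconn_def using sphere_field_deriv[OF p sphere_tang_ext_deriv[OF p, of e], of br] br p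
    by (simp add: E_def[symmetric] orth_proj_sphere)
  show ?thesis
    unfolding sphere_curv_def sphere_curv_field_def Let_def U_def[symmetric] E_def[symmetric] br_def[symmetric, abs_def]
    using 1 2 3 by (simp add: br_def[abs_def])
qed

section \<open>Algebra of the derivative of the tangential projection\<close>

context immersed_submanifold
begin

lemma linear_P: "p \<in> M \<Longrightarrow> linear (P p)"
  by (intro linear_orth_proj subspace_tang)

lemma P_P: "p \<in> M \<Longrightarrow> P p (P p v) = P p v"
  by (intro orth_proj_idem subspace_tang)

lemma P_in: "p \<in> M \<Longrightarrow> P p v \<in> tang M F p"
  by (intro orth_proj_in subspace_tang)

lemma P_id: "p \<in> M \<Longrightarrow> v \<in> tang M F p \<Longrightarrow> P p v = v"
  by (intro orth_proj_id subspace_tang)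

lemma P_sym: "p \<in> M \<Longrightarrow> P p v \<bullet> w = v \<bullet> P p w"
  by (intro orth_proj_sym subspace_tang)

lemma F_usphere: "p \<in> M \<Longrightarrow> F p \<in> usphere"
  by (simp add: F_sphere)

text \<open>For tangent \<open>v\<close> and \<open>u\<close> this is the second fundamental form of
  \<open>F\<close> in the Euclidean space; for \<open>u\<close> normal to \<open>M\<close> it is the
  shape operator of \<open>u\<close> applied to \<open>v\<close>.\<close>

abbreviation "dP p v u \<equiv> dd v (\<lambda>q. P q u) p"

lemma F_P:
  assumes p: "p \<in> M"
  shows "F p \<bullet> P p v = 0"
proof -
  have "dd v (\<lambda>q. F q \<bullet> F q) p = dd v (\<lambda>q. 1) p"
    by (rule dd_cong[OF p]) (rule F_F)
  then show ?thesis
    using dd_inner[OF p smooth_F smooth_F, of v] by (simp add: dd_const[OF p] dd_F[OF p] inner_commute)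
qed

lemma P_F: "p \<in> M \<Longrightarrow> P p (F p) = 0"
  using F_P P_sym by (intro orth_proj_eq_0 subspace_tang) (metis P_id)+

context
  fixes p assumes p: "p \<in> M"
begin

lemma linear_dP1: "linear (\<lambda>v. dP p v u)"
  by (rule linear_dd[OF p smooth_P])

lemma linear_dP2: "linear (dP p v)"
proof (rule linearI)
  show "dP p v (u + u') = dP p v u + dP p v u'" for u u'
  proof -
    have "dP p v (u + u') = dd v (\<lambda>q. P q u + P q u') p"
      by (rule dd_cong[OF p]) (rule linear_add[OF linear_P])
    then show ?thesis by (simp add: dd_add[OF p smooth_P smooth_P])
  qed
  show "dP p v (c *\<^sub>R u) = c *\<^sub>R dP p v u" for c u
  proof -
    have "dP p v (c *\<^sub>R u) = dd v (\<lambda>q. c *\<^sub>R P q u) p"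
      by (rule dd_cong[OF p]) (rule linear_scale[OF linear_P])
    then show ?thesis by (simp add: dd_scale[OF p smooth_P])
  qed
qed

text \<open>Differentiate \<open>P q (P q u) = P q u\<close>. Consequently \<open>dP p v\<close>
  exchanges tangential vectors and vectors orthogonal to the tangent space.\<close>

lemma dP_split: "dP p v (P p u) + P p (dP p v u) = dP p v u"
proof -
  have "dP p v u = dd v (\<lambda>q. P q (P q u)) p"
    by (rule dd_cong[OF p]) (simp add: P_P)
  also have "\<dots> = dP p v (P p u) + P p (dP p v u)"
    by (rule dd_apply[OF p linear_P smooth_P smooth_P])
  finally show ?thesis by simp
qed

lemma dP_sym: "dP p v u \<bullet> w = u \<bullet> dP p v w"
proof -
  have "dd v (\<lambda>q. P q u \<bullet> w) p = dd v (\<lambda>q. u \<bullet> P q w) p"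
    by (rule dd_cong[OF p]) (rule P_sym)
  then show ?thesis
    using dd_inner[OF p smooth_P smooth_on_const, of v u w] dd_inner[OF p smooth_on_const smooth_P, of v u w]
    by (simp add: dd_const[OF p])
qed

lemma dP_swap: "dP p v (P p w) = dP p w (P p v)"
  by (rule dd_P_symmetric[OF p])

text \<open>Differentiate \<open>P q (F q) = 0\<close>. This produces the summand with
  \<open>real m\<close> in \<open>mean_curvature_eq\<close>.\<close>

lemma dP_F: "dP p v (F p) = - P p v"
proof -
  have "dd v (\<lambda>q. P q (F q)) p = dd v (\<lambda>q. 0) p"
    by (rule dd_cong[OF p]) (rule P_F)
  then have "dP p v (F p) + P p (P p v) = 0"
    using dd_apply[OF p linear_P smooth_P smooth_F, of v] by (simp add: dd_const[OF p] dd_F[OF p])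
  then show ?thesis by (simp add: P_P[OF p] eq_neg_iff_add_eq_0)
qed

lemma P_dP_P: "P p (dP p v (P p u)) = 0"
  using dP_split[of v "P p u"] by (simp add: P_P[OF p])

lemma P_dP_normal: "P p w = 0 \<Longrightarrow> P p (dP p v w) = dP p v w"
  using dP_split[of v w] linear_0[OF linear_dP2] by simp

lemma nor_eq: "nor M F p = {v. v \<bullet> F p = 0 \<and> P p v = 0}"
proof -
  have "(\<forall>x\<in>tang M F p. v \<bullet> x = 0) \<longleftrightarrow> P p v = 0" for v
  proof
    assume "P p v = 0"
    then show "\<forall>x\<in>tang M F p. v \<bullet> x = 0" using P_sym[OF p, of v] P_id[OF p] by (metis inner_zero_left)
  next
    assume "\<forall>x\<in>tang M F p. v \<bullet> x = 0"
    then show "P p v = 0" by (intro orth_proj_eq_0 subspace_tang p) auto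
  qed
  then show ?thesis unfolding nor_def tangent_space_usphere[OF F_usphere[OF p]] by auto
qed

lemma subspace_nor: "subspace (nor M F p)"
  unfolding nor_eq subspace_def using linear_P[OF p]
  by (auto simp: inner_add_left linear_add linear_scale linear_0)

abbreviation "N \<equiv> orth_proj (nor M F p)"

lemma N_eq: "N u = u - P p u - (u \<bullet> F p) *\<^sub>R F p"
proof (rule orth_proj_unique[OF subspace_nor])
  have "P p u \<bullet> F p = 0" using F_P[OF p, of u] by (simp add: inner_commute)
  then show "u - P p u - (u \<bullet> F p) *\<^sub>R F p \<in> nor M F p"
    unfolding nor_eq using F_F[OF p] linear_P[OF p]
    by (simp add: inner_diff_left linear_diff linear_scale P_P[OF p] P_F[OF p])
  fix w assume "w \<in> nor M F p"
  then show "(u - (u - P p u - (u \<bullet> F p) *\<^sub>R F p)) \<bullet> w = 0"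
    unfolding nor_eq by (simp add: inner_add_left P_sym[OF p] inner_commute[of "F p" w])
qed

lemma linear_N: "linear N"
  by (rule linear_orth_proj[OF subspace_nor])

lemma N_F: "N (F p) = 0"
  by (simp add: N_eq P_F[OF p] F_F[OF p])

lemma N_tang: "P p v = v \<Longrightarrow> N v = 0"
  using F_P[OF p, of v] by (simp add: N_eq inner_commute)

lemma N_P: "N (P p v) = 0"
  by (rule N_tang[OF P_P[OF p]])

lemma field_deriv_dd: "X p \<in> tang M F p \<Longrightarrow> field_deriv M F X V p = dd (X p) V p"
  unfolding field_deriv_def dd_def by (simp add: P_id[OF p])

lemma nconn_eq: "X p \<in> tang M F p \<Longrightarrow> nconn M F X V p = N (dd (X p) V p)"
  unfolding nconn_def sconn_def field_deriv_dd orth_proj_sphere[OF F_usphere[OF p]]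
  by (simp add: linear_diff[OF linear_N] linear_scale[OF linear_N] N_F field_deriv_dd)

lemma P_sconn: "X p \<in> tang M F p \<Longrightarrow> P p (sconn M F X V p) = P p (dd (X p) V p)"
  unfolding sconn_def orth_proj_sphere[OF F_usphere[OF p]]
  by (simp add: linear_diff[OF linear_P[OF p]] linear_scale[OF linear_P[OF p]] P_F[OF p] field_deriv_dd)

lemma tang_ext_in: "tang_ext M F e p \<in> tang M F p"
  unfolding tang_ext_def by (rule P_in[OF p])

text \<open>For tangent \<open>e\<close> the derivative of its extension along \<open>e\<close> is
  orthogonal to the tangent space. Hence the correction term of the normal Hessian drops out at
  \<open>p\<close>.\<close>

lemma tang_ext_geodesic:
  assumes "e \<in> tang M F p"
  shows "tconn M F (tang_ext M F e) (tang_ext M F e) p = 0"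
proof -
  have e: "P p e = e" by (rule P_id[OF p assms])
  have "tconn M F (tang_ext M F e) (tang_ext M F e) p = P p (dP p e (P p e))"
    unfolding tconn_def P_sconn[of "tang_ext M F e", OF tang_ext_in] unfolding tang_ext_def[abs_def] dd_P[OF p] e ..
  then show ?thesis by (simp add: P_dP_P)
qed

abbreviation "B \<equiv> orthonormal_basis (tang M F p)"

lemma B_tang: "e \<in> B \<Longrightarrow> P p e = e" "e \<in> B \<Longrightarrow> e \<in> tang M F p"
  using orthonormal_basis_subset[OF subspace_tang[OF p]] P_id[OF p] by auto

lemma B_unit: "e \<in> B \<Longrightarrow> e \<bullet> e = 1"
  using orthonormal_basis_inner[OF subspace_tang[OF p], of e e] by simp

lemma B_card: "card B = m"
  by (simp add: orthonormal_basis_card[OF subspace_tang[OF p]] dim_tang[OF p])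

lemma B_F: "e \<in> B \<Longrightarrow> e \<bullet> F p = 0"
  using F_P[OF p, of e] by (simp add: B_tang inner_commute)

lemma sum_B:
  assumes "\<And>v. linear (\<lambda>u. C u v)" "\<And>u. linear (C u)"
  shows "(\<Sum>e\<in>B. C e e) = (\<Sum>b\<in>Basis. C (P p b) b)"
  by (rule sum_orthonormal_basis[OF subspace_tang[OF p] assms])

text \<open>The second fundamental forms in the Euclidean space and in the sphere differ by the
  component along \<open>F p\<close>, which is \<open>-1\<close> for each unit tangent
  vector.\<close>

lemma mean_curvature_eq: "mean_curvature M F p = (\<Sum>b\<in>Basis. dP p b b) + real m *\<^sub>R F p"
proof -
  have "second_fund M F (tang_ext M F e) (tang_ext M F e) p = dP p e e + F p" if e: "e \<in> B" for e
  proof -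
    have "sconn M F (tang_ext M F e) (tang_ext M F e) p = dP p e e - (dP p e e \<bullet> F p) *\<^sub>R F p"
      unfolding sconn_def orth_proj_sphere[OF F_usphere[OF p]] field_deriv_dd[of "tang_ext M F e", OF tang_ext_in]
      unfolding tang_ext_def[abs_def] dd_P[OF p] ..
    moreover have "dP p e e \<bullet> F p = - 1"
      unfolding dP_sym dP_F using B_tang(1)[OF e] B_unit[OF e] by simp
    ultimately show ?thesis
      unfolding second_fund_def tang_ext_geodesic[OF B_tang(2)[OF e]] by simp
  qed
  then have "mean_curvature M F p = (\<Sum>e\<in>B. dP p e e) + real m *\<^sub>R F p"
    unfolding mean_curvature_def by (simp add: sum.distrib B_card sum_constant_scaleR)
  also have "(\<Sum>e\<in>B. dP p e e) = (\<Sum>b\<in>Basis. dP p b b)"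
    unfolding sum_B[OF linear_dP1 linear_dP2] dd_P[OF p] ..
  finally show ?thesis .
qed

end

section \<open>Normal sections and the three terms of the Jacobi operator\<close>

lemma smooth_N: "smooth_on M (\<lambda>q. orth_proj (nor M F q) v)"
  by (rule smooth_on_cong[OF smooth_diff[OF smooth_diff[OF smooth_on_const smooth_P]
    smooth_scaleR[OF smooth_inner[OF smooth_on_const smooth_F] smooth_F]]]) (simp add: N_eq)

definition nfield :: "'a \<Rightarrow> 'b \<Rightarrow> 'a" where
  "nfield a p = (if p \<in> M then orth_proj (nor M F p) a else 0)"

lemma nfield_section: "nfield a \<in> normal_sections M F"
  unfolding normal_sections_def nfield_def
  by (auto intro!: smooth_on_cong[OF smooth_N] orth_proj_in subspace_nor)

lemma section_smooth: "V \<in> normal_sections M F \<Longrightarrow> smooth_on M V"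
  and section_nor: "V \<in> normal_sections M F \<Longrightarrow> p \<in> M \<Longrightarrow> V p \<in> nor M F p"
  by (auto simp: normal_sections_def)

lemma nfield_nor: "p \<in> M \<Longrightarrow> a \<in> nor M F p \<Longrightarrow> nfield a p = a"
  by (simp add: nfield_def orth_proj_id subspace_nor)

lemma P_section: "V \<in> normal_sections M F \<Longrightarrow> p \<in> M \<Longrightarrow> P p (V p) = 0"
  using section_nor nor_eq by blast

text \<open>Weingarten's formula, from differentiating \<open>P q (V q) = 0\<close>.\<close>

lemma P_dd_section:
  assumes p: "p \<in> M" and V: "V \<in> normal_sections M F"
  shows "P p (dd v V p) = - dP p v (V p)"
proof -
  have "dd v (\<lambda>q. P q (V q)) p = dd v (\<lambda>q. 0) p"
    by (rule dd_cong[OF p]) (rule P_section[OF V])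
  then have "dP p v (V p) + P p (dd v V p) = 0"
    using dd_apply[OF p linear_P smooth_P section_smooth[OF V], of v] by (simp add: dd_const[OF p])
  then show ?thesis by (simp add: eq_neg_iff_add_eq_0 add.commute)
qed

lemma simons_term_eqI:
  assumes p: "p \<in> M" and u: "u \<in> nor M F p"
    and eq: "\<And>W. W \<in> normal_sections M F \<Longrightarrow> u \<bullet> W p = (\<Sum>e\<in>orthonormal_basis (tang M F p).
       dP p e (V p) \<bullet> dP p e (W p))"
    and V: "V \<in> normal_sections M F"
  shows "simons_term M F V p = u"
proof -
  have term_eq: "orth_proj (tang M F p) (sconn M F (tang_ext M F e) V p) = - dP p e (V p)"
    if "V \<in> normal_sections M F" for V e
    unfolding P_sconn[OF p, of "tang_ext M F e", OF tang_ext_in[OF p]] unfolding tang_ext_def dd_P[OF p]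
    by (rule P_dd_section[OF p that])
  show ?thesis
    unfolding simons_term_def
  proof (rule the_equality)
    show "u \<in> nor M F p \<and> (\<forall>W\<in>normal_sections M F. u \<bullet> W p = (\<Sum>e\<in>orthonormal_basis (tang M F p).
       orth_proj (tang M F p) (sconn M F (tang_ext M F e) V p) \<bullet>
       orth_proj (tang M F p) (sconn M F (tang_ext M F e) W p)))"
      using u eq by (simp add: term_eq[OF V] term_eq)
    fix u' assume u': "u' \<in> nor M F p \<and> (\<forall>W\<in>normal_sections M F. u' \<bullet> W p = (\<Sum>e\<in>orthonormal_basis (tang M F p).
       orth_proj (tang M F p) (sconn M F (tang_ext M F e) V p) \<bullet>
       orth_proj (tang M F p) (sconn M F (tang_ext M F e) W p)))"
    \<comment> \<open>The section \<open>nfield ?d\<close> takes the value \<open>?d\<close> at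
      \<open>p\<close>, so testing with it gives \<open>?d \<bullet> ?d = 0\<close>.\<close>
    let ?d = "u' - u"
    have "?d \<in> nor M F p" using u u' by (simp add: subspace_diff subspace_nor[OF p])
    moreover have "u' \<bullet> nfield ?d p = u \<bullet> nfield ?d p"
      using u' eq[OF nfield_section] nfield_section[of ?d] by (simp add: term_eq[OF V] term_eq)
    ultimately have "?d \<bullet> ?d = 0" by (simp add: nfield_nor[OF p] inner_diff_left)
    then show "u' = u" by simp
  qed
qed

text \<open>By Weingarten's formula the defining sum pairs two shape operators. As
  \<open>dP p e\<close> is self-adjoint, both can be moved onto \<open>V p\<close>, and the
  projection represents the resulting form on the normal space.\<close>

lemma simons_term_eq:
  assumes p: "p \<in> M" and V: "V \<in> normal_sections M F"
  shows "simons_term M F V p = (\<Sum>e\<in>orthonormal_basis (tang M F p). orth_proj (nor M F p) (dP p e (dP p e (V p))))"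
proof (rule simons_term_eqI[OF p _ _ V])
  show "(\<Sum>e\<in>orthonormal_basis (tang M F p). orth_proj (nor M F p) (dP p e (dP p e (V p)))) \<in> nor M F p"
    by (intro subspace_sum subspace_nor orth_proj_in p)
  fix W assume "W \<in> normal_sections M F"
  then have "W p \<in> nor M F p" by (rule section_nor[OF _ p])
  then show "(\<Sum>e\<in>orthonormal_basis (tang M F p). orth_proj (nor M F p) (dP p e (dP p e (V p)))) \<bullet> W p
     = (\<Sum>e\<in>orthonormal_basis (tang M F p). dP p e (V p) \<bullet> dP p e (W p))"
    by (simp add: inner_sum_left orth_proj_inner[OF subspace_nor[OF p]] dP_sym[OF p])
qed

lemma curv_term_eq:
  assumes p: "p \<in> M" and V: "V p \<in> nor M F p"
  shows "curv_term M F V p = real m *\<^sub>R V p"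
proof -
  have "orth_proj (nor M F p) (sphere_curv (F p) (V p) e e) = V p" if e: "e \<in> orthonormal_basis (tang M F p)" for e
  proof -
    have "V p \<bullet> F p = 0" "P p (V p) = 0" using V by (auto simp: nor_eq[OF p])
    moreover have "V p \<bullet> e = 0"
      using P_sym[OF p, of "V p" e] B_tang(1)[OF p e] \<open>P p (V p) = 0\<close> by simp
    ultimately have "sphere_curv (F p) (V p) e e = V p"
      by (intro sphere_curv_eq F_usphere p B_F[OF p e] B_unit[OF p e])
    then show ?thesis by (simp add: orth_proj_id[OF subspace_nor[OF p] V])
  qed
  then show ?thesis unfolding curv_term_def by (simp add: B_card[OF p] sum_constant_scaleR)
qed

lemma normal_laplacian_eq:
  assumes p: "p \<in> M" and V: "V \<in> normal_sections M F"
  shows "normal_laplacian M F V p = (\<Sum>e\<in>orthonormal_basis (tang M F p).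
    orth_proj (nor M F p) (dd e (\<lambda>q. orth_proj (nor M F q) (dd e V q)) p))"
  unfolding normal_laplacian_def
proof (rule sum.cong[OF refl])
  fix e assume e: "e \<in> orthonormal_basis (tang M F p)"
  let ?E = "tang_ext M F e"
  have X0: "tconn M F ?E ?E p \<in> tang M F p"
    unfolding tang_ext_geodesic[OF p B_tang(2)[OF p e]] by (rule subspace_0[OF subspace_tang[OF p]])
  have "nconn M F (tconn M F ?E ?E) V p = 0"
    unfolding nconn_eq[OF p, of "tconn M F ?E ?E", OF X0] tang_ext_geodesic[OF p B_tang(2)[OF p e]]
      linear_0[OF linear_dd[OF p section_smooth[OF V]]] linear_0[OF linear_N[OF p]] ..
  moreover have "nconn M F ?E V q = orth_proj (nor M F q) (dd e V q)" if q: "q \<in> M" for q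
    unfolding nconn_eq[OF q, of ?E, OF tang_ext_in[OF q]] unfolding tang_ext_def dd_P[OF q] ..
  then have "dd e (nconn M F ?E V) p = dd e (\<lambda>q. orth_proj (nor M F q) (dd e V q)) p"
    by (rule dd_cong[OF p])
  then have "nconn M F ?E (nconn M F ?E V) p = orth_proj (nor M F p) (dd e (\<lambda>q. orth_proj (nor M F q) (dd e V q)) p)"
    unfolding nconn_eq[OF p, of ?E, OF tang_ext_in[OF p]] unfolding tang_ext_def dd_P[OF p] by simp
  ultimately show "normal_hessian M F V ?E ?E p = orth_proj (nor M F p) (dd e (\<lambda>q. orth_proj (nor M F q) (dd e V q)) p)"
    unfolding normal_hessian_def by simp
qed

text \<open>The symmetry \<open>dP_swap\<close> moves \<open>a\<close> into the direction of
  differentiation, where the differentiated trace will need it. The right side is free of the normal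
  projection, so that it can be differentiated again.\<close>

lemma N_dd_nfield:
  assumes q: "q \<in> M"
  shows "orth_proj (nor M F q) (dd v (nfield a) q) = - dP q a (P q v) - (P q v \<bullet> a) *\<^sub>R F q"
proof -
  note smooth_open = smooth_inner[OF smooth_on_const smooth_F, of a] smooth_diff[OF smooth_on_const smooth_P, of a a]
  have "dd v (nfield a) q = dd v (\<lambda>q. a - P q a - (a \<bullet> F q) *\<^sub>R F q) q"
    by (rule dd_cong[OF q]) (simp add: nfield_def N_eq)
  also have "\<dots> = - dP q v a - ((a \<bullet> F q) *\<^sub>R P q v + (a \<bullet> P q v) *\<^sub>R F q)"
    using dd_diff[OF q smooth_open(2) smooth_scaleR[OF smooth_open(1) smooth_F], of v] dd_diff[OF q smooth_on_const smooth_P, of v a a]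
      dd_scaleR[OF q smooth_open(1) smooth_F, of v] dd_inner[OF q smooth_on_const smooth_F, of v a]
    by (simp add: dd_const[OF q] dd_F[OF q])
  finally have "orth_proj (nor M F q) (dd v (nfield a) q) = - orth_proj (nor M F q) (dP q v a)"
    by (simp add: linear_diff[OF linear_N[OF q]] linear_add[OF linear_N[OF q]] linear_neg[OF linear_N[OF q]]
      linear_scale[OF linear_N[OF q]] N_F[OF q] N_P[OF q])
  also have "dP q v a = dP q v (P q a) + P q (dP q v a)" by (rule dP_split[OF q, symmetric])
  also have "dP q v (P q a) = dP q a (P q v)" by (rule dP_swap[OF q])
  also have "orth_proj (nor M F q) (dP q a (P q v) + P q (dP q v a)) = orth_proj (nor M F q) (dP q a (P q v))"
    by (simp add: linear_add[OF linear_N[OF q]] N_P[OF q])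
  also have "\<dots> = dP q a (P q v) + (P q v \<bullet> a) *\<^sub>R F q"
    by (simp add: N_eq[OF q] P_dP_P[OF q] dP_sym[OF q] dP_F[OF q] P_sym[OF q] P_P[OF q])
  finally show ?thesis by simp
qed

lemma nfield_hessian:
  assumes p: "p \<in> M" and e: "P p e = e"
  shows "orth_proj (nor M F p) (dd e (\<lambda>q. orth_proj (nor M F q) (dd e (nfield a) q)) p)
    = - orth_proj (nor M F p) (dd e (dd a (\<lambda>q. P q e)) p)"
proof -
  let ?N = "orth_proj (nor M F p)"
  note lN = linear_diff[OF linear_N[OF p]] linear_add[OF linear_N[OF p]] linear_neg[OF linear_N[OF p]]
      linear_scale[OF linear_N[OF p]]
  have smG: "smooth_on M (\<lambda>q. dP q a u)" for u by (rule smooth_dd[OF smooth_P])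
  have smPe: "smooth_on M (\<lambda>q. P q e)" by (rule smooth_P)
  have sm1: "smooth_on M (\<lambda>q. dP q a (P q e))"
  proof (rule smooth_on_cong)
    show "smooth_on M (\<lambda>q. \<Sum>b\<in>Basis. (P q e \<bullet> b) *\<^sub>R dP q a b)"
      by (rule conjunct1[OF dd_sum[OF p smooth_scaleR[OF smooth_inner[OF smooth_P smooth_on_const] smG] finite_Basis]])
    show "(\<Sum>b\<in>Basis. (P q e \<bullet> b) *\<^sub>R dP q a b) = dP q a (P q e)" if "q \<in> M" for q
      by (rule linear_expand[OF linear_dP2[OF that], symmetric])
  qed
  note sm2 = smooth_inner[OF smooth_P smooth_on_const, of e a]
  have "dd e (\<lambda>q. orth_proj (nor M F q) (dd e (nfield a) q)) p
      = dd e (\<lambda>q. (-1) *\<^sub>R dP q a (P q e) - (P q e \<bullet> a) *\<^sub>R F q) p"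
    by (rule dd_cong[OF p]) (simp add: N_dd_nfield)
  also have "\<dots> = - dd e (\<lambda>q. dP q a (P q e)) p - ((P p e \<bullet> a) *\<^sub>R P p e + (dP p e e \<bullet> a) *\<^sub>R F p)"
    using dd_diff[OF p smooth_scaleR[OF smooth_on_const[of _ "-1"] sm1] smooth_scaleR[OF sm2 smooth_F], of e]
      dd_scale[OF p sm1, of e "-1"] dd_scaleR[OF p sm2 smooth_F, of e] dd_inner[OF p smooth_P smooth_on_const, of e e a]
    by (simp add: dd_F[OF p] dd_const[OF p])
  also have "dd e (\<lambda>q. dP q a (P q e)) p = dd e (dd a (\<lambda>q. P q e)) p + dP p a (dP p e e)"
  proof -
    have "dd e (\<lambda>q. dP q a (P q e)) p = dd e (\<lambda>q. dP q a (P p e)) p + dP p a (dP p e e)"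
      by (rule dd_apply[OF p linear_dP2 smG smPe])
    then show ?thesis unfolding e .
  qed
  finally have "dd e (\<lambda>q. orth_proj (nor M F q) (dd e (nfield a) q)) p =
    - (dd e (dd a (\<lambda>q. P q e)) p + dP p a (dP p e e)) - ((P p e \<bullet> a) *\<^sub>R P p e + (dP p e e \<bullet> a) *\<^sub>R F p)" .
  \<comment> \<open>\<open>dP p e e\<close> is orthogonal to the tangent space, and
    \<open>dP\<close> sends such vectors to tangential ones.\<close>
  moreover have "?N (dP p a (dP p e e)) = 0"
  proof (rule N_tang[OF p P_dP_normal[OF p]])
    show "P p (dP p e e) = 0" using P_dP_P[OF p, of e e] e by simp
  qed
  ultimately show ?thesis
    by (simp add: lN N_F[OF p] N_P[OF p])
qed

section \<open>Minimality and the eigenvalue -m\<close>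

lemma trace_dP:
  assumes "minimal M F" "p \<in> M"
  shows "(\<Sum>b\<in>Basis. dP p b b) = (- real m) *\<^sub>R F p"
  using assms mean_curvature_eq[OF assms(2)] unfolding minimal_def by (simp add: eq_neg_iff_add_eq_0)

text \<open>Differentiating the trace of \<open>dP\<close> replaces the Codazzi equation.\<close>

lemma N_trace_second:
  assumes min: "minimal M F" and p: "p \<in> M"
  shows "(\<Sum>e\<in>orthonormal_basis (tang M F p). orth_proj (nor M F p) (dd a (dd e (\<lambda>q. P q e)) p)) = 0"
proof -
  let ?N = "orth_proj (nor M F p)" and ?B = "orthonormal_basis (tang M F p)"
  note lN = linear_N[OF p]
  have smdP: "smooth_on M (\<lambda>q. dP q u v)" for u v by (rule smooth_dd[OF smooth_P])
  have C1: "linear (\<lambda>u. dd a (dd u (\<lambda>q. P q v)) p)" for v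
  proof (rule linearI)
    fix u u' c
    have "dd a (dd (u + u') (\<lambda>q. P q v)) p = dd a (\<lambda>q. dP q u v + dP q u' v) p"
      by (rule dd_cong[OF p]) (rule linear_add[OF linear_dP1])
    then show "dd a (dd (u + u') (\<lambda>q. P q v)) p = dd a (dd u (\<lambda>q. P q v)) p + dd a (dd u' (\<lambda>q. P q v)) p"
      by (simp add: dd_add[OF p smdP smdP])
    have "dd a (dd (c *\<^sub>R u) (\<lambda>q. P q v)) p = dd a (\<lambda>q. c *\<^sub>R dP q u v) p"
      by (rule dd_cong[OF p]) (rule linear_scale[OF linear_dP1])
    then show "dd a (dd (c *\<^sub>R u) (\<lambda>q. P q v)) p = c *\<^sub>R dd a (dd u (\<lambda>q. P q v)) p"
      by (simp add: dd_scale[OF p smdP])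
  qed
  have C2: "linear (\<lambda>v. dd a (dd u (\<lambda>q. P q v)) p)" for u
  proof (rule linearI)
    fix v v' c
    have "dd a (dd u (\<lambda>q. P q (v + v'))) p = dd a (\<lambda>q. dP q u v + dP q u v') p"
      by (rule dd_cong[OF p]) (rule linear_add[OF linear_dP2])
    then show "dd a (dd u (\<lambda>q. P q (v + v'))) p = dd a (dd u (\<lambda>q. P q v)) p + dd a (dd u (\<lambda>q. P q v')) p"
      by (simp add: dd_add[OF p smdP smdP])
    have "dd a (dd u (\<lambda>q. P q (c *\<^sub>R v))) p = dd a (\<lambda>q. c *\<^sub>R dP q u v) p"
      by (rule dd_cong[OF p]) (rule linear_scale[OF linear_dP2])
    then show "dd a (dd u (\<lambda>q. P q (c *\<^sub>R v))) p = c *\<^sub>R dd a (dd u (\<lambda>q. P q v)) p"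
      by (simp add: dd_scale[OF p smdP])
  qed
  \<comment> \<open>Freezing the tangential part of \<open>b\<close> at \<open>p\<close> costs the
    derivative of the moving projection, applied to \<open>b - P p b\<close>.\<close>
  have split: "dd a (dd (P p b) (\<lambda>q. P q b)) p = dd a (dd b (\<lambda>q. P q b)) p - dP p (dP p a (b - P p b)) b" for b
  proof -
    let ?u = "b - P p b"
    have Pu: "P p ?u = 0" by (simp add: linear_diff[OF linear_P[OF p]] P_P[OF p])
    have "dd a (dd ?u (\<lambda>q. P q b)) p = dd a (\<lambda>q. dP q (P q ?u) b) p"
      by (rule dd_cong[OF p]) (simp add: dd_P)
    also have "\<dots> = dd a (dd (P p ?u) (\<lambda>q. P q b)) p + dP p (dP p a ?u) b"
      by (rule dd_apply[OF p linear_dP1 smdP smooth_P])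
    also have "dd a (dd (P p ?u) (\<lambda>q. P q b)) p = 0"
      unfolding Pu by (rule linear_0[OF C1])
    finally have "dd a (dd ?u (\<lambda>q. P q b)) p = dP p (dP p a ?u) b" by simp
    then show ?thesis by (simp add: linear_diff[OF C1] algebra_simps)
  qed
  have D1: "linear (\<lambda>u. dP p (dP p a (u - P p u)) v)" for v
    using linear_compose[OF linear_compose[OF linear_compose_sub[OF linear_ident linear_P[OF p]] linear_dP2[OF p, of a]] linear_dP1[OF p, of v]]
    by (simp add: o_def)
  \<comment> \<open>\<open>?N\<close> discards the tangential part of \<open>dP\<close>, so the last
    slot may be projected as well. The sum is then a trace over the tangent space, where
    \<open>e - P p e\<close> is zero.\<close>
  have "(\<Sum>b\<in>Basis. ?N (dP p (dP p a (b - P p b)) b)) = (\<Sum>b\<in>Basis. ?N (dP p (dP p a (b - P p b)) (P p b)))"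
  proof (rule sum.cong[OF refl])
    fix b
    let ?w = "dP p a (b - P p b)"
    have "dP p ?w b = dP p ?w (P p b) + P p (dP p ?w b)" by (rule dP_split[OF p, symmetric])
    then have "?N (dP p ?w b) = ?N (dP p ?w (P p b) + P p (dP p ?w b))" by simp
    then show "?N (dP p ?w b) = ?N (dP p ?w (P p b))" by (simp add: linear_add[OF lN] N_P[OF p])
  qed
  also have "\<dots> = ?N (\<Sum>b\<in>Basis. dP p (dP p a (b - P p b)) (P p b))"
    by (simp add: linear_sum[OF lN])
  also have "(\<Sum>b\<in>Basis. dP p (dP p a (b - P p b)) (P p b)) = (\<Sum>e\<in>?B. dP p (dP p a (e - P p e)) e)"
    by (rule sum_B[OF p, of "\<lambda>v u. dP p (dP p a (u - P p u)) v", OF linear_dP2[OF p] D1, symmetric])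
  also have "\<dots> = (\<Sum>e\<in>?B. 0)"
    by (rule sum.cong[OF refl])
      (simp add: B_tang[OF p] linear_0[OF linear_dP2[OF p]] linear_0[OF linear_dP1[OF p]])
  finally have zero: "(\<Sum>b\<in>Basis. ?N (dP p (dP p a (b - P p b)) b)) = 0"
    by (simp add: linear_0[OF lN])
  \<comment> \<open>By minimality the full trace is a multiple of \<open>F\<close>, whose derivative
    is tangential.\<close>
  have "(\<Sum>b\<in>Basis. dd a (dd b (\<lambda>q. P q b)) p) = dd a (\<lambda>q. \<Sum>b\<in>Basis. dP q b b) p"
    by (rule conjunct2[OF dd_sum[OF p smdP finite_Basis], symmetric])
  also have "\<dots> = dd a (\<lambda>q. (- real m) *\<^sub>R F q) p"
    by (rule dd_cong[OF p]) (rule trace_dP[OF min])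
  also have "\<dots> = (- real m) *\<^sub>R P p a"
    by (simp only: dd_scale[OF p smooth_F] dd_F[OF p])
  finally have tr: "?N (\<Sum>b\<in>Basis. dd a (dd b (\<lambda>q. P q b)) p) = 0"
    by (simp add: linear_neg[OF lN] linear_scale[OF lN] N_P[OF p])
  have "(\<Sum>e\<in>?B. ?N (dd a (dd e (\<lambda>q. P q e)) p)) = ?N (\<Sum>e\<in>?B. dd a (dd e (\<lambda>q. P q e)) p)"
    by (simp add: linear_sum[OF lN])
  also have "(\<Sum>e\<in>?B. dd a (dd e (\<lambda>q. P q e)) p) = (\<Sum>b\<in>Basis. dd a (dd (P p b) (\<lambda>q. P q b)) p)"
    by (rule sum_B[OF p C1 C2])
  also have "?N \<dots> = ?N (\<Sum>b\<in>Basis. dd a (dd b (\<lambda>q. P q b)) p) - (\<Sum>b\<in>Basis. ?N (dP p (dP p a (b - P p b)) b))"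
    unfolding split by (simp add: sum_subtractf linear_diff[OF lN] linear_sum[OF lN])
  finally show ?thesis using tr zero by simp
qed

text \<open>The commutator direction \<open>z\<close> is \<open>dP p e\<close> applied to
  \<open>a - P p a\<close>. It is tangential, so \<open>dP p z e = dP p e z\<close> by symmetry. The
  normal part of \<open>a\<close> yields a summand of the Simons term, its component along
  \<open>F p\<close> one of the mean curvature.\<close>

lemma N_swap:
  assumes p: "p \<in> M" and e: "P p e = e"
  shows "orth_proj (nor M F p) (dd e (dd a (\<lambda>q. P q e)) p) =
    orth_proj (nor M F p) (dd a (dd e (\<lambda>q. P q e)) p)
    + orth_proj (nor M F p) (dP p e (dP p e (orth_proj (nor M F p) a))) - (a \<bullet> F p) *\<^sub>R orth_proj (nor M F p) (dP p e e)"
proof -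
  let ?N = "orth_proj (nor M F p)"
  define z where "z = dP p e a - dP p a e"
  have sw: "dP p a e = dP p e (P p a)" using dP_swap[OF p, of a e] e by simp
  have zz: "z = dP p e (a - P p a)"
    unfolding z_def sw by (simp add: linear_diff[OF linear_dP2[OF p]])
  have "P p (a - P p a) = 0" by (simp add: linear_diff[OF linear_P[OF p]] P_P[OF p])
  then have Pz: "P p z = z" unfolding zz by (rule P_dP_normal[OF p])
  have "a - P p a = ?N a + (a \<bullet> F p) *\<^sub>R F p" by (simp add: N_eq[OF p])
  then have z: "z = dP p e (?N a) - (a \<bullet> F p) *\<^sub>R e"
    unfolding zz using e by (simp add: linear_add[OF linear_dP2[OF p]] linear_scale[OF linear_dP2[OF p]] dP_F[OF p])
  have "dd e (dd a (\<lambda>q. P q e)) p - dd a (dd e (\<lambda>q. P q e)) p = dP p z e"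
    unfolding z_def by (rule dd_commutator[OF p smooth_P])
  also have "dP p z e = dP p e z" using dP_swap[OF p, of z e] e Pz by simp
  also have "\<dots> = dP p e (dP p e (?N a)) - (a \<bullet> F p) *\<^sub>R dP p e e"
    unfolding z by (simp add: linear_diff[OF linear_dP2[OF p]] linear_scale[OF linear_dP2[OF p]])
  finally have "dd e (dd a (\<lambda>q. P q e)) p = dd a (dd e (\<lambda>q. P q e)) p + dP p e (dP p e (?N a)) - (a \<bullet> F p) *\<^sub>R dP p e e"
    by (simp add: algebra_simps)
  then show ?thesis
    by (simp add: linear_diff[OF linear_N[OF p]] linear_add[OF linear_N[OF p]] linear_scale[OF linear_N[OF p]])
qed

text \<open>Summing \<open>nfield_hessian\<close> and \<open>N_swap\<close> over an orthonormal
  basis leaves minus the Simons term, which cancels in the Jacobi operator; the curvature term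
  supplies \<open>- real m\<close>.\<close>

lemma nfield_eigen:
  assumes min: "minimal M F"
  shows "nfield a \<in> eigenspace M F (- real m)"
  unfolding eigenspace_def
proof (intro CollectI conjI ballI nfield_section)
  fix p assume p: "p \<in> M"
  let ?N = "orth_proj (nor M F p)" and ?B = "orthonormal_basis (tang M F p)"
  note lN = linear_N[OF p]
  have val: "nfield a p = ?N a" using p by (simp add: nfield_def)
  have "(\<Sum>e\<in>?B. ?N (dP p e e)) = ?N (\<Sum>e\<in>?B. dP p e e)"
    by (simp add: linear_sum[OF lN])
  also have "(\<Sum>e\<in>?B. dP p e e) = (\<Sum>b\<in>Basis. dP p (P p b) b)"
    by (rule sum_B[OF p linear_dP1[OF p] linear_dP2[OF p]])
  also have "\<dots> = (- real m) *\<^sub>R F p"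
    unfolding dd_P[OF p] by (rule trace_dP[OF min p])
  finally have H0: "(\<Sum>e\<in>?B. ?N (dP p e e)) = 0"
    by (simp add: linear_neg[OF lN] linear_scale[OF lN] N_F[OF p])
  have "normal_laplacian M F (nfield a) p = (\<Sum>e\<in>?B. - ?N (dd e (dd a (\<lambda>q. P q e)) p))"
    unfolding normal_laplacian_eq[OF p nfield_section]
    by (rule sum.cong[OF refl]) (rule nfield_hessian[OF p B_tang(1)[OF p]])
  also have "\<dots> = (\<Sum>e\<in>?B. - (?N (dd a (dd e (\<lambda>q. P q e)) p) + ?N (dP p e (dP p e (?N a))) - (a \<bullet> F p) *\<^sub>R ?N (dP p e e)))"
    by (rule sum.cong[OF refl]) (simp add: N_swap[OF p B_tang(1)[OF p]])
  also have "\<dots> = - (\<Sum>e\<in>?B. ?N (dd a (dd e (\<lambda>q. P q e)) p)) - (\<Sum>e\<in>?B. ?N (dP p e (dP p e (?N a))))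
      + (a \<bullet> F p) *\<^sub>R (\<Sum>e\<in>?B. ?N (dP p e e))"
    by (simp add: sum_negf sum.distrib sum_subtractf scaleR_sum_right)
  also have "\<dots> = - simons_term M F (nfield a) p"
    unfolding N_trace_second[OF min p] H0 simons_term_eq[OF p nfield_section] val by simp
  finally show "jacobi M F (nfield a) p = (- real m) *\<^sub>R nfield a p"
    unfolding jacobi_def using curv_term_eq[OF p, of "nfield a"] section_nor[OF nfield_section p] by simp
qed

end

section \<open>The dimension of the eigenspace\<close>

lemma sum_fun_apply: "(\<Sum>i\<in>I. f i) x = (\<Sum>i\<in>I. f i x)"
  by (induction I rule: infinite_finite_induct) (auto simp: zero_fun_def plus_fun_def)

lemma fun_independent_eval:
  fixes S :: "('x \<Rightarrow> 'y::euclidean_space) set"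
  assumes S: "finite S" and inj: "inj_on (\<lambda>V. V p) S" and ind: "independent ((\<lambda>V. V p) ` S)"
    and zero: "(\<Sum>V\<in>S. u V *\<^sub>R V p) = 0" and V: "V \<in> S"
  shows "u V = 0"
proof (rule ccontr)
  assume "u V \<noteq> 0"
  let ?g = "the_inv_into S (\<lambda>V. V p)"
  have "(\<Sum>w\<in>(\<lambda>V. V p) ` S. u (?g w) *\<^sub>R w) = (\<Sum>V\<in>S. u (?g (V p)) *\<^sub>R V p)"
    by (rule sum.reindex_cong[OF inj]) auto
  also have "\<dots> = (\<Sum>V\<in>S. u V *\<^sub>R V p)"
    by (rule sum.cong) (auto simp: the_inv_into_f_f[OF inj])
  finally have "(\<Sum>w\<in>(\<lambda>V. V p) ` S. u (?g w) *\<^sub>R w) = 0" using zero by simp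
  moreover have "V p \<in> (\<lambda>V. V p) ` S" "u (?g (V p)) \<noteq> 0"
    using V \<open>u V \<noteq> 0\<close> by (auto simp: the_inv_into_f_f[OF inj])
  ultimately have "dependent ((\<lambda>V. V p) ` S)"
    unfolding dependent_finite[OF finite_imageI[OF S]]
    by (intro exI[of _ "\<lambda>w. u (?g w)"]) blast
  then show False using ind by simp
qed

lemma fun_independentI:
  fixes S :: "('x \<Rightarrow> 'y::euclidean_space) set"
  assumes S: "finite S" and inj: "inj_on (\<lambda>V. V p) S" and ind: "independent ((\<lambda>V. V p) ` S)"
  shows "\<not> fun_space.dependent S"
proof
  assume "fun_space.dependent S"
  then obtain u V where V: "V \<in> S" "u V \<noteq> 0" and sum: "(\<Sum>V\<in>S. (\<lambda>x. u V *\<^sub>R V x)) = 0"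
    unfolding fun_space.dependent_finite[OF S] by auto
  from fun_cong[OF sum, of p] have "(\<Sum>V\<in>S. u V *\<^sub>R V p) = 0"
    by (simp add: sum_fun_apply)
  from fun_independent_eval[OF S inj ind this V(1)] V(2) show False by simp
qed

text \<open>Evaluation at \<open>p\<close>, where \<open>Z\<close> vanishes, kills every coefficient
  of a representation of \<open>Z\<close> by \<open>S\<close>.\<close>

lemma fun_independent_insert:
  fixes S :: "('x \<Rightarrow> 'y::euclidean_space) set"
  assumes S: "finite S" and inj: "inj_on (\<lambda>V. V p) S" and ind: "independent ((\<lambda>V. V p) ` S)"
    and Z: "Z p = 0" "Z \<noteq> (\<lambda>_. 0)"
  shows "Z \<notin> S" "\<not> fun_space.dependent (insert Z S)"
proof -
  have "Z \<notin> fun_space.span S"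
  proof
    assume "Z \<in> fun_space.span S"
    then obtain u where u: "Z = (\<Sum>V\<in>S. (\<lambda>x. u V *\<^sub>R V x))"
      unfolding fun_space.span_finite[OF S] by auto
    from fun_cong[OF u, of p] have "(\<Sum>V\<in>S. u V *\<^sub>R V p) = 0"
      using Z by (simp add: sum_fun_apply)
    from fun_independent_eval[OF S inj ind this] have "u V = 0" if "V \<in> S" for V
      using that by blast
    then have "Z x = 0" for x unfolding u by (simp add: sum_fun_apply)
    then show False using Z by auto
  qed
  then show "\<not> fun_space.dependent (insert Z S)"
    using fun_independentI[OF S inj ind] fun_space.independent_insertI by blast
  show "Z \<notin> S" using \<open>Z \<notin> fun_space.span S\<close> fun_space.span_base by blast
qed

lemma edim_ge: "finite B \<Longrightarrow> B \<subseteq> E \<Longrightarrow> \<not> fun_space.dependent B \<Longrightarrow> enat (card B) \<le> edim E"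
  unfolding edim_def by (auto intro: SUP_upper)

text \<open>Evaluation at \<open>p\<close> loses nothing, so it carries independent families in
  \<open>E\<close> to independent families in \<open>L\<close>.\<close>

lemma edim_le_eval:
  fixes E :: "('x \<Rightarrow> 'y::euclidean_space) set"
  assumes E: "\<And>V q. V \<in> E \<Longrightarrow> V q = (if q \<in> M then V p else 0)" and L: "\<And>V. V \<in> E \<Longrightarrow> V p \<in> L"
  shows "edim E \<le> enat (dim L)"
  unfolding edim_def
proof (rule SUP_least, clarify)
  fix B assume B: "finite B" "B \<subseteq> E" "\<not> fun_space.dependent B"
  have inj: "inj_on (\<lambda>V. V p) B"
    using B E by (intro inj_onI ext) (metis subsetD)
  have "independent ((\<lambda>V. V p) ` B)"
  proof
    assume "dependent ((\<lambda>V. V p) ` B)"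
    then obtain u V where V: "V \<in> B" "u (V p) \<noteq> 0" and "(\<Sum>w\<in>(\<lambda>V. V p) ` B. u w *\<^sub>R w) = 0"
      unfolding dependent_finite[OF finite_imageI[OF B(1)]] by auto
    then have sum: "(\<Sum>V\<in>B. u (V p) *\<^sub>R V p) = 0"
      by (simp add: sum.reindex[OF inj])
    have "(\<Sum>V\<in>B. (\<lambda>x. u (V p) *\<^sub>R V x)) = 0"
    proof
      fix q
      have "(\<Sum>V\<in>B. u (V p) *\<^sub>R V q) = (\<Sum>V\<in>B. u (V p) *\<^sub>R (if q \<in> M then V p else 0))"
      proof (rule sum.cong[OF refl])
        fix V assume "V \<in> B"
        then have "V q = (if q \<in> M then V p else 0)" by (rule E[OF subsetD[OF B(2)]])
        then show "u (V p) *\<^sub>R V q = u (V p) *\<^sub>R (if q \<in> M then V p else 0)" by (rule arg_cong)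
      qed
      then show "(\<Sum>V\<in>B. (\<lambda>x. u (V p) *\<^sub>R V x)) q = 0 q"
        using sum by (cases "q \<in> M") (simp_all add: sum_fun_apply)
    qed
    then have "fun_space.dependent B"
      unfolding fun_space.dependent_finite[OF B(1)] using V by (intro exI[of _ "\<lambda>V. u (V p)"]) auto
    then show False using B by simp
  qed
  then have "card ((\<lambda>V. V p) ` B) \<le> dim L"
    using B L by (intro independent_card_le_dim) auto
  then show "enat (card B) \<le> enat (dim L)" by (simp add: card_image[OF inj])
qed

context immersed_submanifold
begin

lemma dim_nor:
  assumes n: "DIM('a) = n + 1" and p: "p \<in> M"
  shows "dim (nor M F p) + m = n"
proof -
  let ?A = "span (insert (F p) (tang M F p))"
  have "F p \<notin> tang M F p"
    using F_P[OF p, of "F p"] P_id[OF p, of "F p"] F_F[OF p] by auto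
  moreover have "span (tang M F p) = tang M F p"
    using subspace_tang[OF p] by (rule span_eq_iff[THEN iffD2])
  ultimately have "F p \<notin> span (tang M F p)" by metis
  then have dimA: "dim ?A = m + 1" by (simp add: dim_insert dim_tang[OF p])
  have "nor M F p = {y \<in> UNIV. \<forall>x\<in>?A. orthogonal x y}"
  proof (intro equalityI subsetI CollectI conjI UNIV_I)
    fix v assume v: "v \<in> nor M F p"
    have "orthogonal v x" if "x \<in> insert (F p) (tang M F p)" for x
      using v that P_sym[OF p, of v] P_id[OF p]
      by (auto simp: nor_eq[OF p] orthogonal_def) (metis inner_zero_left)
    then show "\<forall>x\<in>?A. orthogonal x v"
      using orthogonal_to_span[of _ _ v] orthogonal_commute by blast
  next
    fix v assume "v \<in> {y \<in> UNIV. \<forall>x\<in>?A. orthogonal x y}"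
    then have "x \<bullet> v = 0" if "x \<in> insert (F p) (tang M F p)" for x
      using that by (auto intro: span_base simp: orthogonal_def)
    then have "F p \<bullet> v = 0" "\<forall>x\<in>tang M F p. x \<bullet> v = 0" by blast+
    then show "v \<in> nor M F p"
      unfolding nor_def tangent_space_usphere[OF F_usphere[OF p]]
      by (simp add: inner_commute)
  qed
  then have "dim (nor M F p) + dim ?A = dim (UNIV :: 'a set)"
    using dim_subspace_orthogonal_to_vectors[of ?A UNIV] by simp
  then show ?thesis using n dimA by simp
qed

lemma nor_basis:
  assumes p: "p \<in> M"
  obtains S C where "finite S" "S = nfield ` C" "C \<subseteq> nor M F p" "card S = dim (nor M F p)"
    "inj_on (\<lambda>V. V p) S" "independent ((\<lambda>V. V p) ` S)"
proof -
  obtain C where C: "C \<subseteq> nor M F p" "independent C" "card C = dim (nor M F p)"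
    using basis_exists[of "nor M F p"] by metis
  have fin: "finite C" using C independent_imp_finite by blast
  have val: "nfield b p = b" if "b \<in> C" for b using C that by (intro nfield_nor[OF p]) auto
  have img: "(\<lambda>V. V p) ` nfield ` C = C" using val by (force simp: image_image)
  have inj: "inj_on nfield C" using val by (intro inj_onI) metis
  have "inj_on (\<lambda>V. V p) (nfield ` C)" using val by (auto intro!: inj_onI)
  then show thesis
    using that[of "nfield ` C" C] fin C img card_image[OF inj] by simp
qed

lemma edim_eigenspace_ge:
  assumes min: "minimal M F" and ne: "M \<noteq> {}" and n: "DIM('a) = n + 1"
  shows "enat (n - m) \<le> edim (eigenspace M F (- real m))"
proof -
  obtain p where p: "p \<in> M" using ne by blast
  obtain S C where S: "finite S" "S = nfield ` C" "card S = dim (nor M F p)"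
    "inj_on (\<lambda>V. V p) S" "independent ((\<lambda>V. V p) ` S)"
    using nor_basis[OF p] by metis
  have "\<not> fun_space.dependent S" by (rule fun_independentI[OF S(1,4,5)])
  moreover have "S \<subseteq> eigenspace M F (- real m)" using nfield_eigen[OF min] S(2) by blast
  ultimately have "enat (card S) \<le> edim (eigenspace M F (- real m))"
    using edim_ge S(1) by blast
  then show ?thesis using dim_nor[OF n p] S(3) by (metis add_diff_cancel_right')
qed

lemma lambda1_le:
  assumes min: "minimal M F" and ne: "M \<noteq> {}" and n: "DIM('a) = n + 1" "m < n"
  shows "lambda1 M F \<le> ereal (- real m)"
proof -
  obtain p where p: "p \<in> M" using ne by blast
  have "dim (nor M F p) \<noteq> 0" using dim_nor[OF n(1) p] n(2) by linarith
  then have "\<not> nor M F p \<subseteq> {0}" by simp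
  then obtain a where a: "a \<in> nor M F p" "a \<noteq> 0" by auto
  then have "nfield a p \<noteq> 0" by (simp add: nfield_nor[OF p])
  then have "nfield a \<noteq> (\<lambda>_. 0)" by auto
  then have "- real m \<in> eigenvalues M F"
    unfolding eigenvalues_def using nfield_eigen[OF min] by blast
  then show ?thesis unfolding lambda1_def by (rule INF_lower)
qed

text \<open>If \<open>a\<close> is orthogonal to the normal space at one point,
  \<open>nfield a\<close> vanishes there and, were it nonzero, would be an additional independent
  eigensection. So \<open>nfield a\<close> is zero, which makes \<open>a\<close> orthogonal to every
  normal space.\<close>

lemma nor_const:
  assumes min: "minimal M F" and n: "DIM('a) = n + 1"
    and eq: "edim (eigenspace M F (- real m)) = enat (n - m)" and p: "p \<in> M" and q: "q \<in> M"
  shows "nor M F q = nor M F p"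
proof -
  have zero: "nfield a = (\<lambda>_. 0)" if p: "p \<in> M" and a: "\<And>w. w \<in> nor M F p \<Longrightarrow> a \<bullet> w = 0" for a p
  proof (rule ccontr)
    assume Z: "nfield a \<noteq> (\<lambda>_. 0)"
    obtain S C where S: "finite S" "S = nfield ` C" "card S = dim (nor M F p)"
      "inj_on (\<lambda>V. V p) S" "independent ((\<lambda>V. V p) ` S)"
      using nor_basis[OF p] by metis
    have "nfield a p = 0"
      using p a by (simp add: nfield_def orth_proj_eq_0 subspace_nor)
    note ins = fun_independent_insert[OF S(1,4,5) this Z]
    have "insert (nfield a) S \<subseteq> eigenspace M F (- real m)" using nfield_eigen[OF min] S(2) by blast
    then have "enat (card (insert (nfield a) S)) \<le> enat (n - m)"
      unfolding eq[symmetric] by (intro edim_ge ins(2)) (simp add: S(1))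
    then show False using ins(1) S(1,3) dim_nor[OF n p] by simp
  qed
  have "nor M F q \<subseteq> nor M F p" if p: "p \<in> M" and q: "q \<in> M" for p q
  proof
    fix w assume w: "w \<in> nor M F q"
    define r where "r = w - orth_proj (nor M F p) w"
    have r: "r \<bullet> x = 0" if "x \<in> nor M F p" for x
      unfolding r_def by (rule orth_proj_orth[OF subspace_nor[OF p] that])
    then have "nfield r q = 0" using zero[OF p] by metis
    then have "orth_proj (nor M F q) r = 0" using q by (simp add: nfield_def)
    then have "r \<bullet> w = 0" using orth_proj_inner[OF subspace_nor[OF q] w, of r] by simp
    moreover have "r \<bullet> orth_proj (nor M F p) w = 0" by (intro r orth_proj_in subspace_nor p)
    ultimately have "r \<bullet> r = 0" by (simp add: r_def inner_diff_right)
    then have "w = orth_proj (nor M F p) w" by (simp add: r_def)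
    then show "w \<in> nor M F p" using orth_proj_in[OF subspace_nor[OF p]] by metis
  qed
  then show ?thesis using p q by blast
qed

end

section \<open>Harmonic functions that are homogeneous of degree zero\<close>

text \<open>Translation invariance gives the difference quotients of \<open>f\<close> the integral
  zero, and they converge to the derivative, dominated by a constant on a ball.\<close>

lemma integral_fderiv_zero:
  fixes f :: "'s::euclidean_space \<Rightarrow> real"
  assumes f: "Ck_on 1 UNIV f" and supp: "\<And>x. R \<le> norm x \<Longrightarrow> f x = 0"
  shows "integrable lborel (\<lambda>x. fderiv f x b)" "integral\<^sup>L lborel (\<lambda>x. fderiv f x b) = 0"
proof -
  have dif: "f differentiable (at x)" and cont': "continuous_on UNIV (\<lambda>x. fderiv f x b)" for x
    using f by (auto simp: One_nat_def)
  have cont: "continuous_on UNIV f"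
    using Ck_on_SucD[of 0 UNIV f] f by simp
  have der: "((\<lambda>t. f (x + t *\<^sub>R b)) has_real_derivative fderiv f (x + t *\<^sub>R b) b) (at t)" for x t
  proof -
    have "((\<lambda>s. x + s *\<^sub>R b) has_derivative (\<lambda>h. h *\<^sub>R b)) (at t)"
      by (auto intro!: derivative_eq_intros)
    from has_derivative_compose[OF this fderiv_worksI[OF dif]]
    show ?thesis
      using linear_scale[OF linear_fderiv[OF dif]]
      by (simp add: has_field_derivative_def mult_commute_abs)
  qed
  have supp': "fderiv f x b = 0" if "R < norm x" for x
  proof -
    have "fderiv f x = fderiv (\<lambda>x. 0) x"
    proof (rule fderiv_cong[of "norm -` {R<..}"])
      show "open (norm -` {R<..} :: 's set)"
        by (intro open_vimage continuous_on_norm continuous_on_id) auto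
    qed (use that supp dif in auto)
    then show ?thesis by (simp add: frechet_derivative_const)
  qed
  have int: "integrable lborel g" if "continuous_on UNIV g" "\<And>x. r < norm x \<Longrightarrow> g x = 0" for g :: "'s \<Rightarrow> real" and r
  proof -
    have "integrable lborel (\<lambda>x. indicator (cball 0 r) x *\<^sub>R g x)"
      using that(1) by (intro borel_integrable_compact compact_cball) (auto intro: continuous_on_subset)
    moreover have "(\<lambda>x. indicator (cball 0 r) x *\<^sub>R g x) = g"
      using that(2) by (auto simp: fun_eq_iff indicator_def)
    ultimately show ?thesis by simp
  qed
  show intD: "integrable lborel (\<lambda>x. fderiv f x b)" by (rule int[OF cont' supp'])
  have intf: "integrable lborel f" by (rule int[OF cont, of R]) (use supp in auto)
  have "compact (cball (0::'s) R)" by simp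
  then have "bounded ((\<lambda>x. fderiv f x b) ` cball 0 R)"
    using cont' by (intro compact_imp_bounded compact_continuous_image) (auto intro: continuous_on_subset)
  then obtain K0 where "\<forall>y\<in>(\<lambda>x. fderiv f x b) ` cball 0 R. norm y \<le> K0"
    unfolding bounded_iff by blast
  then have K0: "norm (fderiv f x b) \<le> K0" if "norm x \<le> R" for x using that by auto
  define K where "K = max K0 0"
  have K: "\<bar>fderiv f x b\<bar> \<le> K" for x
    using K0[of x] supp'[of x] unfolding K_def by (cases "norm x \<le> R") auto
  define s where "s k x = (f (x + (1 / real (Suc k)) *\<^sub>R b) - f x) / (1 / real (Suc k))" for k x
  have trans: "integrable lborel (\<lambda>x. f (x + c))" "integral\<^sup>L lborel (\<lambda>x. f (x + c)) = integral\<^sup>L lborel f" for c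
  proof -
    have "integrable (distr lborel borel ((+) c)) f" using intf by (simp add: lborel_distr_plus)
    then show "integrable lborel (\<lambda>x. f (x + c))"
      using intf by (subst (asm) integrable_distr_eq) (auto simp: add.commute)
    have "integral\<^sup>L lborel f = integral\<^sup>L (distr lborel borel ((+) c)) f" by (simp add: lborel_distr_plus)
    also have "\<dots> = integral\<^sup>L lborel (\<lambda>x. f (x + c))"
      using intf by (subst integral_distr) (auto simp: add.commute)
    finally show "integral\<^sup>L lborel (\<lambda>x. f (x + c)) = integral\<^sup>L lborel f" ..
  qed
  have ints: "integrable lborel (s k)" "integral\<^sup>L lborel (s k) = 0" for k
    unfolding s_def using trans intf by simp_all
  \<comment> \<open>The quotient at \<open>x\<close> also sees \<open>f\<close> at distance up to
    \<open>norm b\<close> from \<open>x\<close>, which enlarges the ball by that amount.\<close>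
  define w where "w x = K * indicator (cball (0::'s) (R + norm b)) x" for x
  have intw: "integrable lborel w"
    unfolding w_def using emeasure_bounded_finite[of "cball (0::'s) (R + norm b)"]
    by (intro integrable_mult_right integrable_real_indicator) auto
  have "(\<lambda>k. integral\<^sup>L lborel (s k)) \<longlonglongrightarrow> integral\<^sup>L lborel (\<lambda>x. fderiv f x b)"
  proof (rule integral_dominated_convergence[OF _ _ intw])
    show "(\<lambda>x. fderiv f x b) \<in> borel_measurable lborel" using intD by auto
    show "s k \<in> borel_measurable lborel" for k using ints(1) by auto
    show "AE x in lborel. (\<lambda>k. s k x) \<longlonglongrightarrow> fderiv f x b"
    proof (intro AE_I2)
      fix x
      have "((\<lambda>t. (f (x + t *\<^sub>R b) - f (x + 0 *\<^sub>R b)) / (t - 0)) \<longlongrightarrow> fderiv f (x + 0 *\<^sub>R b) b) (at 0)"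
        using der[of x 0] unfolding has_field_derivative_iff .
      moreover have "filterlim (\<lambda>k. 1 / real (Suc k)) (at 0) sequentially"
        unfolding filterlim_at using LIMSEQ_inverse_real_of_nat by (auto simp: inverse_eq_divide)
      ultimately show "(\<lambda>k. s k x) \<longlonglongrightarrow> fderiv f x b"
        unfolding s_def by (auto dest: filterlim_compose)
    qed
    show "AE x in lborel. norm (s k x) \<le> w x" for k
    proof (intro AE_I2)
      fix x
      let ?t = "1 / real (Suc k)"
      have t: "0 < ?t" "?t \<le> 1" by auto
      show "norm (s k x) \<le> w x"
      proof (cases "norm x \<le> R + norm b")
        case True
        have "\<exists>z>0. z < ?t \<and> f (x + ?t *\<^sub>R b) - f (x + 0 *\<^sub>R b) = (?t - 0) * fderiv f (x + z *\<^sub>R b) b"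
          by (rule MVT2[OF t(1)]) (rule der)
        then obtain z where "f (x + ?t *\<^sub>R b) - f x = ?t * fderiv f (x + z *\<^sub>R b) b" by auto
        then have "s k x = fderiv f (x + z *\<^sub>R b) b" unfolding s_def by simp
        then show ?thesis using K True by (simp add: w_def)
      next
        case False
        have "norm (?t *\<^sub>R b) \<le> norm b" using mult_right_mono[OF t(2) norm_ge_zero[of b]] by simp
        moreover have "norm x \<le> norm (x + ?t *\<^sub>R b) + norm (?t *\<^sub>R b)"
          using norm_triangle_ineq4[of "x + ?t *\<^sub>R b" "?t *\<^sub>R b"] by simp
        ultimately have "R \<le> norm (x + ?t *\<^sub>R b)" "R \<le> norm x"
          using False norm_ge_zero[of b] by linarith+
        then show ?thesis using False by (simp add: s_def w_def supp)
      qed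
    qed
  qed
  then have "(\<lambda>k. 0) \<longlonglongrightarrow> integral\<^sup>L lborel (\<lambda>x. fderiv f x b)" using ints by simp
  then show "integral\<^sup>L lborel (\<lambda>x. fderiv f x b) = 0" by (simp add: LIMSEQ_const_iff)
qed

text \<open>The set where \<open>f\<close> is nonzero is open and negligible.\<close>

lemma integral_zero_imp_zero:
  fixes f :: "'s::euclidean_space \<Rightarrow> real"
  assumes "continuous_on UNIV f" "integrable lborel f" "integral\<^sup>L lborel f = 0" "\<And>x. 0 \<le> f x"
  shows "f x = 0"
proof (rule ccontr)
  assume "f x \<noteq> 0"
  have "AE x in lborel. f x = 0"
    using assms integral_nonneg_eq_0_iff_AE[of lborel f] by auto
  then obtain N where N: "{x \<in> space lborel. f x \<noteq> 0} \<subseteq> N" "emeasure lborel N = 0" "N \<in> sets lborel"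
    by (rule AE_E)
  then have "N \<in> null_sets lborel" by auto
  then have "negligible N" by (simp add: negligible_iff_null_sets null_sets_completionI)
  then have "negligible {x. f x \<noteq> 0}" by (rule negligible_subset) (use N(1) in simp)
  moreover have "open {x. f x \<noteq> 0}"
    using assms(1) by (intro open_Collect_neq continuous_on_const)
  ultimately show False using open_not_negligible \<open>f x \<noteq> 0\<close> by blast
qed

text \<open>The profile of the cut-off. Squaring the positive part is the simplest way to class C^1,
  all that one integration by parts requires.\<close>

lemma Ck_on_pos_square: "Ck_on 1 UNIV (\<lambda>t::real. (max 0 t)\<^sup>2)"
proof -
  have d: "((\<lambda>t. (max 0 t)\<^sup>2) has_real_derivative 2 * max 0 t) (at t)" for t :: real
  proof -
    consider "t > 0" | "t < 0" | "t = 0" by linarith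
    then show ?thesis
    proof cases
      case 1
      have "((\<lambda>t. t\<^sup>2) has_real_derivative 2 * t) (at t)" by (auto intro!: derivative_eq_intros)
      then have "((\<lambda>t. (max 0 t)\<^sup>2) has_real_derivative 2 * t) (at t)"
        by (rule has_field_derivative_transform_within_open[of _ _ _ "{0<..}"]) (use 1 in auto)
      then show ?thesis using 1 by simp
    next
      case 2
      have "((\<lambda>t. 0) has_real_derivative 0) (at t)" by simp
      then have "((\<lambda>t. (max 0 t)\<^sup>2) has_real_derivative 0) (at t)"
        by (rule has_field_derivative_transform_within_open[of _ _ _ "{..<0}"]) (use 2 in auto)
      then show ?thesis using 2 by simp
    next
      case 3
      have "\<forall>\<^sub>F y in at 0. norm (((max 0 y)\<^sup>2 - (max 0 0)\<^sup>2) / (y - 0)) \<le> \<bar>y\<bar>" for y :: real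
        unfolding eventually_at_filter
        by (intro always_eventually) (auto simp: max_def power2_eq_square)
      then have "((\<lambda>y::real. ((max 0 y)\<^sup>2 - (max 0 0)\<^sup>2) / (y - 0)) \<longlongrightarrow> 0) (at 0)"
        by (rule Lim_null_comparison[OF _ tendsto_rabs_zero[OF tendsto_ident_at]])
      then show ?thesis using 3 by (simp add: has_field_derivative_iff)
    qed
  qed
  then have d': "((\<lambda>t. (max 0 t)\<^sup>2) has_derivative (\<lambda>h. (2 * max 0 t) * h)) (at t)" for t :: real
    by (simp add: has_field_derivative_def)
  show ?thesis
    unfolding One_nat_def Ck_on.simps fderiv_eq[OF d']
    by (intro conjI allI ballI continuous_intros) (use d' differentiable_def in blast)
qed

text \<open>The vector field with components \<open>X b\<close> has compact support away from 0, and
  its divergence is \<open>\<eta>\<close> times the squared norm of the derivative of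
  \<open>W\<close>. The integral of the divergence is zero, while \<open>\<eta>\<close> is positive
  at \<open>x0\<close>.\<close>

lemma harmonic_homogeneous_constant:
  fixes W :: "'s::euclidean_space \<Rightarrow> 'd::euclidean_space"
  assumes W: "smooth_open (-{0}) W" and euler: "\<And>x. x \<noteq> 0 \<Longrightarrow> fderiv W x x = 0"
    and harm: "\<And>x. x \<noteq> 0 \<Longrightarrow> (\<Sum>b\<in>Basis. fderiv (\<lambda>y. fderiv W y b) x b) = 0"
    and x0: "x0 \<noteq> 0"
  shows "fderiv W x0 v = 0"
proof -
  define s where "s = (norm x0)\<^sup>2"
  have s: "s > 0" using x0 by (simp add: s_def)
  \<comment> \<open>Nonzero only for \<open>s/2 < x \<bullet> x < 2 * s\<close>, an annulus that
    contains \<open>x0\<close> and avoids the singularity of \<open>W\<close>.\<close>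
  define \<eta> where "\<eta> x = (max 0 ((x \<bullet> x - s/2) * (2 * s - x \<bullet> x)))\<^sup>2" for x :: 's
  have op: "open (-{0::'s})" by (simp add: open_Compl)
  have C\<eta>: "Ck_on 1 UNIV \<eta>"
    unfolding \<eta>_def
  proof (rule Ck_on_compose[OF open_UNIV open_UNIV subset_UNIV _ Ck_on_pos_square])
    have "smooth_open UNIV (\<lambda>x::'s. (x \<bullet> x - s/2) * (2 * s - x \<bullet> x))"
      by (intro smooth_open_mult smooth_open_diff smooth_open_inner smooth_open_ident smooth_open_const open_UNIV)
    then show "Ck_on 1 UNIV (\<lambda>x::'s. (x \<bullet> x - s/2) * (2 * s - x \<bullet> x))" by (simp add: smooth_open_def)
  qed
  have \<eta>0: "\<eta> x = 0" if "x \<bullet> x \<le> s/2 \<or> 2 * s \<le> x \<bullet> x" for x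
  proof -
    have "(x \<bullet> x - s/2) * (2 * s - x \<bullet> x) \<le> 0"
      using that s by (auto simp: mult_le_0_iff)
    then show ?thesis by (simp add: \<eta>_def)
  qed
  have \<eta>d: "\<eta> differentiable (at x)" for x using C\<eta> by (auto simp: One_nat_def)
  have \<eta>rad: "\<exists>c. \<forall>h. fderiv \<eta> x h = c * (x \<bullet> h)" for x
  proof -
    let ?\<phi> = "\<lambda>t::real. (max 0 ((t - s/2) * (2 * s - t)))\<^sup>2"
    have "Ck_on 1 UNIV ?\<phi>"
    proof (rule Ck_on_compose[OF open_UNIV open_UNIV subset_UNIV _ Ck_on_pos_square])
      have "smooth_open UNIV (\<lambda>t::real. (t - s/2) * (2 * s - t))"
        by (intro smooth_open_mult smooth_open_diff smooth_open_ident smooth_open_const open_UNIV)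
      then show "Ck_on 1 UNIV (\<lambda>t::real. (t - s/2) * (2 * s - t))" by (simp add: smooth_open_def)
    qed
    then have \<phi>: "?\<phi> differentiable (at t)" for t by (auto simp: One_nat_def)
    have d: "((\<lambda>x::'s. x \<bullet> x) has_derivative (\<lambda>h. 2 * (x \<bullet> h))) (at x)"
      by (auto intro!: derivative_eq_intros simp: inner_commute)
    have f1: "fderiv (\<lambda>x. ?\<phi> (x \<bullet> x)) x h = fderiv ?\<phi> (x \<bullet> x) (2 * (x \<bullet> h))" for h
      using fderiv_compose[of "\<lambda>x::'s. x \<bullet> x" x ?\<phi> h] d \<phi> by (auto simp: fderiv_eq[OF d] differentiable_def)
    have f2: "fderiv ?\<phi> (x \<bullet> x) (2 * (x \<bullet> h)) = (2 * fderiv ?\<phi> (x \<bullet> x) 1) * (x \<bullet> h)" for h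
      using linear_scale[OF linear_fderiv[OF \<phi>], of "x \<bullet> x" "2 * (x \<bullet> h)" 1] by simp
    have f3: "\<eta> = (\<lambda>x. ?\<phi> (x \<bullet> x))" by (simp add: \<eta>_def fun_eq_iff)
    show ?thesis
      unfolding f3 f1 f2 by (rule exI[of _ "2 * fderiv ?\<phi> (x \<bullet> x) 1"]) simp
  qed
  define X where "X b x = \<eta> x * (W x \<bullet> fderiv W x b)" for b x
  have smWb: "smooth_open (-{0}) (\<lambda>x. W x \<bullet> fderiv W x b)" for b
    by (intro smooth_open_inner smooth_openD_fderiv W op)
  have X0: "X b x = 0" if "x \<in> ball 0 (sqrt (s/2))" for b x
  proof -
    have "(norm x)\<^sup>2 \<le> (sqrt (s/2))\<^sup>2" using that by (intro power_mono) auto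
    then have "x \<bullet> x \<le> s/2" using s by (simp add: power2_norm_eq_inner)
    then show ?thesis by (simp add: X_def \<eta>0)
  qed
  have CX: "Ck_on 1 UNIV (X b)" for b
  proof (rule Ck_on_local)
    fix x :: 's
    show "\<exists>V. open V \<and> x \<in> V \<and> Ck_on 1 (UNIV \<inter> V) (X b)"
    proof (cases "x = 0")
      case True
      have "Ck_on 1 (ball 0 (sqrt (s/2))) (X b)"
        by (rule Ck_on_cong[OF open_ball _ Ck_on_const[of _ _ 0]]) (simp add: X0)
      then show ?thesis using True s by (intro exI[of _ "ball 0 (sqrt (s/2))"]) auto
    next
      case False
      have "Ck_on 1 (-{0}) (X b)"
        unfolding X_def using smWb
        by (intro Ck_on_bilinear[OF op bounded_bilinear_mult] Ck_on_subset[OF C\<eta>]) (auto simp: smooth_open_def)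
      then show ?thesis using False by (intro exI[of _ "-{0}"]) auto
    qed
  qed
  have suppX: "X b x = 0" if "sqrt (2 * s) \<le> norm x" for b x
  proof -
    have "(sqrt (2 * s))\<^sup>2 \<le> (norm x)\<^sup>2" using that s by (intro power_mono) auto
    then have "2 * s \<le> x \<bullet> x" using s by (simp add: power2_norm_eq_inner)
    then show ?thesis by (simp add: X_def \<eta>0)
  qed
  have dX: "fderiv (X b) x b = fderiv \<eta> x b * (W x \<bullet> fderiv W x b)
      + \<eta> x * (W x \<bullet> fderiv (\<lambda>y. fderiv W y b) x b) + \<eta> x * (fderiv W x b \<bullet> fderiv W x b)" if "x \<noteq> 0" for b x
  proof -
    have x: "x \<in> -{0}" using that by simp
    have "(X b has_derivative (\<lambda>h. \<eta> x * (W x \<bullet> fderiv (\<lambda>y. fderiv W y b) x h + fderiv W x h \<bullet> fderiv W x b)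
       + fderiv \<eta> x h * (W x \<bullet> fderiv W x b))) (at x)"
      unfolding X_def
      by (intro has_derivative_mult has_derivative_inner fderiv_worksI[OF \<eta>d] smooth_openD_deriv[OF W x]
        smooth_openD_deriv[OF smooth_openD_fderiv[OF W] x])
    from fun_cong[OF fderiv_eq[OF this], of b] show ?thesis by (simp add: algebra_simps)
  qed
  \<comment> \<open>In the product rule, the term with the radial gradient of \<open>\<eta>\<close>
    is zero by \<open>euler\<close>, the one with second derivatives of \<open>W\<close> by
    \<open>harm\<close>.\<close>
  have div: "(\<Sum>b\<in>Basis. fderiv (X b) x b) = \<eta> x * (\<Sum>b\<in>Basis. fderiv W x b \<bullet> fderiv W x b)" for x
  proof (cases "x = 0")
    case True
    have "fderiv (X b) x = fderiv (\<lambda>x. 0) x" for b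
    proof (rule fderiv_cong[of "ball 0 (sqrt (s/2))"])
      show "X b differentiable (at x)" using CX by (auto simp: One_nat_def)
    qed (use True s X0 in auto)
    then show ?thesis using True s by (simp add: frechet_derivative_const \<eta>0)
  next
    case False
    obtain c where c: "\<And>h. fderiv \<eta> x h = c * (x \<bullet> h)" using \<eta>rad by blast
    have "(\<Sum>b\<in>Basis. fderiv (X b) x b) = c * (W x \<bullet> (\<Sum>b\<in>Basis. (x \<bullet> b) *\<^sub>R fderiv W x b))
      + \<eta> x * (W x \<bullet> (\<Sum>b\<in>Basis. fderiv (\<lambda>y. fderiv W y b) x b)) + \<eta> x * (\<Sum>b\<in>Basis. fderiv W x b \<bullet> fderiv W x b)"
      unfolding dX[OF False] c by (simp add: sum.distrib sum_distrib_left inner_sum_right mult.assoc)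
    also have "(\<Sum>b\<in>Basis. (x \<bullet> b) *\<^sub>R fderiv W x b) = fderiv W x x"
      by (rule linear_expand[OF linear_fderiv[OF smooth_openD_diff[OF W]], symmetric]) (use False in simp)
    finally show ?thesis using euler[OF False] harm[OF False] by simp
  qed
  define f where "f x = (\<Sum>b\<in>Basis. fderiv (X b) x b)" for x
  have f: "f x = \<eta> x * (\<Sum>b\<in>Basis. fderiv W x b \<bullet> fderiv W x b)" for x
    unfolding f_def by (rule div)
  have "f x0 = 0"
  proof (rule integral_zero_imp_zero[of f])
    show "continuous_on UNIV f"
      unfolding f_def using CX by (intro continuous_on_sum) (auto simp: One_nat_def)
    show "integrable lborel f"
      unfolding f_def by (intro Bochner_Integration.integrable_sum integral_fderiv_zero(1)[OF CX suppX])
    show "integral\<^sup>L lborel f = 0"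
      unfolding f_def using integral_fderiv_zero[OF CX suppX] by (subst Bochner_Integration.integral_sum) auto
    show "0 \<le> f x" for x
      unfolding f by (intro mult_nonneg_nonneg sum_nonneg inner_ge_zero) (simp add: \<eta>_def)
  qed
  moreover have "\<eta> x0 > 0"
    using s by (simp add: \<eta>_def s_def power2_norm_eq_inner)
  ultimately have "(\<Sum>b\<in>Basis. fderiv W x0 b \<bullet> fderiv W x0 b) = 0" by (simp add: f)
  then have "fderiv W x0 b = 0" if "b \<in> Basis" for b
    using that by (subst (asm) sum_nonneg_eq_0_iff) auto
  then show ?thesis
    using linear_expand[OF linear_fderiv[OF smooth_openD_diff[OF W]], of x0 v] x0 by simp
qed

section \<open>Minimal immersions of round spheres\<close>

lemma connected_punctured:
  assumes "2 \<le> DIM('s::euclidean_space)"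
  shows "connected (-{0::'s})"
  using connected_punctured_universe[OF assms, of 0] by simp

locale sphere_isometric = immersed_submanifold m M F
  for m :: nat and M :: "'b::euclidean_space set" and F :: "'b \<Rightarrow> 'a::euclidean_space" +
  fixes f :: "'b \<Rightarrow> 's::euclidean_space" and g :: "'s \<Rightarrow> 'b"
  assumes hom: "homeomorphism M usphere f g" and smf: "smooth_on M f" and smg: "smooth_on usphere g"
    and iso: "\<And>p x y. p \<in> M \<Longrightarrow> x \<in> tangent_space M p \<Longrightarrow> y \<in> tangent_space M p \<Longrightarrow>
        differential M f p x \<bullet> differential M f p y = differential M F p x \<bullet> differential M F p y"
    and dim_s: "DIM('s) = m + 1" and m1: "1 \<le> m" and min: "minimal M F"
begin

abbreviation nz :: "'s set" where "nz \<equiv> -{0}"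
abbreviation unit :: "'s \<Rightarrow> 's" where "unit x \<equiv> x /\<^sub>R norm x"

definition \<rho> :: "'s \<Rightarrow> 'b" where "\<rho> x = g (unit x)"
definition h :: "'s \<Rightarrow> 'a" where "h x = F (\<rho> x)"

definition U :: "'s \<Rightarrow> 'a" where "U x = norm x *\<^sub>R h x"
text \<open>The adjoint of \<open>fderiv U x\<close>, and also a left inverse of it once
  \<open>U\<close> is known to be isometric (\<open>T_U\<close>).\<close>

definition T :: "'s \<Rightarrow> 'a \<Rightarrow> 's" where "T x w = (\<Sum>c\<in>Basis. (w \<bullet> fderiv U x c) *\<^sub>R c)"

lemma open_nz: "open nz" by (simp add: open_Compl)

lemma unit_sphere: "x \<in> nz \<Longrightarrow> unit x \<in> usphere" by simp

lemma smooth_open_\<rho>: "smooth_open nz \<rho>"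
proof -
  have "smooth_on nz unit" using smooth_open_normalize by (simp add: smooth_on_open_iff open_nz)
  moreover have "unit ` nz \<subseteq> usphere" using unit_sphere by blast
  ultimately have "smooth_on nz (\<lambda>x. g (unit x))" by (rule smooth_on_compose[OF _ smg])
  then show ?thesis by (simp add: smooth_on_open_iff open_nz \<rho>_def[abs_def])
qed

lemma \<rho>_M: "x \<in> nz \<Longrightarrow> \<rho> x \<in> M"
  unfolding \<rho>_def using homeomorphism_image2[OF hom] unit_sphere by blast

lemma f_\<rho>: "x \<in> nz \<Longrightarrow> f (\<rho> x) = unit x"
  unfolding \<rho>_def by (rule homeomorphism_apply2[OF hom unit_sphere])

lemma \<rho>_f:
  assumes "q \<in> M" "c > 0"
  shows "\<rho> (c *\<^sub>R f q) = q" "c *\<^sub>R f q \<in> nz"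
proof -
  have "f q \<in> usphere" using homeomorphism_image1[OF hom] assms by blast
  then have n: "norm (f q) = 1" by simp
  then show "c *\<^sub>R f q \<in> nz" using assms by auto
  show "\<rho> (c *\<^sub>R f q) = q"
    using n assms homeomorphism_apply1[OF hom assms(1)] by (simp add: \<rho>_def)
qed

lemma \<rho>_param: "param M nz \<rho>"
  unfolding param_def
proof (intro conjI open_nz smooth_open_\<rho> ballI)
  show "\<rho> ` nz \<subseteq> M" using \<rho>_M by blast
  fix x assume x: "x \<in> nz"
  then have nx: "norm x > 0" by simp
  show "tangent_space M (\<rho> x) = range (fderiv \<rho> x)"
  proof (intro equalityI subsetI)
    fix v assume v: "v \<in> tangent_space M (\<rho> x)"
    \<comment> \<open>Scaling by \<open>norm x\<close> makes the right inverse of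
      \<open>\<rho>\<close> pass through \<open>x\<close> instead of \<open>unit x\<close>.\<close>
    have smooth_open: "smooth_on M (\<lambda>q. norm x *\<^sub>R f q)" by (rule smooth_scaleR[OF smooth_on_const smf])
    have \<tau>: "norm x *\<^sub>R f (\<rho> x) = x" using f_\<rho>[OF x] nx by simp
    have "\<rho> differentiable (at (norm x *\<^sub>R f (\<rho> x)))" unfolding \<tau> by (rule smooth_openD_diff[OF smooth_open_\<rho> x])
    from tangent_space_left_inverse[OF smooth_open open_UNIV UNIV_I \<rho>_f(1)[OF _ nx] this v]
    show "v \<in> range (fderiv \<rho> x)" unfolding \<tau> by (metis rangeI)
  next
    fix v assume "v \<in> range (fderiv \<rho> x)"
    then show "v \<in> tangent_space M (\<rho> x)"
      using fderiv_in_tangent_space[OF open_nz x smooth_open_\<rho>] \<rho>_M by blast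
  qed
qed

lemma smooth_open_h: "smooth_open nz h"
  unfolding h_def[abs_def] by (rule param_sm[OF \<rho>_param smooth_F])

lemma smooth_open_U: "smooth_open nz U"
  unfolding U_def[abs_def] by (rule smooth_open_scaleR[OF open_nz smooth_open_norm smooth_open_h])

lemma fderiv_norm: "x \<in> nz \<Longrightarrow> fderiv norm x v = (x \<bullet> v) / norm x"
  using GDERIV_norm[of x, unfolded gderiv_def, THEN fderiv_eq]
  by (simp add: sgn_div_norm inner_commute divide_inverse mult.commute)

lemma fderiv_U:
  assumes x: "x \<in> nz"
  shows "fderiv U x v = ((x \<bullet> v) / norm x) *\<^sub>R h x + norm x *\<^sub>R fderiv h x v"
proof -
  have "((\<lambda>x. norm x *\<^sub>R h x) has_derivative (\<lambda>v. norm x *\<^sub>R fderiv h x v + fderiv norm x v *\<^sub>R h x)) (at x)"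
    by (intro has_derivative_scaleR smooth_openD_deriv[OF smooth_open_norm x] smooth_openD_deriv[OF smooth_open_h x])
  from fun_cong[OF fderiv_eq[OF this], of v] show ?thesis
    by (simp add: U_def[abs_def] fderiv_norm[OF x])
qed

text \<open>\<open>f (\<rho> x)\<close> is the radial projection, so the isometry hypothesis
  compares \<open>F\<close> with it.\<close>

lemma fderiv_h_inner:
  assumes x: "x \<in> nz"
  shows "fderiv h x v \<bullet> fderiv h x w = fderiv unit x v \<bullet> fderiv unit x w"
proof -
  have t: "fderiv \<rho> x v \<in> tangent_space M (\<rho> x)" for v
    using \<rho>_param x unfolding param_def by auto
  have F: "fderiv h x v = differential M F (\<rho> x) (fderiv \<rho> x v)" for v
    unfolding h_def[abs_def] by (rule param_fderiv[OF \<rho>_param x smooth_F])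
  have "fderiv unit x = fderiv (\<lambda>x. f (\<rho> x)) x"
    by (rule fderiv_cong[OF open_nz x _ smooth_openD_diff[OF smooth_open_normalize x]]) (simp only: f_\<rho>)
  then have f: "fderiv unit x v = differential M f (\<rho> x) (fderiv \<rho> x v)" for v
    using param_fderiv[OF \<rho>_param x smf] by simp
  show ?thesis unfolding F f by (rule iso[OF \<rho>_M[OF x] t t, symmetric])
qed

lemma h_h: "x \<in> nz \<Longrightarrow> h x \<bullet> h x = 1"
  unfolding h_def by (rule F_F[OF \<rho>_M])

lemma fderiv_h_tang:
  assumes x: "x \<in> nz"
  shows "fderiv h x v \<in> tang M F (\<rho> x)"
  using param_tang[OF \<rho>_param x] unfolding h_def[abs_def] by blast

lemma h_fderiv_h:
  assumes x: "x \<in> nz"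
  shows "h x \<bullet> fderiv h x v = 0"
  using F_P[OF \<rho>_M[OF x], of "fderiv h x v"] P_id[OF \<rho>_M[OF x] fderiv_h_tang[OF x]]
  by (simp add: h_def)

lemma fderiv_h_radial:
  assumes x: "x \<in> nz"
  shows "fderiv h x x = 0"
proof -
  have "fderiv unit x x = 0" using x by (simp add: fderiv_normalize power2_norm_eq_inner)
  then show ?thesis using fderiv_h_inner[OF x, of x x] by simp
qed

lemma fderiv_U_radial: "x \<in> nz \<Longrightarrow> fderiv U x x = U x"
  by (simp add: fderiv_U fderiv_h_radial U_def norm_eq_sqrt_inner real_div_sqrt)

lemma fderiv_U_h:
  assumes x: "x \<in> nz"
  shows "fderiv U x v \<bullet> h x = (x \<bullet> v) / norm x"
  using h_fderiv_h[OF x, of v] by (simp add: fderiv_U[OF x] inner_add_left h_h[OF x] inner_commute[of "fderiv h x v" "h x"])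

text \<open>The metric of the cone is \<open>dr^2 + r^2\<close> times that of the round sphere,
  which is the flat metric in polar coordinates.\<close>

lemma fderiv_U_inner:
  assumes x: "x \<in> nz"
  shows "fderiv U x v \<bullet> fderiv U x w = v \<bullet> w"
proof -
  have nx: "norm x \<noteq> 0" using x by simp
  have hh: "fderiv h x u \<bullet> h x = 0" for u
    using h_fderiv_h[OF x, of u] by (simp add: inner_commute[of "fderiv h x u" "h x"])
  define a where "a u = (x \<bullet> u) / (norm x * norm x)" for u
  have xx: "x \<bullet> x = norm x * norm x" by (simp add: dot_square_norm power2_eq_square)
  have unit': "fderiv unit x u = (1 / norm x) *\<^sub>R (u - a u *\<^sub>R x)" for u
    using x by (simp add: fderiv_normalize a_def power2_eq_square) (simp add: inverse_eq_divide)
  have "fderiv U x v \<bullet> fderiv U x w = ((x \<bullet> v) / norm x) * ((x \<bullet> w) / norm x) + norm x * norm x * (fderiv h x v \<bullet> fderiv h x w)"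
    using h_fderiv_h[OF x] by (simp add: fderiv_U[OF x] inner_add_left inner_add_right h_h[OF x] hh)
  also have "norm x * norm x * (fderiv h x v \<bullet> fderiv h x w) = (v - a v *\<^sub>R x) \<bullet> (w - a w *\<^sub>R x)"
    unfolding fderiv_h_inner[OF x] unit' using nx by simp
  also have "\<dots> = v \<bullet> w - a w * (x \<bullet> v) - a v * (x \<bullet> w) + a v * a w * (x \<bullet> x)"
    by (simp add: inner_diff_left inner_diff_right inner_commute[of v x] algebra_simps)
  also have "a v * a w * (x \<bullet> x) = a v * (x \<bullet> w)"
    unfolding xx using nx by (simp add: a_def)
  also have "(x \<bullet> v) / norm x * ((x \<bullet> w) / norm x) = a w * (x \<bullet> v)"
    by (simp add: a_def mult.commute)
  finally show ?thesis by simp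
qed

lemma linear_U': "x \<in> nz \<Longrightarrow> linear (fderiv U x)"
  by (intro linear_fderiv smooth_openD_diff[OF smooth_open_U])

lemma linear_h': "x \<in> nz \<Longrightarrow> linear (fderiv h x)"
  by (intro linear_fderiv smooth_openD_diff[OF smooth_open_h])

lemma linear_T: "linear (T x)"
  unfolding T_def by (intro linearI) (simp_all add: inner_add_left scaleR_add_left sum.distrib scaleR_sum_right)

lemma T_inner:
  assumes x: "x \<in> nz"
  shows "T x w \<bullet> v = w \<bullet> fderiv U x v"
proof -
  have "w \<bullet> fderiv U x v = (\<Sum>c\<in>Basis. (v \<bullet> c) * (w \<bullet> fderiv U x c))"
    by (subst linear_expand[OF linear_U'[OF x]]) (simp add: inner_sum_right)
  also have "\<dots> = T x w \<bullet> v"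
    unfolding T_def by (simp add: inner_sum_left inner_commute[of v] mult.commute)
  finally show ?thesis ..
qed

lemma T_U: "x \<in> nz \<Longrightarrow> T x (fderiv U x v) = v"
  using T_inner[of x "fderiv U x v"] fderiv_U_inner[of x v] by (metis vector_eq_rdot)

text \<open>\<open>fderiv U x (T x w)\<close> is the projection of \<open>w\<close> to the span of
  the tangent space and \<open>h x\<close>. By \<open>fderiv_U\<close> its tangential part is
  \<open>norm x\<close> times \<open>fderiv h x (T x w)\<close>, whence the factor.\<close>

lemma \<rho>_frame: "frame nz \<rho> (\<lambda>x w. norm x *\<^sub>R T x w)"
  unfolding frame_def
proof (intro conjI \<rho>_param ballI allI)
  show "linear (\<lambda>w. norm x *\<^sub>R T x w)" for x by (rule linear_compose_scale_right[OF linear_T])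
  show "smooth_open nz (\<lambda>x. norm x *\<^sub>R T x w)" for w
    unfolding T_def by (intro smooth_open_scaleR smooth_open_sum smooth_open_inner smooth_open_norm smooth_openD_fderiv smooth_open_U smooth_open_const open_nz finite_Basis)
  fix x w assume x: "x \<in> nz"
  let ?y = "norm x *\<^sub>R T x w"
  have nx: "norm x \<noteq> 0" using x by simp
  have Dh: "fderiv h x ?y = fderiv U x (T x w) - (w \<bullet> h x) *\<^sub>R h x"
  proof -
    have "x \<bullet> T x w = norm x * (w \<bullet> h x)"
      using T_inner[OF x, of w x] fderiv_U_radial[OF x] by (simp add: U_def inner_commute)
    then show ?thesis using nx by (simp add: fderiv_U[OF x] linear_scale[OF linear_h'[OF x]])
  qed
  have "P (\<rho> x) w = fderiv h x ?y"
  proof (rule orth_proj_unique[OF subspace_tang[OF \<rho>_M[OF x]] fderiv_h_tang[OF x]])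
    fix z assume "z \<in> tang M F (\<rho> x)"
    then obtain \<zeta> where z: "z = fderiv h x \<zeta>" using param_tang[OF \<rho>_param x] unfolding h_def[abs_def] by auto
    have "norm x *\<^sub>R z = fderiv U x \<zeta> - ((x \<bullet> \<zeta>) / norm x) *\<^sub>R h x" by (simp add: z fderiv_U[OF x])
    from arg_cong[OF this, of "\<lambda>y. (w - fderiv U x (T x w)) \<bullet> y"]
    have "norm x * ((w - fderiv U x (T x w)) \<bullet> z) = (w - fderiv U x (T x w)) \<bullet> fderiv U x \<zeta>
        - ((x \<bullet> \<zeta>) / norm x) * ((w - fderiv U x (T x w)) \<bullet> h x)"
      by (simp only: inner_diff_right inner_scaleR_right)
    also have "(w - fderiv U x (T x w)) \<bullet> fderiv U x \<zeta> = 0"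
      by (simp add: inner_diff_left fderiv_U_inner[OF x] T_inner[OF x])
    also have "(w - fderiv U x (T x w)) \<bullet> h x = 0"
      using T_inner[OF x, of w x] fderiv_U_radial[OF x] nx
      by (simp add: inner_diff_left fderiv_U_h[OF x] inner_commute[of x] U_def)
    finally have "(w - fderiv U x (T x w)) \<bullet> z = 0" using nx by simp
    moreover have "h x \<bullet> z = 0" unfolding z by (rule h_fderiv_h[OF x])
    ultimately show "(w - fderiv h x ?y) \<bullet> z = 0"
      unfolding Dh by (simp add: inner_diff_left)
  qed
  then show "fderiv (\<lambda>y. F (\<rho> y)) x ?y = P (\<rho> x) w" by (simp add: h_def[abs_def])
qed

section \<open>Rigidity of the cone map\<close>

abbreviation "U2 v w x \<equiv> fderiv (\<lambda>y. fderiv U y w) x v"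

lemma U2_commute: "x \<in> nz \<Longrightarrow> U2 v w x = U2 w v x"
  by (rule fderiv_commute[OF open_nz _ smooth_open_U])

lemma fderiv_inner_const:
  assumes x: "x \<in> nz" and V: "smooth_open nz V" "smooth_open nz V'" and c: "\<And>y. y \<in> nz \<Longrightarrow> V y \<bullet> V' y = c"
  shows "V x \<bullet> fderiv V' x v + fderiv V x v \<bullet> V' x = 0"
proof -
  have "((\<lambda>y. V y \<bullet> V' y) has_derivative (\<lambda>v. V x \<bullet> fderiv V' x v + fderiv V x v \<bullet> V' x)) (at x)"
    by (intro has_derivative_inner smooth_openD_deriv[OF V(1) x] smooth_openD_deriv[OF V(2) x])
  then have "((\<lambda>y. c) has_derivative (\<lambda>v. V x \<bullet> fderiv V' x v + fderiv V x v \<bullet> V' x)) (at x)"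
    by (rule has_derivative_transform_within_open[OF _ open_nz x]) (rule c)
  from has_derivative_unique[OF this has_derivative_const] show ?thesis by metis
qed

text \<open>The argument behind Koszul's formula: the expression is symmetric in \<open>v\<close>,
  \<open>w\<close> and skew in \<open>w\<close>, \<open>u\<close>, hence zero.\<close>

lemma U2_orth:
  assumes x: "x \<in> nz"
  shows "U2 v w x \<bullet> fderiv U x u = 0"
proof -
  define t where "t v w u = U2 v w x \<bullet> fderiv U x u" for v w u
  have skew: "t v w u = - t v u w" for v w u
    using fderiv_inner_const[OF x smooth_openD_fderiv[OF smooth_open_U] smooth_openD_fderiv[OF smooth_open_U] fderiv_U_inner, of w u v]
    by (simp add: t_def inner_commute)
  have sym: "t v w u = t w v u" for v w u
    unfolding t_def by (simp add: U2_commute[OF x, of v w])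
  have "t v w u = - t v w u"
    using skew[of v w u] sym[of v u w] skew[of u v w] sym[of u w v] skew[of w u v] sym[of w v u] by simp
  then show ?thesis by (simp add: t_def)
qed

lemma P_U2: "x \<in> nz \<Longrightarrow> P (\<rho> x) (U2 v w x) = 0"
proof -
  assume x: "x \<in> nz"
  have nx: "norm x \<noteq> 0" using x by simp
  show ?thesis
  proof (rule orth_proj_eq_0[OF subspace_tang[OF \<rho>_M[OF x]]])
    fix z assume "z \<in> tang M F (\<rho> x)"
    then obtain \<zeta> where z: "z = fderiv h x \<zeta>" using param_tang[OF \<rho>_param x] unfolding h_def[abs_def] by auto
    have hU: "norm x *\<^sub>R h x = fderiv U x x" using fderiv_U_radial[OF x] by (simp add: U_def)
    have "norm x * (U2 v w x \<bullet> h x) = U2 v w x \<bullet> fderiv U x x" by (metis hU inner_scaleR_right)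
    then have "U2 v w x \<bullet> h x = 0" using nx U2_orth[OF x] by simp
    moreover have "norm x *\<^sub>R z = fderiv U x \<zeta> - ((x \<bullet> \<zeta>) / norm x) *\<^sub>R h x" by (simp add: z fderiv_U[OF x])
    from arg_cong[OF this, of "\<lambda>y. U2 v w x \<bullet> y"]
    have "norm x * (U2 v w x \<bullet> z) = U2 v w x \<bullet> fderiv U x \<zeta> - ((x \<bullet> \<zeta>) / norm x) * (U2 v w x \<bullet> h x)"
      by (simp only: inner_diff_right inner_scaleR_right)
    ultimately show "U2 v w x \<bullet> z = 0" using nx U2_orth[OF x] by simp
  qed
qed

lemma P_fderiv_U:
  assumes x: "x \<in> nz"
  shows "P (\<rho> x) (fderiv U x v) = fderiv U x v - ((x \<bullet> v) / norm x) *\<^sub>R h x"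
proof -
  have M: "\<rho> x \<in> M" by (rule \<rho>_M[OF x])
  have "P (\<rho> x) (h x) = 0" unfolding h_def by (rule P_F[OF M])
  then show ?thesis
    by (simp add: fderiv_U[OF x] linear_add[OF linear_P[OF M]] linear_scale[OF linear_P[OF M]]
      P_id[OF M fderiv_h_tang[OF x]])
qed

text \<open>The cone over a minimal submanifold of the sphere is minimal, so its isometric parametrization
  by flat space is harmonic.\<close>

lemma U_harmonic:
  assumes x: "x \<in> nz"
  shows "(\<Sum>c\<in>Basis. U2 c c x) = 0"
proof -
  let ?q = "\<rho> x"
  have M: "?q \<in> M" by (rule \<rho>_M[OF x])
  have nx: "norm x \<noteq> 0" "norm x > 0" using x by auto
  define \<Phi> where "\<Phi> v w = fderiv (\<lambda>y. P (\<rho> y) w) x v" for v w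
  have smP: "smooth_open nz (\<lambda>y. P (\<rho> y) w)" for w by (rule param_sm[OF \<rho>_param smooth_P])
  have lin1: "linear (\<lambda>v. \<Phi> v w)" for w
    unfolding \<Phi>_def by (rule linear_fderiv[OF smooth_openD_diff[OF smP x]])
  have dP: "dP ?q v w = \<Phi> (norm x *\<^sub>R T x v) w" for v w
    unfolding \<Phi>_def by (rule frame_dd[OF \<rho>_frame x smooth_P])
  have lin2: "linear (\<Phi> v)" for v
  proof -
    have "T x (fderiv U x v) = v" by (rule T_U[OF x])
    then have "\<Phi> v w = (1 / norm x) *\<^sub>R dP ?q (fderiv U x v) w" for w
      using nx by (simp add: dP linear_scale[OF lin1])
    then have "\<Phi> v = (\<lambda>w. (1 / norm x) *\<^sub>R dP ?q (fderiv U x v) w)" by auto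
    then show ?thesis using linear_compose_scale_right[OF linear_dP2[OF M]] by simp
  qed
  \<comment> \<open>The adjoint \<open>T\<close> carries the trace from the ambient basis to the
    basis of the flat domain.\<close>
  have sum: "(\<Sum>b\<in>Basis. dP ?q b b) = norm x *\<^sub>R (\<Sum>c\<in>Basis. \<Phi> c (fderiv U x c))"
  proof -
    have "dP ?q b b = (\<Sum>c\<in>Basis. norm x *\<^sub>R (fderiv U x c \<bullet> b) *\<^sub>R \<Phi> c b)" for b
      unfolding dP linear_scale[OF lin1] T_def linear_sum[OF lin1]
      by (simp add: scaleR_sum_right inner_commute)
    then have "(\<Sum>b\<in>Basis. dP ?q b b) = (\<Sum>c\<in>Basis. \<Sum>b\<in>Basis. norm x *\<^sub>R (fderiv U x c \<bullet> b) *\<^sub>R \<Phi> c b)"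
      by (simp add: sum.swap[of _ "Basis :: 's set"])
    also have "\<dots> = norm x *\<^sub>R (\<Sum>c\<in>Basis. \<Phi> c (fderiv U x c))"
      unfolding scaleR_sum_right
      by (intro sum.cong refl) (subst linear_expand[OF lin2], simp add: scaleR_sum_right)
    finally show ?thesis .
  qed
  \<comment> \<open>\<open>P (\<rho> y) (fderiv U y c)\<close> is known from
    \<open>P_fderiv_U\<close>. Its derivative is compared with the product rule, where the projected
    second derivative of \<open>U\<close> is zero by \<open>P_U2\<close>.\<close>
  have \<Phi>_diag: "\<Phi> c (fderiv U x c) = U2 c c x - (((c \<bullet> c) / norm x - (x \<bullet> c)\<^sup>2 / norm x ^ 3) *\<^sub>R h x + ((x \<bullet> c) / norm x) *\<^sub>R fderiv h x c)" for c
  proof -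
    let ?k = "\<lambda>y. (y \<bullet> c) / norm y"
    have dk: "(?k has_derivative (\<lambda>v. (v \<bullet> c) / norm x - (x \<bullet> c) * (x \<bullet> v) / norm x ^ 3)) (at x)"
    proof -
      note GDERIV_norm[OF x[unfolded Compl_iff singleton_iff], unfolded gderiv_def, derivative_intros]
      show ?thesis using nx
        by (auto intro!: derivative_eq_intros simp: fun_eq_iff sgn_div_norm inner_commute power3_eq_cube field_simps)
    qed
    have "((\<lambda>y. fderiv U y c - ?k y *\<^sub>R h y) has_derivative
      (\<lambda>v. fderiv (\<lambda>y. fderiv U y c) x v - (?k x *\<^sub>R fderiv h x v + ((v \<bullet> c) / norm x - (x \<bullet> c) * (x \<bullet> v) / norm x ^ 3) *\<^sub>R h x))) (at x)"
      by (intro has_derivative_diff has_derivative_scaleR smooth_openD_deriv[OF smooth_openD_fderiv[OF smooth_open_U] x] smooth_openD_deriv[OF smooth_open_h x] dk)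
    then have "((\<lambda>y. P (\<rho> y) (fderiv U y c)) has_derivative
      (\<lambda>v. fderiv (\<lambda>y. fderiv U y c) x v - (?k x *\<^sub>R fderiv h x v + ((v \<bullet> c) / norm x - (x \<bullet> c) * (x \<bullet> v) / norm x ^ 3) *\<^sub>R h x))) (at x)"
      by (rule has_derivative_transform_within_open[OF _ open_nz x]) (simp add: P_fderiv_U)
    from fun_cong[OF fderiv_eq[OF this], of c]
    have 1: "fderiv (\<lambda>y. P (\<rho> y) (fderiv U y c)) x c = U2 c c x - (((c \<bullet> c) / norm x - (x \<bullet> c)\<^sup>2 / norm x ^ 3) *\<^sub>R h x + ((x \<bullet> c) / norm x) *\<^sub>R fderiv h x c)"
      by (simp add: power2_eq_square add.commute)
    have "fderiv (\<lambda>y. P (\<rho> y) (fderiv U y c)) x c = fderiv (\<lambda>y. P (\<rho> y) (fderiv U x c)) x c + P (\<rho> x) (fderiv (\<lambda>y. fderiv U y c) x c)"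
      by (rule fderiv_apply[OF open_nz x linear_P[OF \<rho>_M] smooth_openD_diff[OF smP x] smooth_openD_diff[OF smooth_openD_fderiv[OF smooth_open_U] x]])
    then show ?thesis using 1 P_U2[OF x] by (simp add: \<Phi>_def)
  qed
  \<comment> \<open>There are \<open>m + 1\<close> basis vectors, and the radial term takes one
    away. The remaining \<open>m\<close> cancels the one in the trace of \<open>dP\<close>.\<close>
  have s1: "(\<Sum>c\<in>(Basis::'s set). (c \<bullet> c) / norm x - (x \<bullet> c)\<^sup>2 / norm x ^ 3) = real m / norm x"
  proof -
    have "(\<Sum>c\<in>(Basis::'s set). (x \<bullet> c)\<^sup>2) = (norm x)\<^sup>2"
      unfolding power2_norm_eq_inner by (subst euclidean_inner) (simp add: power2_eq_square)
    moreover have "(\<Sum>c\<in>(Basis::'s set). c \<bullet> c) = real m + 1" using dim_s by simp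
    ultimately show ?thesis
      using nx by (simp add: sum_subtractf flip: sum_divide_distrib) (simp add: field_simps power3_eq_cube power2_eq_square)
  qed
  have s2: "(\<Sum>c\<in>Basis. ((x \<bullet> c) / norm x) *\<^sub>R fderiv h x c) = 0"
  proof -
    have "(\<Sum>c\<in>Basis. ((x \<bullet> c) / norm x) *\<^sub>R fderiv h x c) = (1 / norm x) *\<^sub>R (\<Sum>c\<in>Basis. (x \<bullet> c) *\<^sub>R fderiv h x c)"
      by (simp add: scaleR_sum_right)
    also have "(\<Sum>c\<in>Basis. (x \<bullet> c) *\<^sub>R fderiv h x c) = fderiv h x x"
      by (rule linear_expand[OF linear_h'[OF x], symmetric])
    finally show ?thesis by (simp add: fderiv_h_radial[OF x])
  qed
  have "(- real m) *\<^sub>R h x = norm x *\<^sub>R (\<Sum>c\<in>Basis. \<Phi> c (fderiv U x c))"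
    using trace_dP[OF min M] sum by (simp add: h_def)
  also have "(\<Sum>c\<in>Basis. \<Phi> c (fderiv U x c)) = (\<Sum>c\<in>Basis. U2 c c x)
      - ((\<Sum>c\<in>(Basis::'s set). (c \<bullet> c) / norm x - (x \<bullet> c)\<^sup>2 / norm x ^ 3) *\<^sub>R h x + (\<Sum>c\<in>Basis. ((x \<bullet> c) / norm x) *\<^sub>R fderiv h x c))"
    unfolding \<Phi>_diag scaleR_sum_left by (simp only: sum_subtractf sum.distrib)
  also have "norm x *\<^sub>R \<dots> = norm x *\<^sub>R (\<Sum>c\<in>Basis. U2 c c x) - real m *\<^sub>R h x"
    unfolding s1 s2 using nx by (simp add: scaleR_diff_right)
  finally show ?thesis using nx by simp
qed

text \<open>Apply the Laplacian to \<open>|\<partial>\<^sub>b U|\<^sup>2 = 1\<close>.\<close>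

lemma U2_zero:
  assumes x: "x \<in> nz"
  shows "U2 v b x = 0"
proof -
  let ?Ub = "\<lambda>y. fderiv U y b"
  have smUb: "smooth_open nz (\<lambda>y. fderiv U y b)" for b by (rule smooth_openD_fderiv[OF smooth_open_U])
  \<comment> \<open>The orthogonality \<open>U2_orth\<close> differentiated once more: half the
    second derivative of the squared norm of \<open>?Ub\<close>.\<close>
  have one: "fderiv (\<lambda>y. U2 k b y) x k \<bullet> ?Ub x + U2 k b x \<bullet> U2 k b x = 0" for k
  proof -
    have "U2 k b x \<bullet> fderiv ?Ub x k + fderiv (\<lambda>y. U2 k b y) x k \<bullet> ?Ub x = 0"
      by (rule fderiv_inner_const[OF x smooth_openD_fderiv[OF smUb] smUb U2_orth])
    then show ?thesis by (simp add: add.commute)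
  qed
  \<comment> \<open>Commuting third derivatives turns the sum over \<open>k\<close> into the
    derivative of the Laplacian of \<open>U\<close> in direction \<open>b\<close>.\<close>
  have two: "fderiv (\<lambda>y. U2 k b y) x k = fderiv (\<lambda>y. U2 k k y) x b" for k
  proof -
    have "fderiv (\<lambda>y. U2 k b y) x = fderiv (\<lambda>y. U2 b k y) x"
      by (rule fderiv_cong[OF open_nz x U2_commute smooth_openD_diff[OF smooth_openD_fderiv[OF smUb] x]])
    then show ?thesis using fderiv_commute[OF open_nz x smUb[of k], of b k] by simp
  qed
  have "(\<Sum>k\<in>Basis. fderiv (\<lambda>y. U2 k k y) x b) = fderiv (\<lambda>y. \<Sum>k\<in>Basis. U2 k k y) x b"
  proof -
    have "((\<lambda>y. \<Sum>k\<in>Basis. U2 k k y) has_derivative (\<lambda>v. \<Sum>k\<in>Basis. fderiv (\<lambda>y. U2 k k y) x v)) (at x)"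
      by (intro has_derivative_sum smooth_openD_deriv[OF smooth_openD_fderiv[OF smUb] x])
    from fun_cong[OF fderiv_eq[OF this], of b] show ?thesis by simp
  qed
  also have "\<dots> = fderiv (\<lambda>y. 0) x b"
  proof (rule fun_cong[OF fderiv_cong[OF open_nz x U_harmonic]])
    show "(\<lambda>y. \<Sum>k\<in>Basis. U2 k k y) differentiable (at x)"
      by (rule smooth_openD_diff[OF smooth_open_sum[OF open_nz finite_Basis smooth_openD_fderiv[OF smUb]] x])
  qed
  finally have three: "(\<Sum>k\<in>Basis. fderiv (\<lambda>y. U2 k k y) x b) = 0"
    by (simp add: frechet_derivative_const)
  have "0 = (\<Sum>k\<in>Basis. fderiv (\<lambda>y. U2 k b y) x k \<bullet> ?Ub x + U2 k b x \<bullet> U2 k b x)"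
    by (simp add: one)
  also have "\<dots> = (\<Sum>k\<in>Basis. fderiv (\<lambda>y. U2 k k y) x b) \<bullet> ?Ub x + (\<Sum>k\<in>Basis. U2 k b x \<bullet> U2 k b x)"
    unfolding two by (simp add: sum.distrib inner_sum_left)
  finally have "(\<Sum>k\<in>Basis. U2 k b x \<bullet> U2 k b x) = 0" unfolding three by simp
  then have "U2 k b x = 0" if "k \<in> Basis" for k
    using that by (subst (asm) sum_nonneg_eq_0_iff) auto
  then show ?thesis
    using linear_expand[OF linear_fderiv[OF smooth_openD_diff[OF smUb[of b] x]], of v] by simp
qed

text \<open>\<open>1 \<le> m\<close> enters through connectedness of the punctured space, whose
  dimension is \<open>m + 1\<close>.\<close>

lemma constant_on_nz:
  assumes V: "smooth_open nz V" and zero: "\<And>x v. x \<in> nz \<Longrightarrow> fderiv V x v = 0" and xy: "x \<in> nz" "y \<in> nz"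
  shows "V x = V y"
proof (rule has_derivative_zero_unique_connected[OF open_nz connected_punctured _ xy])
  show "2 \<le> DIM('s)" using dim_s m1 by simp
  show "(V has_derivative (\<lambda>x. 0)) (at x)" if "x \<in> nz" for x
  proof -
    have "fderiv V x = (\<lambda>_. 0)" using zero[OF that] by auto
    then show ?thesis using smooth_openD_deriv[OF V that] by simp
  qed
qed

lemma U'_const: "x \<in> nz \<Longrightarrow> y \<in> nz \<Longrightarrow> fderiv U x b = fderiv U y b"
  by (rule constant_on_nz[OF smooth_openD_fderiv[OF smooth_open_U] U2_zero])

lemma T_const: "x \<in> nz \<Longrightarrow> y \<in> nz \<Longrightarrow> T x w = T y w"
  unfolding T_def by (simp only: U'_const[of x y])

section \<open>Eigensections over a totally geodesic sphere\<close>

text \<open>The range of \<open>fderiv U x\<close> is the span of \<open>h x\<close> and the tangent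
  space. By \<open>U'_const\<close> it is the same for all \<open>x\<close>, and with it the normal
  space.\<close>

lemma nor_const:
  assumes x: "x \<in> nz"
  shows "nor M F (\<rho> x) = {v. \<forall>\<xi>. v \<bullet> fderiv U x \<xi> = 0}"
proof -
  have nx: "norm x \<noteq> 0" using x by simp
  have hU: "h x = (1 / norm x) *\<^sub>R fderiv U x x" using fderiv_U_radial[OF x] nx by (simp add: U_def)
  have "v \<in> nor M F (\<rho> x) \<longleftrightarrow> (\<forall>\<xi>. v \<bullet> fderiv U x \<xi> = 0)" for v
  proof
    assume "v \<in> nor M F (\<rho> x)"
    then have "v \<bullet> h x = 0" "\<forall>y\<in>tang M F (\<rho> x). v \<bullet> y = 0"
      unfolding nor_def tangent_space_usphere[OF F_usphere[OF \<rho>_M[OF x]]] by (auto simp: h_def)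
    then show "\<forall>\<xi>. v \<bullet> fderiv U x \<xi> = 0"
      using fderiv_h_tang[OF x] by (simp add: fderiv_U[OF x] inner_add_right)
  next
    assume v: "\<forall>\<xi>. v \<bullet> fderiv U x \<xi> = 0"
    then have 1: "v \<bullet> h x = 0" by (subst hU) simp
    have "v \<bullet> fderiv h x \<xi> = 0" for \<xi>
    proof -
      have "v \<bullet> fderiv U x \<xi> = norm x * (v \<bullet> fderiv h x \<xi>)" by (simp add: fderiv_U[OF x] inner_add_right 1)
      then show ?thesis using v nx by simp
    qed
    then have "\<forall>y\<in>tang M F (\<rho> x). v \<bullet> y = 0"
      using param_tang[OF \<rho>_param x] by (auto simp: h_def[abs_def])
    then show "v \<in> nor M F (\<rho> x)"
      unfolding nor_def tangent_space_usphere[OF F_usphere[OF \<rho>_M[OF x]]] using 1 by (simp add: h_def)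
  qed
  then show ?thesis by blast
qed

lemma M_\<rho>:
  assumes "q \<in> M"
  obtains x where "x \<in> nz" "q = \<rho> x"
  using \<rho>_f[OF assms, of 1] that[of "f q"] by simp

text \<open>Being normal means being orthogonal to vectors that do not depend on the point, a
  condition inherited by derivatives.\<close>

lemma dd_nor:
  assumes V: "smooth_on M V" and nor: "\<And>q. q \<in> M \<Longrightarrow> V q \<in> nor M F q" and q: "q \<in> M"
  shows "dd v V q \<in> nor M F q"
proof -
  obtain x where x: "x \<in> nz" "q = \<rho> x" by (rule M_\<rho>[OF q])
  have "V (\<rho> y) \<bullet> fderiv U x \<xi> = 0" if "y \<in> nz" for y \<xi>
    using nor[OF \<rho>_M[OF that]] unfolding nor_const[OF that] U'_const[OF that x(1)] by blast
  then have "fderiv (\<lambda>y. V (\<rho> y)) x \<eta> \<bullet> fderiv U x \<xi> = 0" for \<eta> \<xi>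
    using fderiv_inner_const[OF x(1) param_sm[OF \<rho>_param V] smooth_open_const, of "fderiv U x \<xi>" 0 \<eta>]
    by (simp add: frechet_derivative_const)
  then show ?thesis
    unfolding x(2) nor_const[OF x(1)] frame_dd[OF \<rho>_frame x(1) V] by blast
qed

lemma eigensection_const:
  assumes V: "V \<in> eigenspace M F (- real m)" and q: "q \<in> M" "q' \<in> M"
  shows "V q = V q'"
proof -
  have sec: "V \<in> normal_sections M F" and jac: "\<And>p. p \<in> M \<Longrightarrow> jacobi M F V p = (- real m) *\<^sub>R V p"
    using V by (auto simp: eigenspace_def)
  note smV = section_smooth[OF sec] and norV = section_nor[OF sec]
  have smd: "smooth_on M (dd e V)" for e by (rule smooth_dd[OF smV])
  have nord: "dd e V p \<in> nor M F p" if "p \<in> M" for e p by (rule dd_nor[OF smV norV that])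
  \<comment> \<open>The shape operator vanishes by \<open>dd_nor\<close>, so the Simons term is
    zero; the curvature term uses up the eigenvalue, and the normal projections in the Laplacian act
    as identities.\<close>
  have lap: "(\<Sum>b\<in>Basis. dd b (dd b V) p) = 0" if p: "p \<in> M" for p
  proof -
    have "dP p e (V p) = 0" for e
      using P_dd_section[OF p sec, of e] nord[OF p, of e] by (simp add: nor_eq[OF p])
    then have "simons_term M F V p = 0"
      by (simp add: simons_term_eq[OF p sec] linear_0[OF linear_dP2[OF p]] linear_0[OF linear_N[OF p]])
    then have "normal_laplacian M F V p = 0"
      using jac[OF p] curv_term_eq[OF p, of V, OF norV[OF p]] by (simp add: jacobi_def)
    moreover have "orth_proj (nor M F p) (dd e (\<lambda>q. orth_proj (nor M F q) (dd e V q)) p) = dd e (dd e V) p" for e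
    proof -
      have "dd e (\<lambda>q. orth_proj (nor M F q) (dd e V q)) p = dd e (dd e V) p"
        by (rule dd_cong[OF p]) (rule orth_proj_id[OF subspace_nor nord])
      moreover have "dd e (dd e V) p \<in> nor M F p" by (rule dd_nor[OF smd nord p])
      ultimately show ?thesis by (simp add: orth_proj_id[OF subspace_nor[OF p]])
    qed
    ultimately have 0: "(\<Sum>e\<in>orthonormal_basis (tang M F p). dd e (dd e V) p) = 0"
      by (simp add: normal_laplacian_eq[OF p sec])
    have lin2: "linear (\<lambda>v. dd u (dd v V) p)" for u
    proof (rule linearI)
      fix v w c
      have "dd u (dd (v + w) V) p = dd u (\<lambda>q. dd v V q + dd w V q) p"
        by (rule dd_cong[OF p]) (rule linear_add[OF linear_dd[OF _ smV]])
      then show "dd u (dd (v + w) V) p = dd u (dd v V) p + dd u (dd w V) p"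
        by (simp add: dd_add[OF p smd smd])
      have "dd u (dd (c *\<^sub>R v) V) p = dd u (\<lambda>q. c *\<^sub>R dd v V q) p"
        by (rule dd_cong[OF p]) (rule linear_scale[OF linear_dd[OF _ smV]])
      then show "dd u (dd (c *\<^sub>R v) V) p = c *\<^sub>R dd u (dd v V) p"
        by (simp add: dd_scale[OF p smd])
    qed
    have "(\<Sum>e\<in>orthonormal_basis (tang M F p). dd e (dd e V) p) = (\<Sum>b\<in>Basis. dd (P p b) (dd b V) p)"
      by (rule sum_B[OF p linear_dd[OF p smd] lin2])
    then show ?thesis using 0 by (simp add: dd_P[OF p])
  qed
  define W where "W x = V (\<rho> x)" for x
  have smW: "smooth_open nz W" unfolding W_def[abs_def] by (rule param_sm[OF \<rho>_param smV])
  have W_frame: "fderiv W x (norm x *\<^sub>R T x e) = dd e V (\<rho> x)" if "x \<in> nz" for x e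
    unfolding W_def[abs_def] by (rule frame_dd[OF \<rho>_frame that smV, symmetric])
  \<comment> \<open>\<open>fderiv W x \<xi>\<close> depends only on \<open>fderiv h x \<xi>\<close>,
    which is zero both for \<open>x\<close> and for 0.\<close>
  have euler: "fderiv W x x = 0" if x: "x \<in> nz" for x
  proof -
    have *: "field_deriv M F (\<lambda>_. fderiv h x \<xi>) V (\<rho> x) = fderiv W x \<xi>" for \<xi>
      unfolding W_def[abs_def] by (rule param_field_deriv[OF \<rho>_param x smV]) (simp add: h_def[abs_def])
    show ?thesis
      using *[of x] *[of 0] linear_0[OF linear_h'[OF x]] linear_0[OF linear_fderiv[OF smooth_openD_diff[OF smW x]]]
      by (simp add: fderiv_h_radial[OF x])
  qed
  have harm: "(\<Sum>c\<in>Basis. fderiv (\<lambda>y. fderiv W y c) x c) = 0" if x: "x \<in> nz" for x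
  proof -
    have nx: "norm x \<noteq> 0" using x by simp
    \<comment> \<open>What results from differentiating \<open>norm y *\<^sub>R fderiv W y v\<close>
      at \<open>x\<close> in direction \<open>norm x *\<^sub>R u\<close>; it is bilinear, so its
      trace can be moved between bases.\<close>
    define \<Psi> where "\<Psi> u v = (x \<bullet> u) *\<^sub>R fderiv W x v + (norm x * norm x) *\<^sub>R fderiv (\<lambda>y. fderiv W y v) x u" for u v
    have linW: "linear (fderiv W y)" if "y \<in> nz" for y by (rule linear_fderiv[OF smooth_openD_diff[OF smW that]])
    have linW2: "linear (\<lambda>v. fderiv (\<lambda>y. fderiv W y v) x u)" for u
      using linear_fderiv[OF smooth_openD_diff[OF smooth_openD_fderiv[OF smW] x]] fderiv_commute[OF open_nz x smW, of _ u] by simp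
    have 1: "linear (\<lambda>u. \<Psi> u v)" for v
      unfolding \<Psi>_def using linear_fderiv[OF smooth_openD_diff[OF smooth_openD_fderiv[OF smW] x]]
      by (intro linearI) (simp_all add: linear_add linear_scale inner_add_right scaleR_add_left scaleR_add_right algebra_simps)
    have 2: "linear (\<Psi> u)" for u
      unfolding \<Psi>_def[abs_def]
      by (intro linear_compose_add linear_compose_scale_right linW[OF x] linW2)
    have "dd b (dd b V) (\<rho> x) = \<Psi> (T x b) (T x b)" for b
    proof -
      let ?t = "T x b"
      \<comment> \<open>\<open>T\<close> is constant, so the direction \<open>?t\<close> taken at
        \<open>x\<close> serves for all \<open>y\<close>.\<close>
      have "dd b V (\<rho> y) = norm y *\<^sub>R fderiv W y ?t" if "y \<in> nz" for y
        using W_frame[OF that, of b] T_const[OF that x, of b] by (simp add: linear_scale[OF linW[OF that]])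
      then have eq: "norm y *\<^sub>R fderiv W y ?t = dd b V (\<rho> y)" if "y \<in> nz" for y using that by simp
      have "((\<lambda>y. norm y *\<^sub>R fderiv W y ?t) has_derivative
          (\<lambda>v. norm x *\<^sub>R fderiv (\<lambda>y. fderiv W y ?t) x v + fderiv norm x v *\<^sub>R fderiv W x ?t)) (at x)"
        by (intro has_derivative_scaleR smooth_openD_deriv[OF smooth_open_norm x] smooth_openD_deriv[OF smooth_openD_fderiv[OF smW] x])
      then have "((\<lambda>y. dd b V (\<rho> y)) has_derivative
          (\<lambda>v. norm x *\<^sub>R fderiv (\<lambda>y. fderiv W y ?t) x v + fderiv norm x v *\<^sub>R fderiv W x ?t)) (at x)"
        by (rule has_derivative_transform_within_open[OF _ open_nz x]) (rule eq)
      from fderiv_eq[OF this]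
      have "dd b (dd b V) (\<rho> x) = norm x *\<^sub>R fderiv (\<lambda>y. fderiv W y ?t) x (norm x *\<^sub>R ?t) + fderiv norm x (norm x *\<^sub>R ?t) *\<^sub>R fderiv W x ?t"
        using frame_dd[OF \<rho>_frame x smd, of b b] by simp
      then show ?thesis
        using nx by (simp add: \<Psi>_def fderiv_norm[OF x] linear_scale[OF linear_fderiv[OF smooth_openD_diff[OF smooth_openD_fderiv[OF smW] x]]])
    qed
    then have "(\<Sum>b\<in>Basis. \<Psi> (T x b) (T x b)) = 0" using lap[OF \<rho>_M[OF x]] by simp
    \<comment> \<open>The vectors \<open>T x b\<close> over the ambient basis give the same trace as
      the basis of the domain, because \<open>T x\<close> is both adjoint and left inverse to
      \<open>fderiv U x\<close>.\<close>
    moreover have "(\<Sum>b\<in>Basis. \<Psi> (T x b) (T x b)) = (\<Sum>c\<in>Basis. \<Psi> c c)"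
    proof -
      have "\<Psi> (T x b) (T x b) = (\<Sum>c\<in>Basis. (fderiv U x c \<bullet> b) *\<^sub>R \<Psi> c (T x b))" for b
      proof -
        have "\<Psi> (T x b) v = (\<Sum>c\<in>Basis. (fderiv U x c \<bullet> b) *\<^sub>R \<Psi> c v)" for v
          unfolding T_def linear_sum[OF 1] linear_scale[OF 1] by (simp add: inner_commute)
        then show ?thesis .
      qed
      then have "(\<Sum>b\<in>Basis. \<Psi> (T x b) (T x b)) = (\<Sum>c\<in>Basis. \<Sum>b\<in>Basis. (fderiv U x c \<bullet> b) *\<^sub>R \<Psi> c (T x b))"
        by (simp add: sum.swap[of _ "Basis :: 's set"])
      also have "\<dots> = (\<Sum>c\<in>Basis. \<Psi> c (T x (fderiv U x c)))"
      proof (rule sum.cong[OF refl])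
        fix c :: 's
        have "linear (\<lambda>w. \<Psi> c (T x w))" using linear_compose[OF linear_T 2] by (simp add: o_def)
        from linear_expand[OF this, of "fderiv U x c"]
        show "(\<Sum>b\<in>Basis. (fderiv U x c \<bullet> b) *\<^sub>R \<Psi> c (T x b)) = \<Psi> c (T x (fderiv U x c))" ..
      qed
      finally show ?thesis by (simp add: T_U[OF x])
    qed
    ultimately have "(\<Sum>c\<in>Basis. (x \<bullet> c) *\<^sub>R fderiv W x c) + (norm x * norm x) *\<^sub>R (\<Sum>c\<in>Basis. fderiv (\<lambda>y. fderiv W y c) x c) = 0"
      unfolding \<Psi>_def by (simp add: sum.distrib scaleR_sum_right)
    moreover have "(\<Sum>c\<in>Basis. (x \<bullet> c) *\<^sub>R fderiv W x c) = fderiv W x x"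
      by (rule linear_expand[OF linW[OF x], symmetric])
    ultimately show ?thesis using nx euler[OF x] by simp
  qed
  have "fderiv W x v = 0" if "x \<in> nz" for x v
    by (rule harmonic_homogeneous_constant[OF smW]) (use that euler harm in auto)
  note const = constant_on_nz[OF smW this]
  obtain x where "x \<in> nz" "q = \<rho> x" by (rule M_\<rho>[OF q(1)])
  moreover obtain x' where "x' \<in> nz" "q' = \<rho> x'" by (rule M_\<rho>[OF q(2)])
  ultimately show ?thesis using const[of x x'] by (simp add: W_def)
qed

lemma edim_eigenspace_le:
  assumes n: "DIM('a) = n + 1" and ne: "M \<noteq> {}"
  shows "edim (eigenspace M F (- real m)) \<le> enat (n - m)"
proof -
  obtain p where p: "p \<in> M" using ne by blast
  have "edim (eigenspace M F (- real m)) \<le> enat (dim (nor M F p))"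
  proof (rule edim_le_eval[of _ M p])
    fix V q assume V: "V \<in> eigenspace M F (- real m)"
    then have sec: "V \<in> normal_sections M F" by (simp add: eigenspace_def)
    show "V q = (if q \<in> M then V p else 0)"
      using eigensection_const[OF V _ p] sec by (auto simp: normal_sections_def)
    show "V p \<in> nor M F p" by (rule section_nor[OF sec p])
  qed
  then show ?thesis using dim_nor[OF n p] by (metis add_diff_cancel_right')
qed

end

section \<open>Totally geodesic immersions\<close>

lemma finite_separated:
  fixes S :: "'a::metric_space set"
  assumes "finite S"
  obtains d where "d > 0" "\<And>x y. x \<in> S \<Longrightarrow> y \<in> S \<Longrightarrow> x \<noteq> y \<Longrightarrow> d \<le> dist x y"
proof (cases "S = {}")
  case True
  then show thesis using that[of 1] by simp
next
  case False
  have "\<forall>x. \<exists>d>0. \<forall>y\<in>S. y \<noteq> x \<longrightarrow> d \<le> dist x y"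
    using finite_set_avoid[OF assms] by blast
  then obtain e where e: "\<And>x. e x > 0" "\<And>x y. y \<in> S \<Longrightarrow> y \<noteq> x \<Longrightarrow> e x \<le> dist x y"
    by metis
  show thesis
  proof (rule that[of "Min (e ` S)"])
    show "Min (e ` S) > 0" using assms False e by (subst Min_gr_iff) auto
    fix x y assume xy: "x \<in> S" "y \<in> S" "x \<noteq> y"
    have "Min (e ` S) \<le> e x" using assms xy by simp
    also have "\<dots> \<le> dist x y" using e xy by metis
    finally show "Min (e ` S) \<le> dist x y" .
  qed
qed

text \<open>The fibre of \<open>y\<close> is compact and discrete, hence finite, and its points have
  disjoint neighbourhoods on which \<open>f\<close> is a homeomorphism. Removing the image of the
  compact rest of \<open>M\<close> leaves a neighbourhood of \<open>y\<close> over which nothing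
  else lies.\<close>

lemma compact_local_homeomorphism_covering:
  fixes f :: "'b::euclidean_space \<Rightarrow> 's::euclidean_space"
  assumes M: "compact M" and f: "continuous_on M f" "f ` M = S"
    and loc: "\<And>p. p \<in> M \<Longrightarrow> \<exists>U T g. openin (top_of_set M) U \<and> p \<in> U \<and> openin (top_of_set S) T \<and> homeomorphism U T f g"
  shows "covering_space M f S"
proof
  fix y assume y: "y \<in> S"
  obtain U T g where U: "\<And>p. p \<in> M \<Longrightarrow> openin (top_of_set M) (U p)" "\<And>p. p \<in> M \<Longrightarrow> p \<in> U p"
    and T: "\<And>p. p \<in> M \<Longrightarrow> openin (top_of_set S) (T p)"
    and hom: "\<And>p. p \<in> M \<Longrightarrow> homeomorphism (U p) (T p) f (g p)"
    using loc by metis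
  have UM: "U p \<subseteq> M" if "p \<in> M" for p using openin_imp_subset[OF U(1)[OF that]] .
  have inj: "inj_on f (U p)" if "p \<in> M" for p
    by (rule inj_on_inverseI) (rule homeomorphism_apply1[OF hom[OF that]])
  define Y where "Y = {p \<in> M. f p = y}"
  have YM: "Y \<subseteq> M" by (auto simp: Y_def)
  have "closedin (top_of_set M) Y"
    using continuous_closedin_preimage_constant[OF f(1), of y] by (simp add: Y_def)
  then have "compact Y" using M closedin_compact_eq by blast
  have "\<forall>p\<in>M. \<exists>Q. open Q \<and> U p = M \<inter> Q" using U(1) by (auto simp: openin_open)
  then obtain O' where O': "\<And>p. p \<in> M \<Longrightarrow> open (O' p)" "\<And>p. p \<in> M \<Longrightarrow> U p = M \<inter> O' p" by metis
  have "p \<in> O' p" if "p \<in> Y" for p using O'(2) U(2) YM that by blast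
  then have cover: "Y \<subseteq> (\<Union>p\<in>Y. O' p)" by blast
  have openO: "open (O' p)" if "p \<in> Y" for p using O'(1) YM that by blast
  obtain D where D: "D \<subseteq> Y" "finite D" "Y \<subseteq> (\<Union>p\<in>D. O' p)"
    by (rule compactE_image[OF \<open>compact Y\<close> openO cover]) (assumption, rule that)
  \<comment> \<open>By injectivity of \<open>f\<close> on \<open>U p\<close>, each set of the finite
    cover meets the fibre only in its own point \<open>p\<close>.\<close>
  have "Y \<subseteq> D"
  proof
    fix q assume q: "q \<in> Y"
    then obtain p where p: "p \<in> D" "q \<in> O' p" using D by blast
    then have pM: "p \<in> M" "f p = y" using D YM by (auto simp: Y_def)
    then have "q \<in> U p" "p \<in> U p" using O' p q YM U(2) by auto
    then have "q = p" using inj[OF pM(1)] q pM(2) by (auto simp: Y_def dest: inj_onD)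
    then show "q \<in> D" using p by simp
  qed
  then have finY: "finite Y" using D finite_subset by blast
  have neY: "Y \<noteq> {}" using y f(2) by (auto simp: Y_def)
  obtain d where d: "d > 0" "\<And>p q. p \<in> Y \<Longrightarrow> q \<in> Y \<Longrightarrow> p \<noteq> q \<Longrightarrow> d \<le> dist p q"
    using finite_separated[OF finY] by metis
  define U' where "U' p = U p \<inter> ball p (d/2)" for p
  have U': "openin (top_of_set M) (U' p)" "p \<in> U' p" "U' p \<subseteq> U p" if "p \<in> Y" for p
    using that U YM d(1) by (auto simp: U'_def intro!: openin_Int_open)
  have disj: "U' p \<inter> U' q = {}" if "p \<in> Y" "q \<in> Y" "p \<noteq> q" for p q
  proof (rule ccontr)
    assume "U' p \<inter> U' q \<noteq> {}"
    then obtain r where "dist p r < d/2" "dist q r < d/2" by (auto simp: U'_def)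
    then have "dist p q < d" using dist_triangle[of p q r] by (simp add: dist_commute)
    then show False using d(2)[OF that] by simp
  qed
  define C where "C = M - (\<Union>p\<in>Y. U' p)"
  have "openin (top_of_set M) (\<Union>p\<in>Y. U' p)" using U'(1) by (intro openin_Union) auto
  then have "closedin (top_of_set M) C" unfolding C_def by (metis closedin_diff closedin_topspace topspace_euclidean_subtopology)
  then have "compact C" using M closedin_compact_eq by blast
  then have "compact (f ` C)" by (intro compact_continuous_image continuous_on_subset[OF f(1)]) (auto simp: C_def)
  then have closed: "closed (f ` C)" by (rule compact_imp_closed)
  have yC: "y \<notin> f ` C" using U'(2) by (auto simp: C_def Y_def)
  have img: "openin (top_of_set S) (f ` U' p)" if p: "p \<in> Y" for p
  proof -
    have pM: "p \<in> M" using p YM by auto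
    have "openin (top_of_set (U p)) (U' p)"
      using U'(1,3)[OF p] UM[OF pM] openin_subset_trans by blast
    then have "openin (top_of_set (T p)) (f ` U' p)"
      by (rule homeomorphism_imp_open_map[OF hom[OF pM]])
    then show ?thesis using T[OF pM] openin_trans by blast
  qed
  define V where "V = (\<Inter>p\<in>Y. f ` U' p) - f ` C"
  have "openin (top_of_set S) (\<Inter>p\<in>Y. f ` U' p)"
    using finY neY img by (intro openin_Inter) auto
  then have oV: "openin (top_of_set S) V"
    unfolding V_def Diff_eq by (rule openin_Int_open) (use closed in \<open>simp add: open_Compl\<close>)
  have yV: "y \<in> V" using yC U'(2) by (auto simp: V_def Y_def)
  show "\<exists>T. y \<in> T \<and> openin (top_of_set S) T \<and>
          (\<exists>v. \<Union>v = M \<inter> f -` T \<and> (\<forall>u\<in>v. openin (top_of_set M) u) \<and>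
               pairwise disjnt v \<and> (\<forall>u\<in>v. \<exists>q. homeomorphism u T f q))"
  proof (intro exI[of _ V] exI[of _ "(\<lambda>p. U' p \<inter> f -` V) ` Y"] conjI yV oV ballI)
    show "\<Union>((\<lambda>p. U' p \<inter> f -` V) ` Y) = M \<inter> f -` V"
    proof (intro equalityI subsetI)
      fix q assume "q \<in> \<Union>((\<lambda>p. U' p \<inter> f -` V) ` Y)"
      then show "q \<in> M \<inter> f -` V" using U'(3) UM YM by blast
    next
      fix q assume q: "q \<in> M \<inter> f -` V"
      then have "q \<notin> C" by (auto simp: V_def)
      then show "q \<in> \<Union>((\<lambda>p. U' p \<inter> f -` V) ` Y)" using q by (auto simp: C_def)
    qed
    show "pairwise disjnt ((\<lambda>p. U' p \<inter> f -` V) ` Y)"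
      using disj by (fastforce simp: pairwise_def disjnt_def)
    fix u assume "u \<in> (\<lambda>p. U' p \<inter> f -` V) ` Y"
    then obtain p where p: "p \<in> Y" and u: "u = U' p \<inter> f -` V" by auto
    have pM: "p \<in> M" using p YM by auto
    have U'M: "U' p \<subseteq> M" using U'(3)[OF p] UM[OF pM] by blast
    have "openin (top_of_set M) (M \<inter> f -` V)"
      by (rule continuous_openin_preimage[OF f(1) _ oV]) (use f(2) in auto)
    then have "openin (top_of_set M) (U' p \<inter> (M \<inter> f -` V))" using U'(1)[OF p] by blast
    moreover have "U' p \<inter> (M \<inter> f -` V) = u" using U'M u by blast
    ultimately show "openin (top_of_set M) u" by simp
    have "V \<subseteq> f ` U' p" using p unfolding V_def by blast
    then have "f ` u = V" unfolding u by blast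
    have "u \<subseteq> U p" using U'(3)[OF p] u by blast
    then have "homeomorphism u V f (g p)"
      by (rule homeomorphism_of_subsets[OF hom[OF pM] _ subset_refl \<open>f ` u = V\<close>])
    then show "\<exists>q. homeomorphism u V f q" by (rule exI[of _ "g p"])
  qed
qed (use f in auto)

text \<open>From dimension 3 of the ambient space on, the sphere is simply connected, so its
  identity lifts to a section \<open>s\<close>. Then \<open>s (f x)\<close> and \<open>x\<close> are
  two lifts of \<open>f\<close> on the connected \<open>M\<close> that agree at a point in the image
  of \<open>s\<close>.\<close>

lemma compact_covering_injective:
  fixes f :: "'b::euclidean_space \<Rightarrow> 's::euclidean_space"
  assumes cov: "covering_space M f (sphere 0 1)" and M: "connected M" and dim: "3 \<le> DIM('s)"
  shows "inj_on f M"
proof -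
  have sc: "simply_connected (sphere (0::'s) 1)" by (rule simply_connected_sphere[OF dim])
  obtain s where s: "continuous_on (sphere 0 1) s" "s \<in> sphere 0 1 \<rightarrow> M" "\<And>y. y \<in> sphere 0 1 \<Longrightarrow> f (s y) = y"
    by (rule covering_space_lift[OF cov sc locally_path_connected_sphere continuous_on_id]) auto
  obtain b :: 's where b: "b \<in> sphere 0 1" using dim nonempty_Basis norm_Basis by fastforce
  have fM: "f \<in> M \<rightarrow> sphere 0 1" and cf: "continuous_on M f"
    using covering_space_imp_surjective[OF cov] covering_space_imp_continuous[OF cov] by auto
  have fs: "f (s (f x)) = f x" if "x \<in> M" for x using that fM by (intro s(3)) auto
  have "s (f x) = x" if x: "x \<in> M" for x
  proof (rule covering_space_lift_unique[OF cov, of "\<lambda>x. s (f x)" "s b" "\<lambda>x. x" M f])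
    show "continuous_on M (\<lambda>x. s (f x))"
      using continuous_on_compose2[OF s(1) cf] fM by blast
  qed (use s b fM cf x M fs in auto)
  then show ?thesis by (metis inj_onI)
qed

context immersed_submanifold
begin

text \<open>The inverse function theorem needs a map between spaces of equal dimension, but
  \<open>\<phi> (F q)\<close> stays on the sphere. The factor \<open>y0 \<bullet> z\<close> in
  \<open>G\<close> supplies the missing radial direction and makes the derivative at
  \<open>y0\<close> the identity.\<close>

lemma local_section:
  fixes \<phi> :: "'a \<Rightarrow> 's::euclidean_space" and \<psi> :: "'s \<Rightarrow> 'a"
  assumes p: "p \<in> M" and \<phi>: "linear \<phi>" and \<psi>: "linear \<psi>" and \<phi>\<psi>: "\<And>z. \<phi> (\<psi> z) = z"
    and \<psi>F: "\<psi> (\<phi> (F p)) = F p" and \<psi>_N: "\<And>z. orth_proj (nor M F p) (\<psi> z) = 0"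
    and inner: "\<And>z. \<psi> z \<bullet> F p = z \<bullet> \<phi> (F p)" and norm: "\<And>q. q \<in> M \<Longrightarrow> norm (\<phi> (F q)) = 1"
  obtains V \<gamma> where "open V" "\<phi> (F p) \<in> V" "smooth_open V \<gamma>" "\<gamma> ` V \<subseteq> M" "\<gamma> (\<phi> (F p)) = p"
    "\<And>y. y \<in> V \<Longrightarrow> norm y = 1 \<Longrightarrow> \<phi> (F (\<gamma> y)) = y"
proof -
  obtain W and \<rho> :: "'b \<Rightarrow> 'b" and A x0 where fr: "frame W \<rho> A" "x0 \<in> W" "\<rho> x0 = p"
    by (rule frame_at[OF p])
  note W = frame_open[OF fr(1)]
  define y0 where "y0 = \<phi> (F p)"
  have y0: "y0 \<bullet> y0 = 1" using norm[OF p] by (simp add: y0_def dot_square_norm)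
  \<comment> \<open>Lifts the tangential part of \<open>\<psi> z\<close> to the parameter domain. It
    kills \<open>y0\<close>, because \<open>F p\<close> has no tangential part.\<close>
  define \<iota> where "\<iota> z = A x0 (P p (\<psi> z))" for z
  have lin: "linear \<iota>"
    using linear_compose[OF linear_compose[OF \<psi> linear_P[OF p]] frame_linear_A[OF fr(1,2)]]
    by (simp add: \<iota>_def[abs_def] o_def)
  have \<iota>0: "\<iota> y0 = 0"
    using linear_0[OF frame_linear_A[OF fr(1,2)]] by (simp add: \<iota>_def y0_def \<psi>F P_F[OF p])
  have bl: "bounded_linear \<iota>" "bounded_linear \<phi>" using lin \<phi> linear_conv_bounded_linear by auto
  have smooth_open_aff: "smooth_open UNIV (\<lambda>z. x0 + \<iota> z)" by (intro smooth_open_add smooth_open_linear bl smooth_open_const open_UNIV)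
  define X where "X = (\<lambda>z. x0 + \<iota> z) -` W"
  have X: "open X" using open_vimage_sm[OF open_UNIV smooth_open_aff W] by (simp add: X_def)
  have y0X: "y0 \<in> X" using fr(2) \<iota>0 by (simp add: X_def)
  define k where "k z = \<phi> (F (\<rho> (x0 + \<iota> z)))" for z
  have sm\<phi>F: "smooth_open W (\<lambda>x. \<phi> (F (\<rho> x)))"
    by (rule smooth_open_compose[OF W open_UNIV subset_UNIV frame_sm[OF fr(1) smooth_F] smooth_open_linear[OF bl(2)]])
  have smk: "smooth_open X k"
    unfolding k_def by (rule smooth_open_compose[OF X W _ smooth_open_subset[OF smooth_open_aff] sm\<phi>F]) (auto simp: X_def)
  define G where "G z = (y0 \<bullet> z) *\<^sub>R k z" for z
  have smG: "smooth_open X G"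
    unfolding G_def[abs_def] by (intro smooth_open_scaleR smooth_open_inner smooth_open_const smooth_open_ident X smk)
  have ky0: "k y0 = y0" using \<iota>0 fr(3) by (simp add: k_def y0_def)
  have Gy0: "G y0 = y0" by (simp add: G_def ky0 y0)
  have "fderiv G y0 z = z" for z
  proof -
    have d\<iota>: "((\<lambda>z. x0 + \<iota> z) has_derivative \<iota>) (at y0)"
      using has_derivative_add[OF has_derivative_const bounded_linear_imp_has_derivative[OF bl(1)]] by simp
    have dh: "((\<lambda>x. F (\<rho> x)) has_derivative fderiv (\<lambda>x. F (\<rho> x)) x0) (at (x0 + \<iota> y0))"
      using smooth_openD_deriv[OF frame_sm[OF fr(1) smooth_F] fr(2)] \<iota>0 by simp
    have "(k has_derivative (\<lambda>z. \<phi> (fderiv (\<lambda>x. F (\<rho> x)) x0 (\<iota> z)))) (at y0)"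
      unfolding k_def[abs_def]
      by (rule bounded_linear.has_derivative[OF bl(2) has_derivative_compose[OF d\<iota> dh]])
    then have "(G has_derivative (\<lambda>z. (y0 \<bullet> y0) *\<^sub>R \<phi> (fderiv (\<lambda>x. F (\<rho> x)) x0 (\<iota> z)) + (y0 \<bullet> z) *\<^sub>R k y0)) (at y0)"
      unfolding G_def[abs_def] by (auto intro!: derivative_eq_intros)
    from fun_cong[OF fderiv_eq[OF this], of z]
    have "fderiv G y0 z = \<phi> (fderiv (\<lambda>x. F (\<rho> x)) x0 (\<iota> z)) + (y0 \<bullet> z) *\<^sub>R y0" by (simp add: y0 ky0)
    also have "fderiv (\<lambda>x. F (\<rho> x)) x0 (\<iota> z) = P p (\<psi> z)"
      unfolding \<iota>_def using frame_P[OF fr(1,2), of "P p (\<psi> z)"] fr(3) P_P[OF p] by simp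
    also have "\<phi> (P p (\<psi> z)) + (y0 \<bullet> z) *\<^sub>R y0 = \<phi> (P p (\<psi> z) + (\<psi> z \<bullet> F p) *\<^sub>R F p)"
      using inner[of z] by (simp add: linear_add[OF \<phi>] linear_scale[OF \<phi>] y0_def inner_commute)
    \<comment> \<open>\<open>\<psi> z\<close> has no component in \<open>nor M F p\<close>, so its
      tangential part and its part along \<open>F p\<close> make up all of it.\<close>
    also have "P p (\<psi> z) + (\<psi> z \<bullet> F p) *\<^sub>R F p = \<psi> z"
      using \<psi>_N[of z] by (simp add: N_eq[OF p] algebra_simps)
    finally show ?thesis by (simp add: \<phi>\<psi>)
  qed
  then have "inj (fderiv G y0)" by (simp add: inj_def)
  then obtain X' V k' where IFT: "open X'" "X' \<subseteq> X" "y0 \<in> X'" "open V" "G y0 \<in> V" "homeomorphism X' V G k'" "smooth_open V k'"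
    by (rule smooth_inverse_function[OF X y0X smG])
  \<comment> \<open>For unit \<open>y\<close> the equation \<open>G z = y\<close> forces
    \<open>y0 \<bullet> z\<close> to be 1 or -1; the half-space selects 1.\<close>
  define V' where "V' = V \<inter> k' -` {z. 0 < y0 \<bullet> z}"
  have V': "open V'"
    unfolding V'_def by (rule open_vimage_sm[OF IFT(4,7) open_halfspace_gt])
  have k'y0: "k' y0 = y0" using homeomorphism_apply1[OF IFT(6,3)] Gy0 by simp
  have k'X: "k' y \<in> X" "G (k' y) = y" if "y \<in> V'" for y
    using that IFT(2) homeomorphism_image2[OF IFT(6)] homeomorphism_apply2[OF IFT(6)] unfolding V'_def by auto
  define \<gamma> where "\<gamma> y = \<rho> (x0 + \<iota> (k' y))" for y
  have im: "(\<lambda>y. x0 + \<iota> (k' y)) ` V' \<subseteq> W" using k'X by (auto simp: X_def)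
  have "smooth_open V' (\<lambda>y. x0 + \<iota> (k' y))"
    by (rule smooth_open_compose[OF V' open_UNIV subset_UNIV _ smooth_open_aff]) (rule smooth_open_subset[OF IFT(7)], simp add: V'_def)
  moreover have "smooth_open W \<rho>" using fr(1) by (simp add: frame_def param_def)
  ultimately have sm\<gamma>: "smooth_open V' \<gamma>"
    unfolding \<gamma>_def[abs_def] by (rule smooth_open_compose[OF V' W im])
  have \<gamma>M: "\<gamma> ` V' \<subseteq> M" using im frame_M[OF fr(1)] by (auto simp: \<gamma>_def)
  show thesis
  proof (rule that[OF V' _ sm\<gamma> \<gamma>M])
    show "\<phi> (F p) \<in> V'" using IFT(5) Gy0 y0 k'y0 by (simp add: V'_def y0_def[symmetric])
    show "\<gamma> (\<phi> (F p)) = p" using k'y0 \<iota>0 fr(3) by (simp add: \<gamma>_def y0_def[symmetric])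
    fix y assume y: "y \<in> V'" "norm y = 1"
    let ?z = "k' y"
    have "\<gamma> y \<in> M" using \<gamma>M y by blast
    then have "norm (k ?z) = 1" using norm unfolding k_def \<gamma>_def by blast
    moreover have "norm (G ?z) = 1" using k'X(2)[OF y(1)] y(2) by simp
    moreover have "0 < y0 \<bullet> ?z" using y(1) by (simp add: V'_def)
    ultimately have "y0 \<bullet> ?z = 1" by (simp add: G_def)
    then show "\<phi> (F (\<gamma> y)) = y" using k'X(2)[OF y(1)] by (simp add: G_def k_def \<gamma>_def)
  qed
qed

text \<open>\<open>\<sigma>\<close> after \<open>\<gamma>\<close> maps an open part of an
  \<open>m\<close>-dimensional sphere injectively into the \<open>m\<close>-dimensional
  \<open>L\<close>. Invariance of domain makes the image open there, hence the image of
  \<open>\<gamma>\<close> open in \<open>M\<close>, with inverse \<open>f\<close>.\<close>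

lemma section_image_open:
  fixes f :: "'b \<Rightarrow> 's::euclidean_space"
  assumes p: "p \<in> M" and f: "continuous_on M f" "f ` M \<subseteq> sphere 0 1" and dim: "DIM('s) = m + 1"
    and V: "open V" "f p \<in> V" "smooth_open V \<gamma>" "\<gamma> ` V \<subseteq> M" "\<gamma> (f p) = p" "\<And>y. y \<in> V \<Longrightarrow> norm y = 1 \<Longrightarrow> f (\<gamma> y) = y"
  shows "\<exists>U T g. openin (top_of_set M) U \<and> p \<in> U \<and> openin (top_of_set (sphere 0 1)) T \<and> homeomorphism U T f g"
proof -
  obtain W and \<rho> :: "'b \<Rightarrow> 'b" and L U \<sigma> where L: "subspace L" "dim L = m"
    and U: "open U" "p \<in> U" "smooth_open U \<sigma>" "\<sigma> ` U \<subseteq> W \<inter> L" "\<And>q. q \<in> M \<Longrightarrow> q \<in> U \<Longrightarrow> \<rho> (\<sigma> q) = q"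
    using slice_chart[OF embedded p] by metis
  define T where "T = (V \<inter> \<gamma> -` U) \<inter> sphere 0 1"
  have oV: "open (V \<inter> \<gamma> -` U)" by (rule open_vimage_sm[OF V(1,3) U(1)])
  have oT: "openin (top_of_set (sphere 0 1)) T" unfolding T_def using oV by (auto simp: openin_open)
  have f\<gamma>: "f (\<gamma> y) = y" "\<gamma> y \<in> M" "\<gamma> y \<in> U" if "y \<in> T" for y using that V unfolding T_def by auto
  have c\<gamma>: "continuous_on T \<gamma>" using smooth_openD_cont[OF V(3)] by (rule continuous_on_subset) (auto simp: T_def)
  have c\<sigma>: "continuous_on T (\<lambda>y. \<sigma> (\<gamma> y))"
    by (rule continuous_on_compose2[OF smooth_openD_cont[OF U(3)] c\<gamma>]) (use f\<gamma> in auto)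
  have op: "openin (top_of_set L) ((\<lambda>y. \<sigma> (\<gamma> y)) ` T)"
  proof (rule invariance_of_domain_sphere_affine_set[OF c\<sigma>])
    show "(\<lambda>y. \<sigma> (\<gamma> y)) \<in> T \<rightarrow> L" using f\<gamma> U(4) by auto
    show "inj_on (\<lambda>y. \<sigma> (\<gamma> y)) T" using f\<gamma> U(5) by (intro inj_onI) metis
    show "affine L" using L(1) by (rule subspace_imp_affine)
    show "aff_dim L < int (DIM('s))" using L dim by (simp add: aff_dim_subspace)
    show "openin (top_of_set (sphere 0 1)) T" by (rule oT)
  qed simp
  then obtain Q where Q: "open Q" "(\<lambda>y. \<sigma> (\<gamma> y)) ` T = L \<inter> Q" by (auto simp: openin_open)
  have "\<gamma> ` T = M \<inter> (U \<inter> \<sigma> -` Q)"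
  proof (intro equalityI subsetI)
    fix q assume "q \<in> \<gamma> ` T"
    then show "q \<in> M \<inter> (U \<inter> \<sigma> -` Q)" using f\<gamma> Q(2) by blast
  next
    fix q assume q: "q \<in> M \<inter> (U \<inter> \<sigma> -` Q)"
    then have "\<sigma> q \<in> (\<lambda>y. \<sigma> (\<gamma> y)) ` T" unfolding Q(2) using U(4) by auto
    then obtain y where y: "y \<in> T" "\<sigma> q = \<sigma> (\<gamma> y)" by auto
    then have "q = \<gamma> y" using U(5)[of q] U(5)[of "\<gamma> y"] f\<gamma> q by auto
    then show "q \<in> \<gamma> ` T" using y by auto
  qed
  then have oU: "openin (top_of_set M) (\<gamma> ` T)"
    using open_vimage_sm[OF U(1,3) Q(1)] by (auto simp: openin_open)
  have "f p \<in> T" using V U f(2) p unfolding T_def by auto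
  then have pU: "p \<in> \<gamma> ` T" using V(5) by (metis image_eqI)
  have "homeomorphism (\<gamma> ` T) T f \<gamma>"
    unfolding homeomorphism_def
    using f\<gamma> c\<gamma> continuous_on_subset[OF f(1), of "\<gamma> ` T"] by (auto simp: image_image)
  then show ?thesis using oU pU oT by blast
qed

text \<open>The complement \<open>K\<close> of the constant normal space has dimension
  \<open>m + 1\<close> and contains the image of \<open>F\<close>; \<open>f\<close> is
  \<open>F\<close> in orthonormal coordinates of \<open>K\<close>. The image of \<open>f\<close> in
  the connected sphere is open by the local sections and closed by compactness.\<close>

lemma isometric_to_sphere:
  assumes min: "minimal M F" and n: "DIM('a) = n + 1" and dim: "DIM('s::euclidean_space) = m + 1" and m1: "1 \<le> m"
    and eq: "edim (eigenspace M F (- real m)) = enat (n - m)" and ne: "M \<noteq> {}"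
    and M: "compact M" "inj_on F M \<or> connected M \<and> 2 \<le> m"
  shows "isometric_to M F (sphere (0::'s) 1)"
proof -
  obtain p0 where p0: "p0 \<in> M" using ne by blast
  let ?N = "nor M F p0"
  have norN: "nor M F q = ?N" if "q \<in> M" for q by (rule nor_const[OF min n eq p0 that])
  define K where "K = {y \<in> UNIV. \<forall>x\<in>?N. orthogonal x y}"
  have subK: "subspace K"
    unfolding K_def by (auto simp: subspace_def orthogonal_def inner_add_right)
  have "dim K + dim ?N = dim (UNIV :: 'a set)"
    unfolding K_def by (rule dim_subspace_orthogonal_to_vectors[OF subspace_nor[OF p0]]) auto
  then have dimK: "dim K = dim (UNIV :: 's set)" using dim_nor[OF n p0] n dim by simp
  obtain \<phi> :: "'a \<Rightarrow> 's" and \<psi> where \<phi>: "linear \<phi>" and \<psi>: "linear \<psi>" and im: "\<phi> ` K = UNIV" "\<psi> ` UNIV = K"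
    and nrm: "\<And>x. x \<in> K \<Longrightarrow> norm (\<phi> x) = norm x" and \<psi>\<phi>: "\<And>x. x \<in> K \<Longrightarrow> \<psi> (\<phi> x) = x" and \<phi>\<psi>: "\<And>z. \<phi> (\<psi> z) = z"
    using isometries_subspaces[OF subK subspace_UNIV dimK] by (metis UNIV_I)
  have inner: "\<phi> x \<bullet> \<phi> y = x \<bullet> y" if "x \<in> K" "y \<in> K" for x y
    using that nrm[OF subspace_add[OF subK that]] by (simp add: dot_norm nrm linear_add[OF \<phi>])
  have KI: "v \<in> K" if "\<And>w. w \<in> ?N \<Longrightarrow> v \<bullet> w = 0" for v
    using that by (simp add: K_def orthogonal_def inner_commute)
  have FK: "F q \<in> K" if q: "q \<in> M" for q
  proof (rule KI)
    fix w assume "w \<in> ?N"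
    then have "w \<bullet> F q = 0" using norN[OF q] nor_eq[OF q] by blast
    then show "F q \<bullet> w = 0" by (simp add: inner_commute)
  qed
  have tK: "tang M F q \<subseteq> K" if q: "q \<in> M" for q
  proof (intro subsetI KI)
    fix v w assume "v \<in> tang M F q" "w \<in> ?N"
    then have "w \<bullet> v = 0" using norN[OF q] unfolding nor_def by blast
    then show "v \<bullet> w = 0" by (simp add: inner_commute)
  qed
  have \<psi>K: "\<psi> z \<in> K" for z using im by blast
  have \<psi>N: "orth_proj (nor M F q) (\<psi> z) = 0" if q: "q \<in> M" for q z
  proof (rule orth_proj_eq_0[OF subspace_nor[OF q]])
    fix w assume "w \<in> nor M F q"
    then have "orthogonal w (\<psi> z)" using \<psi>K[of z] norN[OF q] unfolding K_def by blast
    then show "\<psi> z \<bullet> w = 0" by (simp add: orthogonal_def inner_commute)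
  qed
  define f where "f q = \<phi> (F q)" for q
  have blphi: "bounded_linear \<phi>" using \<phi> linear_conv_bounded_linear by auto
  have "smooth_on UNIV \<phi>" using smooth_open_linear[OF blphi] by (simp add: smooth_on_open_iff)
  then have smf: "smooth_on M f"
    unfolding f_def[abs_def] by (intro smooth_on_compose[OF smooth_F]) auto
  have cf: "continuous_on M f" by (rule smooth_on_continuous[OF smf])
  have normf: "norm (f q) = 1" if "q \<in> M" for q using that nrm[OF FK] F_sphere by (simp add: f_def)
  then have fS: "f ` M \<subseteq> sphere 0 1" by auto
  have sec: "\<exists>V \<gamma>. open V \<and> f p \<in> V \<and> smooth_open V \<gamma> \<and> \<gamma> ` V \<subseteq> M \<and> \<gamma> (f p) = p \<and>
    (\<forall>y\<in>V. norm y = 1 \<longrightarrow> f (\<gamma> y) = y)" if p: "p \<in> M" for p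
  proof -
    have in1: "\<psi> z \<bullet> F p = z \<bullet> \<phi> (F p)" for z using inner[OF \<psi>K FK[OF p], of z] by (simp add: \<phi>\<psi>)
    obtain V \<gamma> where V: "open V" "\<phi> (F p) \<in> V" "smooth_open V \<gamma>" "\<gamma> ` V \<subseteq> M" "\<gamma> (\<phi> (F p)) = p"
      "\<And>y. y \<in> V \<Longrightarrow> norm y = 1 \<Longrightarrow> \<phi> (F (\<gamma> y)) = y"
      using local_section[OF p \<phi> \<psi> \<phi>\<psi> \<psi>\<phi>[OF FK[OF p]] \<psi>N[OF p] in1 normf[unfolded f_def]] by metis
    then show ?thesis unfolding f_def by (intro exI[of _ V] exI[of _ \<gamma>]) auto
  qed
  have loc: "\<exists>U T g. openin (top_of_set M) U \<and> p \<in> U \<and> openin (top_of_set (sphere 0 1)) T \<and> homeomorphism U T f g"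
    if p: "p \<in> M" for p
  proof -
    obtain V \<gamma> where V: "open V" "f p \<in> V" "smooth_open V \<gamma>" "\<gamma> ` V \<subseteq> M" "\<gamma> (f p) = p"
      "\<And>y. y \<in> V \<Longrightarrow> norm y = 1 \<Longrightarrow> f (\<gamma> y) = y"
      using sec[OF p] by blast
    show ?thesis by (rule section_image_open[OF p cf fS dim V])
  qed
  have surj: "f ` M = sphere 0 1"
  proof -
    have "openin (top_of_set (sphere 0 1)) (f ` M)"
    proof (subst openin_subopen, intro ballI)
      fix y assume "y \<in> f ` M"
      then obtain p where p: "p \<in> M" "y = f p" by auto
      obtain U T g where U: "openin (top_of_set M) U" "p \<in> U" "openin (top_of_set (sphere 0 1)) T" "homeomorphism U T f g"
        using loc[OF p(1)] by blast
      then show "\<exists>T. openin (top_of_set (sphere 0 1)) T \<and> y \<in> T \<and> T \<subseteq> f ` M"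
        using p homeomorphism_image1[OF U(4)] openin_imp_subset[OF U(1)] by blast
    qed
    moreover have "closedin (top_of_set (sphere 0 1)) (f ` M)"
      using compact_continuous_image[OF cf M(1)] fS by (simp add: closed_subset compact_imp_closed)
    moreover have "connected (sphere (0::'s) 1)" by (rule connected_sphere) (use dim m1 in simp)
    ultimately show ?thesis using ne by (auto simp: connected_clopen)
  qed
  have injf: "inj_on f M"
    using M(2)
  proof
    assume i: "inj_on F M"
    show ?thesis
    proof (rule inj_onI)
      fix q q' assume "q \<in> M" "q' \<in> M" "f q = f q'"
      then have "F q = F q'" using \<psi>\<phi>[OF FK] unfolding f_def by metis
      then show "q = q'" using i \<open>q \<in> M\<close> \<open>q' \<in> M\<close> by (auto dest: inj_onD)
    qed
  next
    \<comment> \<open>Here \<open>DIM('s)\<close> is at least 3, so the sphere is simply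
      connected.\<close>
    assume c: "connected M \<and> 2 \<le> m"
    have "covering_space M f (sphere 0 1)"
      by (rule compact_local_homeomorphism_covering[OF M(1) cf surj loc])
    then show ?thesis by (rule compact_covering_injective) (use c dim in auto)
  qed
  obtain g where hom: "homeomorphism M (sphere 0 1) f g"
    using homeomorphism_compact[OF M(1) cf surj injf] by blast
  \<comment> \<open>Near each point \<open>g\<close> agrees with a smooth local section, because
    \<open>g\<close> undoes \<open>f\<close> on all of \<open>M\<close>.\<close>
  have smg: "smooth_on (sphere 0 1) g"
  proof (rule smooth_onI)
    fix y :: 's assume y: "y \<in> sphere 0 1"
    then have "y \<in> f ` M" unfolding surj .
    then obtain p where p: "p \<in> M" "y = f p" by blast
    obtain V \<gamma> where V: "open V" "f p \<in> V" "smooth_open V \<gamma>" "\<gamma> ` V \<subseteq> M" "\<gamma> (f p) = p"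
      "\<And>y. y \<in> V \<Longrightarrow> norm y = 1 \<Longrightarrow> f (\<gamma> y) = y"
      using sec[OF p(1)] by blast
    have "g x = \<gamma> x" if "x \<in> sphere 0 1 \<inter> V" for x
    proof -
      have "f (\<gamma> x) = x" "\<gamma> x \<in> M" using V that by auto
      then show ?thesis using homeomorphism_apply1[OF hom] by metis
    qed
    then show "\<exists>U h. open U \<and> y \<in> U \<and> smooth_open U h \<and> (\<forall>q\<in>sphere 0 1 \<inter> U. g q = h q)"
      using V p by (intro exI[of _ V] exI[of _ \<gamma>]) auto
  qed
  have met: "differential M f q x \<bullet> differential M f q y = differential M F q x \<bullet> differential M F q y"
    if q: "q \<in> M" and x: "x \<in> tangent_space M q" and y: "y \<in> tangent_space M q" for q x y
  proof -
    have d: "(f has_derivative (\<lambda>v. \<phi> (differential M F q v))) (at q within M)"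
      unfolding f_def[abs_def] by (rule bounded_linear.has_derivative[OF blphi has_derivative_differential[OF smooth_F q]])
    have "differential M F q v \<in> K" if "v \<in> tangent_space M q" for v
      using tK[OF q] that unfolding tang_def by blast
    then show ?thesis
      unfolding differential_unique[OF d x] differential_unique[OF d y] using x y by (intro inner)
  qed
  show ?thesis
    unfolding isometric_to_def using hom smf smg met by blast
qed

end

text \<open>The condition for \<open>m = 1\<close> excludes a circle that winds several times around
  a great circle: there the dimensions agree, but the length is wrong. For \<open>m = n\<close> the
  normal spaces are zero and there are no eigenvalues, so that \<open>lambda1\<close> is an infimum
  over the empty set.\<close>

theorem theorem4p1:
  fixes M :: "'b::euclidean_space set"
    and F :: "'b \<Rightarrow> 'a::euclidean_space"
    and m n :: nat
  assumes "DIM('a) = n + 1"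
    and "DIM('s::euclidean_space) = m + 1"
    and "1 \<le> m"
    and "immersed_in_sphere m M F"
    and "M \<noteq> {}"
    and "minimal M F"
  shows "edim (eigenspace M F (- real m)) \<ge> enat (n - m)
    \<and> (compact M \<and> (inj_on F M \<or> connected M \<and> 2 \<le> m) \<longrightarrow>
         (edim (eigenspace M F (- real m)) = enat (n - m) \<longleftrightarrow>
          isometric_to M F (sphere (0::'s) 1)))
    \<and> (m < n \<longrightarrow> lambda1 M F \<le> ereal (- real m))"
proof -
  interpret immersed_submanifold m M F by unfold_locales (rule assms(4))
  have ge: "enat (n - m) \<le> edim (eigenspace M F (- real m))"
    by (rule edim_eigenspace_ge[OF assms(6,5,1)])
  have "edim (eigenspace M F (- real m)) = enat (n - m)" if iso: "isometric_to M F (sphere (0::'s) 1)"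
  proof -
    obtain f g where fg: "homeomorphism M (sphere (0::'s) 1) f g" "smooth_on M f" "smooth_on (sphere 0 1) g"
      "\<forall>p\<in>M. \<forall>x\<in>tangent_space M p. \<forall>y\<in>tangent_space M p.
        differential M f p x \<bullet> differential M f p y = differential M F p x \<bullet> differential M F p y"
      using iso unfolding isometric_to_def by blast
    interpret sphere_isometric m M F f g
      by unfold_locales (use fg assms in auto)
    show ?thesis using edim_eigenspace_le[OF assms(1,5)] ge by (rule antisym)
  qed
  then show ?thesis
    using ge lambda1_le[OF assms(6,5,1)] isometric_to_sphere[OF assms(6,1,2,3) _ assms(5)] by blast
qed

end
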